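(* Let $v:\mathbb Z\to\mathbb{RP}^3$ be a polygon and $c:\mathbb Z\to\mathbb{RP}^3$ a companion polygon, let $u,b$ be the (same) affine coordinates of $v,c$, and let $T$ be the short diagonal hyperplane map dynamics. Consider the square lattice with face weights $(a_{i,j})_{(i,j)\in\mathbb Z^2}$ given by $$a_{i,j}=\begin{cases}b_{i+j-\lfloor\frac{i-j}{4}\rfloor}&\text{if }[i-j]_4\in\{0,3\},\\ T(u)_{i+j-\lfloor\frac{i-j}{4}\rfloor}&\text{if }[i-j]_4=1,\\ u_{i+j-\lfloor\frac{i-j}{4}\rfloor}&\text{if }[i-j]_4=2.\end{cases}$$ Then, for all $(i,k)\in\mathbb Z^2$ such that $k\ge1$, $$T^k(u)_i=\begin{cases}Y\bigl(A_{2k-2}(\tfrac i2+k+2,\tfrac i2-k-1),a\bigr)&\text{if }[i]_2=0,\\ Y\bigl(A_{2k-2}(\tfrac{i-1}2+k,\tfrac{i-1}2-k+1),a\bigr)&\text{if }[i]_2=1.\end{cases}$$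
   Context: $[n]_q\in\{0,\dots,q-1\}$ is the residue of $n$ modulo $q$. For $[r]=[r_0,r_1,r_2,r_3]\in\mathbb{RP}^3$ and $\ell\in\{0,1,2\}$, the $\ell$-th affine coordinate is $\pi_\ell([r])=r_\ell/r_3\in\mathbb R\cup\{\infty\}$. Fix $\ell$; $u_i=\pi_\ell(v_i)$, $b_i=\pi_\ell(c_i)$, and $T^k(u)_i=\pi_\ell(T^k(v)_i)$. Given a polygon $(v_i)_{i\in\mathbb Z}$ in $\mathbb{RP}^3$, a companion polygon is $(c_i)_{i\in\mathbb Z}$ such that for all $i$, $c_i$ is on the line $v_{i-1}v_{i+1}$ and on the plane spanned by $v_{i-2},v_i,c_{i-2}$. The short diagonal hyperplane map dynamics $T$ acts by $$T(v)_i=v_{i-1}v_{i+1}\cap v_{i-2}v_iv_{i+2},\qquad T(c)_i=c_{i-1}c_{i+1}\cap T(v)_{i-1}T(v)_{i+1},$$ where $v_iv_j$ is the line through two points and $v_iv_jv_k$ the plane through three points. Ratio function of oriented dimers. Consider the square lattice whose faces are the unit squares centered at the points of $\mathbb Z^2$, face $(i,j)$ carrying the weight $a_{i,j}$. For $k\ge1$, the Aztec diamond $A_k(i,j)$ of size $k$ centered at the face $(i,j)$ is the subgraph formed by the vertices and edges of its internal faces, which are the faces $(i',j')$ with $|i'-i|+|j'-j|<k$; its open faces are the $(i',j')$ with $|i'-i|+|j'-j|=k$; $F$ is the set of all internal and open faces. The graph is bipartite. A Kasteleyn orientation is a skew-symmetric function $\varphi$ from directed edges to $\{-1,1\}$ such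 that for every internal face $f$, $\prod_{wb\in\partial f}\varphi_{(w,b)}=-1$ (product over the four boundary edges, each directed from white to black). An oriented dimer configuration $\vec{M}$ is a set of directed edges whose undirected version is a perfect matching (each matched edge carrying exactly one direction). Its weight is $\prod_{\vec e\in\vec M}\varphi_{\vec e}\,a_{f(\vec e)}$, where $f(\vec e)\in F$ is the face to the right of $\vec e$. $Z(A,a,\varphi)$ is the sum of the weights of all oriented dimer configurations of $A$, and $Y(A,a)=\bigl(\prod_{f\in F}a_f\bigr)\frac{Z(A,a^{-1},\varphi)}{Z(A,a,\varphi)}$, where $a^{-1}$ denotes the inverse face weights; this does not depend on $\varphi$. For size $0$, $Y(A_0(i,j),a)=a_{i,j}$. $Y$ is regarded as a rational function of the face weights. Standing assumption: the data are generic, so that all expressions are well defined. *)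

theory Defs
  imports "HOL-Analysis.Analysis"
begin

section \<open>Polygons in real projective 3-space\<close>

text \<open>
  A point of \<open>\<real>\<P>\<^sup>3\<close> is a one-dimensional linear subspace of \<open>\<real>\<^sup>4\<close>, and the projective
  subspace spanned by some points is the linear span of their union; intersection of projective
  subspaces is intersection of sets.  The homogeneous coordinates of a vector \<open>r\<close> are
  \<open>r $ 0, r $ 1, r $ 2, r $ 3\<close> (the type \<open>4\<close> of indices consists of 0, 1, 2, 3).
\<close>

type_synonym polygon = "int \<Rightarrow> (real ^ 4) set"

definition RP3 :: "(real ^ 4) set set" where
  "RP3 = {L. subspace L \<and> dim L = 1}"

definition line_through :: "(real ^ 4) set \<Rightarrow> (real ^ 4) set \<Rightarrow> (real ^ 4) set" where
  "line_through p q = span (p \<union> q)"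

definition plane_through ::
    "(real ^ 4) set \<Rightarrow> (real ^ 4) set \<Rightarrow> (real ^ 4) set \<Rightarrow> (real ^ 4) set" where
  "plane_through p q r = span (p \<union> q \<union> r)"

definition at_infinity :: "(real ^ 4) set \<Rightarrow> bool" where
  "at_infinity p \<longleftrightarrow> (\<forall>r\<in>p. r $ 3 = 0)"

text \<open>
  The affine coordinate \<open>r $ l / r $ 3\<close> does not depend on the representative \<open>r\<close>.  It is
  meaningful only for points that are not \<open>at_infinity\<close>; the value \<open>\<infinity>\<close> is excluded below by
  the general position assumption.
\<close>

definition affine_coord :: "4 \<Rightarrow> (real ^ 4) set \<Rightarrow> real" where
  "affine_coord l p = (THE x. \<forall>r\<in>p. r \<noteq> 0 \<longrightarrow> x = r $ l / r $ 3)"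

definition companion :: "polygon \<Rightarrow> polygon \<Rightarrow> bool" where
  "companion v c \<longleftrightarrow>
     (\<forall>i. c i \<in> RP3 \<and>
          c i \<subseteq> line_through (v (i - 1)) (v (i + 1)) \<and>
          c i \<subseteq> plane_through (v (i - 2)) (v i) (c (i - 2)))"

definition shd_polygon :: "polygon \<Rightarrow> polygon" where
  "shd_polygon v = (\<lambda>i. line_through (v (i - 1)) (v (i + 1)) \<inter>
                        plane_through (v (i - 2)) (v i) (v (i + 2)))"

definition shd_companion :: "polygon \<Rightarrow> polygon \<Rightarrow> polygon" where
  "shd_companion v c =
     (\<lambda>i. line_through (c (i - 1)) (c (i + 1)) \<inter>
          line_through (shd_polygon v (i - 1)) (shd_polygon v (i + 1)))"

text \<open>The prefix \<open>shd\<close> stands for the short diagonal hyperplane map.\<close>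

definition shd_map :: "polygon \<times> polygon \<Rightarrow> polygon \<times> polygon" where
  "shd_map = (\<lambda>(v, c). (shd_polygon v, shd_companion v c))"

text \<open>
  The constructions above are total on sets of vectors.  They have their geometric meaning when
  all spans involved have the expected dimension and the intersections are single points.
\<close>

definition shd_map_defined :: "polygon \<times> polygon \<Rightarrow> bool" where
  "shd_map_defined = (\<lambda>(v, c). \<forall>i.
     dim (line_through (v (i - 1)) (v (i + 1))) = 2 \<and>
     dim (plane_through (v (i - 2)) (v i) (v (i + 2))) = 3 \<and>
     dim (shd_polygon v i) = 1 \<and>
     dim (line_through (c (i - 1)) (c (i + 1))) = 2 \<and>
     dim (line_through (shd_polygon v (i - 1)) (shd_polygon v (i + 1))) = 2 \<and>
     dim (shd_companion v c i) = 1)"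

text \<open>
  Genericity of the geometric data: the planes in the definition of a companion polygon are
  planes and meet the corresponding lines in single points, all iterates of the dynamics are
  defined, and all affine coordinates of \<open>c\<close> and of the iterates of \<open>v\<close> are finite.
\<close>

definition general_position :: "polygon \<Rightarrow> polygon \<Rightarrow> bool" where
  "general_position v c \<longleftrightarrow>
     (\<forall>i. dim (plane_through (v (i - 2)) (v i) (c (i - 2))) = 3 \<and>
          dim (line_through (v (i - 1)) (v (i + 1)) \<inter>
               plane_through (v (i - 2)) (v i) (c (i - 2))) = 1) \<and>
     (\<forall>k. shd_map_defined ((shd_map ^^ k) (v, c))) \<and>
     (\<forall>k i. \<not> at_infinity (fst ((shd_map ^^ k) (v, c)) i)) \<and>
     (\<forall>i. \<not> at_infinity (c i))"

section \<open>Oriented dimers on Aztec diamonds\<close>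

text \<open>
  Face \<open>(i, j)\<close> of the square lattice is the unit square centred at the point \<open>(i, j)\<close>.  The
  lattice vertex at the point \<open>(x + 1/2, y + 1/2)\<close> is encoded by the pair of integers \<open>(x, y)\<close>.
  A directed edge is the pair of its start and its end.
\<close>

type_synonym face = "int \<times> int"
type_synonym vertex = "int \<times> int"
type_synonym dedge = "vertex \<times> vertex"

fun adjacent :: "vertex \<Rightarrow> vertex \<Rightarrow> bool" where
  "adjacent (x, y) (x', y') \<longleftrightarrow> \<bar>x' - x\<bar> + \<bar>y' - y\<bar> = 1"

fun white :: "vertex \<Rightarrow> bool" where
  "white (x, y) \<longleftrightarrow> even (x + y)"

fun corners :: "face \<Rightarrow> vertex set" where
  "corners (i, j) = {i - 1, i} \<times> {j - 1, j}"

definition face_edges :: "face \<Rightarrow> dedge set" where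
  "face_edges f = {(p, q). p \<in> corners f \<and> q \<in> corners f \<and> adjacent p q}"

text \<open>
  The midpoint of the edge from \<open>(x, y)\<close> to \<open>(x', y')\<close> is \<open>((x + x' + 1)/2, (y + y' + 1)/2)\<close>,
  and the centre of the face to its right is obtained by adding half of the direction
  \<open>(x' - x, y' - y)\<close> turned clockwise by a right angle.  Both divisions are exact.
\<close>

fun right_face :: "dedge \<Rightarrow> face" where
  "right_face ((x, y), (x', y')) =
     ((x + x' + 1 + (y' - y)) div 2, (y + y' + 1 - (x' - x)) div 2)"

fun grid_dist :: "face \<Rightarrow> face \<Rightarrow> int" where
  "grid_dist (i, j) (i', j') = \<bar>i' - i\<bar> + \<bar>j' - j\<bar>"

definition internal_faces :: "nat \<Rightarrow> face \<Rightarrow> face set" where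
  "internal_faces n z = {f. grid_dist z f < int n}"

definition open_faces :: "nat \<Rightarrow> face \<Rightarrow> face set" where
  "open_faces n z = {f. grid_dist z f = int n}"

definition aztec_faces :: "nat \<Rightarrow> face \<Rightarrow> face set" where
  "aztec_faces n z = internal_faces n z \<union> open_faces n z"

definition aztec_vertices :: "nat \<Rightarrow> face \<Rightarrow> vertex set" where
  "aztec_vertices n z = (\<Union>f\<in>internal_faces n z. corners f)"

definition aztec_edges :: "nat \<Rightarrow> face \<Rightarrow> dedge set" where
  "aztec_edges n z = (\<Union>f\<in>internal_faces n z. face_edges f)"

definition kasteleyn_orientation :: "nat \<Rightarrow> face \<Rightarrow> (dedge \<Rightarrow> real) \<Rightarrow> bool" where
  "kasteleyn_orientation n z \<phi> \<longleftrightarrow>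
     (\<forall>(p, q)\<in>aztec_edges n z. \<phi> (p, q) \<in> {-1, 1} \<and> \<phi> (q, p) = - \<phi> (p, q)) \<and>
     (\<forall>f\<in>internal_faces n z. (\<Prod>e\<in>{(w, b)\<in>face_edges f. white w}. \<phi> e) = -1)"

text \<open>
  Since \<open>aztec_edges\<close> contains both directions of every edge, the uniqueness below also prevents
  a configuration from containing an edge in both directions.
\<close>

definition oriented_dimers :: "nat \<Rightarrow> face \<Rightarrow> dedge set set" where
  "oriented_dimers n z =
     {M. M \<subseteq> aztec_edges n z \<and>
         (\<forall>p\<in>aztec_vertices n z. \<exists>!e. e \<in> M \<and> (fst e = p \<or> snd e = p))}"

definition aztec_Z :: "nat \<Rightarrow> face \<Rightarrow> (face \<Rightarrow> real) \<Rightarrow> (dedge \<Rightarrow> real) \<Rightarrow> real" where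
  "aztec_Z n z a \<phi> = (\<Sum>M\<in>oriented_dimers n z. \<Prod>e\<in>M. \<phi> e * a (right_face e))"

definition aztec_Y :: "nat \<Rightarrow> face \<Rightarrow> (face \<Rightarrow> real) \<Rightarrow> (dedge \<Rightarrow> real) \<Rightarrow> real" where
  "aztec_Y n z a \<phi> =
     (if n = 0 then a z
      else (\<Prod>f\<in>aztec_faces n z. a f) * aztec_Z n z (\<lambda>f. inverse (a f)) \<phi> / aztec_Z n z a \<phi>)"

definition aztec_Y_defined :: "nat \<Rightarrow> face \<Rightarrow> (face \<Rightarrow> real) \<Rightarrow> (dedge \<Rightarrow> real) \<Rightarrow> bool" where
  "aztec_Y_defined n z a \<phi> \<longleftrightarrow>
     (n > 0 \<longrightarrow> (\<forall>f\<in>aztec_faces n z. a f \<noteq> 0) \<and> aztec_Z n z a \<phi> \<noteq> 0)"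

text \<open>
  Kasteleyn orientations exist on every Aztec diamond, and there are finitely many oriented
  dimer configurations, so \<open>aztec_Z\<close> is a genuine sum.
\<close>

lemma face_edges_white:
  "{(w, b)\<in>face_edges (i, j). white w} =
     (if even (i + j)
      then {((i, j), (i - 1, j)), ((i, j), (i, j - 1)),
            ((i - 1, j - 1), (i, j - 1)), ((i - 1, j - 1), (i - 1, j))}
      else {((i - 1, j), (i, j)), ((i - 1, j), (i - 1, j - 1)),
            ((i, j - 1), (i - 1, j - 1)), ((i, j - 1), (i, j))})"
  by (auto simp: face_edges_def)

lemma kasteleyn_orientation_exists: "\<exists>\<phi>. kasteleyn_orientation n z \<phi>"
proof -
  define s :: "dedge \<Rightarrow> real" where
    "s = (\<lambda>(p, q). if snd p = snd q \<or> even (fst p) then 1 else - 1)"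
  define \<phi> :: "dedge \<Rightarrow> real" where
    "\<phi> = (\<lambda>(p, q). if white p then s (p, q) else - s (p, q))"
  have "\<phi> (p, q) \<in> {-1, 1} \<and> \<phi> (q, p) = - \<phi> (p, q)" if "(p, q) \<in> aztec_edges n z" for p q
  proof -
    have adj: "adjacent p q"
      using that by (auto simp: aztec_edges_def face_edges_def)
    obtain x y x' y' where pq: "p = (x, y)" "q = (x', y')"
      by (metis surj_pair)
    have "(x' = x + 1 \<and> y' = y) \<or> (x' = x - 1 \<and> y' = y) \<or>
          (x' = x \<and> y' = y + 1) \<or> (x' = x \<and> y' = y - 1)"
      using adj unfolding pq adjacent.simps by linarith
    then show ?thesis
      by (auto simp: pq \<phi>_def s_def)
  qed
  moreover have "(\<Prod>e\<in>{(w, b)\<in>face_edges f. white w}. \<phi> e) = -1" for f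
    by (cases f) (auto simp: face_edges_white \<phi>_def s_def)
  ultimately show ?thesis
    unfolding kasteleyn_orientation_def by blast
qed

lemma finite_aztec_faces: "finite (aztec_faces n z)"
proof -
  have "aztec_faces n z \<subseteq>
          {fst z - int n..fst z + int n} \<times> {snd z - int n..snd z + int n}"
    by (cases z) (auto simp: aztec_faces_def internal_faces_def open_faces_def)
  then show ?thesis
    by (rule finite_subset) simp
qed

lemma finite_oriented_dimers: "finite (oriented_dimers n z)"
proof -
  have "finite (internal_faces n z)"
    using finite_aztec_faces[of n z] by (simp add: aztec_faces_def)
  moreover have "finite (face_edges f)" for f
    by (rule finite_subset[of _ "corners f \<times> corners f"]) (cases f, auto simp: face_edges_def)+
  ultimately have "finite (aztec_edges n z)"
    by (simp add: aztec_edges_def)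
  moreover have "oriented_dimers n z \<subseteq> Pow (aztec_edges n z)"
    by (auto simp: oriented_dimers_def)
  ultimately show ?thesis
    by (meson finite_Pow_iff finite_subset)
qed

section \<open>The face weights\<close>

fun shd_weight :: "(int \<Rightarrow> real) \<Rightarrow> (int \<Rightarrow> real) \<Rightarrow> (int \<Rightarrow> real) \<Rightarrow> face \<Rightarrow> real" where
  "shd_weight u Tu b (i, j) =
     (if (i - j) mod 4 \<in> {0, 3} then b (i + j - (i - j) div 4)
      else if (i - j) mod 4 = 1 then Tu (i + j - (i - j) div 4)
      else u (i + j - (i - j) div 4))"

fun shd_centre :: "int \<Rightarrow> nat \<Rightarrow> face" where
  "shd_centre i k =
     (if i mod 2 = 0 then (i div 2 + int k + 2, i div 2 - int k - 1)
      else ((i - 1) div 2 + int k, (i - 1) div 2 - int k + 1))"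

end

theory Submission
  imports Defs
begin

text \<open>
  The coordinates of the points \<open>T\<^sup>k(v)\<^sub>i\<close> and \<open>T\<^sup>k(c)\<^sub>i\<close> form, level by level, a solution of the dSKP
  recurrence on the octahedral lattice, whose initial condition is \<open>a\<close>: half of the octahedra are
  complete quadrilaterals, for which the recurrence is Menelaus' theorem, and in the other half two
  of the six points coincide, so that the recurrence just copies a point.

  The ratio function is invariant when one level of the recurrence is applied while the size of the
  Aztec diamond drops by one.  Every edge of the diamond of size \<open>n\<close> lies on exactly one face of the
  level to be updated.  A matching therefore amounts to a choice, for each of these faces, of the
  set of its corners matched along it, and replacing all these sets by their complements turns
  matchings of size \<open>n\<close> into matchings of size \<open>n - 1\<close> (urban renewal).  The weights correspond
  up to factors that cancel, with the right power of the face weights, in the ratio.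

  This requires all neighbouring points to have different coordinates.  As points of \<open>\<real>\<P>\<^sup>3\<close> they are
  different, because coincidences would make later iterates undefined; their affine coordinates
  are made different by replacing the projection by generic ones that converge to it.
\<close>

section \<open>Matchings of graphs covered by edge-disjoint pieces\<close>

text \<open>An edge may be used in either direction, with opposite signs and with the faces on its
  two sides. So it enters a sum over matchings only as a sign times a difference of two face
  weights, and every local identity is one between differences. Inverting all weights gives a
  solution of the recurrence again, because dSKP is invariant under Moebius maps; both sums in
  \<open>Y\<close> therefore change by the same rule, and what remains is to count powers of
  weights.

  The relation is used in multiplied-out form (\<open>aztec_ratio\<close>). This form makes sense
  down to size 0, where the induction starts, and survives limits without any lower bound on the
  approximating denominators.

  Only the projection is perturbed, never the points: the coincidences behind the copying steps are
  equalities of points and persist under every projection, whereas a perturbed polygon would need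
  its own proof that all iterates are defined. In the limit only the first and the last level are
  compared; coordinates of intermediate levels may collide or tend to infinity there.\<close>

definition matchings :: "('a \<times> 'a) set \<Rightarrow> 'a set \<Rightarrow> ('a \<times> 'a) set set" where
  "matchings E V = {M. M \<subseteq> E \<and> (\<forall>e\<in>M. fst e \<in> V \<and> snd e \<in> V) \<and>
     (\<forall>p\<in>V. \<exists>!e. e \<in> M \<and> (fst e = p \<or> snd e = p))}"

definition matching_sum :: "('a \<times> 'a) set \<Rightarrow> ('a \<times> 'a \<Rightarrow> real) \<Rightarrow> 'a set \<Rightarrow> real" where
  "matching_sum E w V = (\<Sum>M\<in>matchings E V. \<Prod>e\<in>M. w e)"

text \<open>\<open>B\<close> indexes the pieces of a graph, \<open>C f\<close> contains the vertices
  of piece \<open>f\<close>, and \<open>c f\<close> records those that are matched inside it. The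
  functions are extensional so that complementing twice returns the same function.\<close>

definition partitions_over :: "'b set \<Rightarrow> ('b \<Rightarrow> 'a set) \<Rightarrow> 'a set \<Rightarrow> ('b \<Rightarrow> 'a set) set" where
  "partitions_over B C V = {c \<in> PiE B (\<lambda>f. Pow (C f)).
     (\<forall>f\<in>B. c f \<subseteq> V) \<and> (\<forall>p\<in>V. \<exists>!f. f \<in> B \<and> p \<in> c f)}"

lemma matchings_subset: "matchings E V \<subseteq> Pow E"
  by (auto simp: matchings_def)

lemma finite_matchings: "finite E \<Longrightarrow> finite (matchings E V)"
  by (rule finite_subset[OF matchings_subset]) simp

lemma matching_sum_empty: "matching_sum E w {} = 1"
proof -
  have "matchings E {} = {{}}" by (auto simp: matchings_def)
  then show ?thesis by (simp add: matching_sum_def)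
qed

text \<open>Expansion along the edge that covers \<open>p\<close>: removing it is a bijection onto
  pairs of an edge at \<open>p\<close> and a matching of the remaining vertices. This is the means
  of evaluating sums on a four-cycle.\<close>

lemma matching_sum_rec:
  assumes "finite E" "p \<in> V"
  shows "matching_sum E w V =
    (\<Sum>e\<in>{e \<in> E. (fst e = p \<or> snd e = p) \<and> fst e \<in> V \<and> snd e \<in> V}.
       w e * matching_sum E w (V - {fst e, snd e}))" (is "_ = (\<Sum>e\<in>?D. _)")
proof -
  have finD: "finite ?D" using assms by simp
  have "(\<Sum>e\<in>?D. w e * matching_sum E w (V - {fst e, snd e})) =
     (\<Sum>e\<in>?D. \<Sum>M\<in>matchings E (V - {fst e, snd e}). w e * (\<Prod>e\<in>M. w e))"
    by (simp add: matching_sum_def sum_distrib_left)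
  also have "\<dots> = (\<Sum>(e, M)\<in>Sigma ?D (\<lambda>e. matchings E (V - {fst e, snd e})). w e * (\<Prod>e\<in>M. w e))"
    by (rule sum.Sigma) (use assms finD finite_matchings in auto)
  also have "\<dots> = (\<Sum>M\<in>matchings E V. \<Prod>e\<in>M. w e)"
  proof (rule sum.reindex_bij_witness[where
        i = "\<lambda>M. let e = (THE e. e \<in> M \<and> (fst e = p \<or> snd e = p)) in (e, M - {e})" and
        j = "\<lambda>(e, M). insert e M"])
    fix a assume a: "a \<in> Sigma ?D (\<lambda>e. matchings E (V - {fst e, snd e}))"
    obtain e M where aeq: "a = (e, M)" by (cases a)
    have e: "e \<in> E" "fst e = p \<or> snd e = p" "fst e \<in> V" "snd e \<in> V"
      and M: "M \<subseteq> E" "\<And>x. x \<in> M \<Longrightarrow> fst x \<in> V - {fst e, snd e} \<and> snd x \<in> V - {fst e, snd e}"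
        "\<And>q. q \<in> V - {fst e, snd e} \<Longrightarrow> \<exists>!x. x \<in> M \<and> (fst x = q \<or> snd x = q)"
      using a by (auto simp: aeq matchings_def)
    have eM: "e \<notin> M" using M(2)[of e] by auto
    have the: "(THE x. x \<in> insert e M \<and> (fst x = p \<or> snd x = p)) = e"
    proof (rule the_equality)
      show "e \<in> insert e M \<and> (fst e = p \<or> snd e = p)" using e(2) by blast
      show "y = e" if "y \<in> insert e M \<and> (fst y = p \<or> snd y = p)" for y
        using that M(2)[of y] e(2) by auto
    qed
    show "(let e = (THE e. e \<in> (case a of (e, M) \<Rightarrow> insert e M) \<and> (fst e = p \<or> snd e = p))
       in (e, (case a of (e, M) \<Rightarrow> insert e M) - {e})) = a"
      unfolding aeq prod.case the Let_def using eM by simp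
    have "\<exists>!x. x \<in> insert e M \<and> (fst x = q \<or> snd x = q)" if q: "q \<in> V" for q
    proof (cases "q \<in> {fst e, snd e}")
      case True
      show ?thesis
      proof (rule ex1I[of _ e])
        show "e \<in> insert e M \<and> (fst e = q \<or> snd e = q)" using True by auto
        show "y = e" if "y \<in> insert e M \<and> (fst y = q \<or> snd y = q)" for y
          using that M(2)[of y] True by blast
      qed
    next
      case False
      then obtain x where x: "x \<in> M" "fst x = q \<or> snd x = q"
        "\<And>y. y \<in> M \<Longrightarrow> fst y = q \<or> snd y = q \<Longrightarrow> y = x"
        using M(3)[OF DiffI[OF q False]] by metis
      show ?thesis
      proof (rule ex1I[of _ x])
        show "x \<in> insert e M \<and> (fst x = q \<or> snd x = q)" using x(1,2) by blast
        show "y = x" if "y \<in> insert e M \<and> (fst y = q \<or> snd y = q)" for y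
          using that x(3)[of y] False by blast
      qed
    qed
    then show "(case a of (e, M) \<Rightarrow> insert e M) \<in> matchings E V"
    proof -
      assume ex1: "\<And>q. q \<in> V \<Longrightarrow> \<exists>!x. x \<in> insert e M \<and> (fst x = q \<or> snd x = q)"
      have "fst x \<in> V \<and> snd x \<in> V" if "x \<in> insert e M" for x
        using that M(2)[of x] e(3,4) by auto
      then show ?thesis
        unfolding aeq prod.case matchings_def using e(1) M(1) ex1 by simp
    qed
    show "(\<Prod>e\<in>(case a of (e, M) \<Rightarrow> insert e M). w e) = (case a of (e, M) \<Rightarrow> w e * (\<Prod>e\<in>M. w e))"
      using eM finite_subset[OF M(1) assms(1)] by (simp add: aeq)
  next
    fix M assume M: "M \<in> matchings E V"
    have ex1: "\<exists>!e. e \<in> M \<and> (fst e = q \<or> snd e = q)" if "q \<in> V" for q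
      using M that by (simp add: matchings_def)
    define e where "e = (THE e. e \<in> M \<and> (fst e = p \<or> snd e = p))"
    have e: "e \<in> M" "fst e = p \<or> snd e = p" and ME: "M \<subseteq> E"
      using theI'[OF ex1[OF assms(2)]] M by (auto simp: e_def matchings_def)
    have V: "\<And>x. x \<in> M \<Longrightarrow> fst x \<in> V \<and> snd x \<in> V" using M by (auto simp: matchings_def)
    have fresh: "fst x \<notin> {fst e, snd e} \<and> snd x \<notin> {fst e, snd e}" if "x \<in> M" "x \<noteq> e" for x
      using ex1[of "fst e"] ex1[of "snd e"] V[OF e(1)] e(1) that by (metis insert_iff singletonD)
    have "M - {e} \<in> matchings E (V - {fst e, snd e})"
      unfolding matchings_def mem_Collect_eq
    proof (intro conjI ballI)
      show "M - {e} \<subseteq> E" using ME by auto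
      show "fst x \<in> V - {fst e, snd e}" "snd x \<in> V - {fst e, snd e}" if "x \<in> M - {e}" for x
        using V[of x] fresh[of x] that by auto
      show "\<exists>!x. x \<in> M - {e} \<and> (fst x = q \<or> snd x = q)" if q: "q \<in> V - {fst e, snd e}" for q
      proof -
        obtain x where x: "x \<in> M" "fst x = q \<or> snd x = q"
          "\<And>y. y \<in> M \<Longrightarrow> fst y = q \<or> snd y = q \<Longrightarrow> y = x"
          using ex1[OF DiffD1[OF q]] by metis
        show ?thesis
        proof (rule ex1I[of _ x])
          show "x \<in> M - {e} \<and> (fst x = q \<or> snd x = q)" using x(1,2) q by blast
          show "y = x" if "y \<in> M - {e} \<and> (fst y = q \<or> snd y = q)" for y
            using that x(3)[of y] by blast
        qed
      qed
    qed
    then show "(let e = (THE e. e \<in> M \<and> (fst e = p \<or> snd e = p)) in (e, M - {e}))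
        \<in> Sigma ?D (\<lambda>e. matchings E (V - {fst e, snd e}))"
      using e ME V by (auto simp: e_def[symmetric])
    show "(case let e = (THE e. e \<in> M \<and> (fst e = p \<or> snd e = p)) in (e, M - {e}) of
       (e, M) \<Rightarrow> insert e M) = M"
      using e(1) by (auto simp: e_def[symmetric])
  qed
  finally show ?thesis by (simp add: matching_sum_def)
qed

text \<open>A matching is the disjoint union of its parts on the pieces. Each vertex is covered by
  one edge, and that edge belongs to one piece, so the vertex sets covered piece by piece partition
  \<open>V\<close>; for a fixed partition the pieces are matched independently.\<close>

lemma matching_sum_partition:
  assumes "finite B" "\<And>f. f \<in> B \<Longrightarrow> finite (E f)" "\<And>f. f \<in> B \<Longrightarrow> finite (C f)"
    and "disjoint_family_on E B"
    and inc: "\<And>f e. f \<in> B \<Longrightarrow> e \<in> E f \<Longrightarrow> fst e \<in> C f \<and> snd e \<in> C f"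
  shows "matching_sum (\<Union>f\<in>B. E f) w V =
    (\<Sum>c\<in>partitions_over B C V. \<Prod>f\<in>B. matching_sum (E f) w (c f))"
proof -
  let ?P = "partitions_over B C V"
  let ?D = "Sigma ?P (\<lambda>c. PiE B (\<lambda>f. matchings (E f) (c f)))"
  let ?cov = "\<lambda>M f. fst ` (M \<inter> E f) \<union> snd ` (M \<inter> E f)"
  have finP: "finite ?P"
    unfolding partitions_over_def by (rule finite_subset[OF _ finite_PiE[of B "\<lambda>f. Pow (C f)"]]) (use assms in auto)
  have "(\<Sum>c\<in>?P. \<Prod>f\<in>B. matching_sum (E f) w (c f)) =
     (\<Sum>c\<in>?P. \<Sum>m\<in>PiE B (\<lambda>f. matchings (E f) (c f)). \<Prod>f\<in>B. \<Prod>e\<in>m f. w e)"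
    unfolding matching_sum_def
    by (intro sum.cong refl prod_sum_PiE finite_matchings) (use assms(1,2) in auto)
  also have "\<dots> = (\<Sum>(c, m)\<in>?D. \<Prod>f\<in>B. \<Prod>e\<in>m f. w e)"
    by (rule sum.Sigma) (use assms(1,2) finP in \<open>auto intro!: finite_PiE finite_matchings\<close>)
  also have "\<dots> = (\<Sum>M\<in>matchings (\<Union>f\<in>B. E f) V. \<Prod>e\<in>M. w e)"
  proof (rule sum.reindex_bij_witness[where
        i = "\<lambda>M. (\<lambda>f\<in>B. ?cov M f, \<lambda>f\<in>B. M \<inter> E f)" and
        j = "\<lambda>(c, m). \<Union>f\<in>B. m f"])
    fix a assume a: "a \<in> ?D"
    obtain c m where aeq: "a = (c, m)" by (cases a)
    have c: "c \<in> extensional B" "\<And>f. f \<in> B \<Longrightarrow> c f \<subseteq> C f" "\<And>f. f \<in> B \<Longrightarrow> c f \<subseteq> V"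
      "\<And>p. p \<in> V \<Longrightarrow> \<exists>!f. f \<in> B \<and> p \<in> c f"
      and mext: "m \<in> extensional B" and mm: "\<And>f. f \<in> B \<Longrightarrow> m f \<in> matchings (E f) (c f)"
      using a by (auto simp: aeq partitions_over_def PiE_def)
    have m: "m f \<subseteq> E f" "\<And>x. x \<in> m f \<Longrightarrow> fst x \<in> c f \<and> snd x \<in> c f"
        "\<And>q. q \<in> c f \<Longrightarrow> \<exists>!x. x \<in> m f \<and> (fst x = q \<or> snd x = q)" if "f \<in> B" for f
      using mm[OF that] by (auto simp: matchings_def)
    have disj: "f = f'" if "f \<in> B" "f' \<in> B" "x \<in> E f" "x \<in> E f'" for f f' x
      using that assms(4) by (auto simp: disjoint_family_on_def)
    have int: "(\<Union>f\<in>B. m f) \<inter> E f = m f" if "f \<in> B" for f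
      using m(1) that disj by blast
    have cov: "?cov (\<Union>f\<in>B. m f) f = c f" if "f \<in> B" for f
    proof -
      have "fst ` m f \<union> snd ` m f = c f"
      proof (intro equalityI subsetI)
        show "q \<in> c f" if "q \<in> fst ` m f \<union> snd ` m f" for q
          using that m(2)[OF \<open>f \<in> B\<close>] by auto
        show "q \<in> fst ` m f \<union> snd ` m f" if "q \<in> c f" for q
          using m(3)[OF \<open>f \<in> B\<close> that] by (metis UnI1 UnI2 imageI)
      qed
      then show ?thesis unfolding int[OF that] .
    qed
    show "(\<lambda>f\<in>B. ?cov (case a of (c, m) \<Rightarrow> \<Union>f\<in>B. m f) f,
           \<lambda>f\<in>B. (case a of (c, m) \<Rightarrow> \<Union>f\<in>B. m f) \<inter> E f) = a"
    proof -
      have "(\<lambda>f\<in>B. ?cov (\<Union>f\<in>B. m f) f) = c"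
        by (rule extensionalityI[of _ B]) (use cov c(1) in auto)
      moreover have "(\<lambda>f\<in>B. (\<Union>f\<in>B. m f) \<inter> E f) = m"
        by (rule extensionalityI[of _ B]) (use int mext in auto)
      ultimately show ?thesis by (simp add: aeq)
    qed
    have "\<exists>!x. x \<in> (\<Union>f\<in>B. m f) \<and> (fst x = q \<or> snd x = q)" if q: "q \<in> V" for q
    proof -
      obtain f where f: "f \<in> B" "q \<in> c f" "\<And>f'. f' \<in> B \<Longrightarrow> q \<in> c f' \<Longrightarrow> f' = f"
        using c(4)[OF q] by metis
      obtain x where x: "x \<in> m f" "fst x = q \<or> snd x = q"
          "\<And>y. y \<in> m f \<Longrightarrow> fst y = q \<or> snd y = q \<Longrightarrow> y = x"
        using m(3)[OF f(1,2)] by metis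
      show ?thesis
      proof (rule ex1I[of _ x])
        show "x \<in> \<Union> (m ` B) \<and> (fst x = q \<or> snd x = q)" using x(1,2) f(1) by blast
        fix y assume y: "y \<in> \<Union> (m ` B) \<and> (fst y = q \<or> snd y = q)"
        then obtain f' where f': "f' \<in> B" "y \<in> m f'" by auto
        have "q \<in> c f'" using m(2)[OF f'] y by auto
        then have "f' = f" by (rule f(3)[OF f'(1)])
        then show "y = x" using x(3)[of y] f' y by blast
      qed
    qed
    moreover have "(\<Union>f\<in>B. m f) \<subseteq> (\<Union>f\<in>B. E f)" using m(1) by auto
    moreover have "fst e \<in> V \<and> snd e \<in> V" if "e \<in> (\<Union>f\<in>B. m f)" for e
      using that m(2) c(3) by blast
    ultimately show "(case a of (c, m) \<Rightarrow> \<Union>f\<in>B. m f) \<in> matchings (\<Union>f\<in>B. E f) V"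
      unfolding aeq prod.case matchings_def by blast
    have "(\<Prod>e\<in>(\<Union>f\<in>B. m f). w e) = (\<Prod>f\<in>B. \<Prod>e\<in>m f. w e)"
    proof (rule prod.UNION_disjoint)
      show "finite B" by fact
      show "\<forall>i\<in>B. finite (m i)" using m(1) assms(2) finite_subset by metis
      show "\<forall>i\<in>B. \<forall>j\<in>B. i \<noteq> j \<longrightarrow> m i \<inter> m j = {}"
        using m(1) disj by blast
    qed
    then show "(\<Prod>e\<in>(case a of (c, m) \<Rightarrow> \<Union>f\<in>B. m f). w e) =
        (case a of (c, m) \<Rightarrow> \<Prod>f\<in>B. \<Prod>e\<in>m f. w e)"
      by (simp add: aeq)
  next
    fix M assume "M \<in> matchings (\<Union>f\<in>B. E f) V"
    then have M: "M \<subseteq> (\<Union>f\<in>B. E f)" "\<And>x. x \<in> M \<Longrightarrow> fst x \<in> V \<and> snd x \<in> V"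
      "\<And>q. q \<in> V \<Longrightarrow> \<exists>!x. x \<in> M \<and> (fst x = q \<or> snd x = q)"
      by (auto simp: matchings_def)
    have fcov: "\<exists>!f. f \<in> B \<and> p \<in> ?cov M f" if p: "p \<in> V" for p
    proof -
      obtain x where x: "x \<in> M" "fst x = p \<or> snd x = p"
          "\<And>y. y \<in> M \<Longrightarrow> fst y = p \<or> snd y = p \<Longrightarrow> y = x"
        using M(3)[OF p] by metis
      obtain f where f: "f \<in> B" "x \<in> E f" using x(1) M(1) by auto
      show ?thesis
      proof (rule ex1I[of _ f])
        show "f \<in> B \<and> p \<in> ?cov M f" using f x(1,2) by auto
        fix f' assume f': "f' \<in> B \<and> p \<in> ?cov M f'"
        then obtain y where "y \<in> M" "y \<in> E f'" "fst y = p \<or> snd y = p" by auto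
        then have "x \<in> E f'" using x(3)[of y] by blast
        then show "f' = f" using f f' assms(4) by (auto simp: disjoint_family_on_def)
      qed
    qed
    have c: "(\<lambda>f\<in>B. ?cov M f) \<in> ?P"
      unfolding partitions_over_def mem_Collect_eq
    proof (intro conjI ballI)
      show "(\<lambda>f\<in>B. ?cov M f) \<in> PiE B (\<lambda>f. Pow (C f))"
      proof (rule restrict_PiE_iff[THEN iffD2], intro ballI PowI subsetI)
        show "q \<in> C f" if "f \<in> B" "q \<in> ?cov M f" for f q
          using that(2) inc[OF that(1)] by blast
      qed
      show "(\<lambda>f\<in>B. ?cov M f) f \<subseteq> V" if "f \<in> B" for f
        using M(2) by (intro subsetI) (auto simp: that dest: M(2))
      show "\<exists>!f. f \<in> B \<and> p \<in> (\<lambda>f\<in>B. ?cov M f) f" if "p \<in> V" for p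
        using fcov[OF that] by (simp cong: conj_cong)
    qed
    have m: "M \<inter> E f \<in> matchings (E f) (?cov M f)" for f
    proof -
      have "\<exists>!x. x \<in> M \<inter> E f \<and> (fst x = q \<or> snd x = q)" if q: "q \<in> ?cov M f" for q
      proof -
        obtain x where x: "x \<in> M \<inter> E f" "fst x = q \<or> snd x = q" using q by auto
        then have "q \<in> V" using M(2)[of x] by auto
        then show ?thesis using M(3)[of q] x by (metis IntD1 IntI)
      qed
      then show ?thesis by (auto simp: matchings_def)
    qed
    show "(\<lambda>f\<in>B. ?cov M f, \<lambda>f\<in>B. M \<inter> E f) \<in> ?D"
      by (intro SigmaI c restrict_PiE_iff[THEN iffD2] ballI) (simp add: m)
    show "(case (\<lambda>f\<in>B. ?cov M f, \<lambda>f\<in>B. M \<inter> E f) of (c, m) \<Rightarrow> \<Union>f\<in>B. m f) = M"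
      using M(1) by auto
  qed
  finally show ?thesis by (simp add: matching_sum_def)
qed

text \<open>Of the two pieces meeting at \<open>p\<close> exactly one covers it, so among the
  complements exactly the other one does.\<close>

lemma ex1_complement:
  assumes "{h \<in> B. p \<in> C h} = {f, f'}" "f \<noteq> f'" "\<exists>!h. h \<in> B \<and> p \<in> c h"
    and "\<And>h. h \<in> B \<Longrightarrow> c h \<subseteq> C h"
  shows "\<exists>!h. h \<in> B \<and> p \<in> C h - c h"
proof -
  have iff: "h \<in> B \<and> p \<in> C h \<longleftrightarrow> h = f \<or> h = f'" for h
    using assms(1) by (simp add: set_eq_iff)
  obtain h where h: "h \<in> B" "p \<in> c h" and uniq: "\<And>k. k \<in> B \<Longrightarrow> p \<in> c k \<Longrightarrow> k = h"
    using assms(3) by metis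
  have "p \<in> C h" using assms(4)[OF h(1)] h(2) by blast
  define k where "k = (if h = f then f' else f)"
  have k: "k \<noteq> h" "k = f \<or> k = f'" and hk: "x = f \<or> x = f' \<Longrightarrow> x = h \<or> x = k" for x
    using iff[of h] h(1) \<open>p \<in> C h\<close> assms(2) by (auto simp: k_def)
  show ?thesis
  proof (rule ex1I[of _ k])
    show "k \<in> B \<and> p \<in> C k - c k" using iff[of k] k uniq[of k] by blast
    show "x = k" if "x \<in> B \<and> p \<in> C x - c x" for x
      using that iff[of x] hk[of x] h(2) by blast
  qed
qed

text \<open>Urban renewal in abstract form. At a vertex of \<open>V'\<close>, shared by two pieces,
  complementing hands the vertex from one piece to the other. A vertex in a single piece must be
  covered by that piece in a matching of \<open>V\<close> and by none in a matching of
  \<open>V'\<close>. Hence complementation is a bijection between the two kinds of partitions, and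
  \<open>g x\<close> occurs once for each vertex because the covered sets partition
  \<open>V'\<close>.\<close>

lemma matching_sum_complement:
  assumes "finite B" "\<And>f. f \<in> B \<Longrightarrow> finite (E f)" "\<And>f. f \<in> B \<Longrightarrow> finite (C f)"
    and "disjoint_family_on E B"
    and inc: "\<And>f e. f \<in> B \<Longrightarrow> e \<in> E f \<Longrightarrow> fst e \<in> C f \<and> snd e \<in> C f"
    and CV: "\<And>f. f \<in> B \<Longrightarrow> C f \<subseteq> V" and V': "V' \<subseteq> V"
    and two: "\<And>p. p \<in> V' \<Longrightarrow> \<exists>f f'. f \<noteq> f' \<and> {h \<in> B. p \<in> C h} = {f, f'}"
    and one: "\<And>p. p \<in> V - V' \<Longrightarrow> \<exists>f. {h \<in> B. p \<in> C h} = {f}"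
    and loc: "\<And>f c. f \<in> B \<Longrightarrow> c \<subseteq> C f \<Longrightarrow>
      matching_sum (E f) w' c * D f = (\<Prod>x\<in>c. g x) * matching_sum (E f) w (C f - c)"
  shows "matching_sum (\<Union>f\<in>B. E f) w' V' * (\<Prod>f\<in>B. D f) =
    (\<Prod>x\<in>V'. g x) * matching_sum (\<Union>f\<in>B. E f) w V"
proof -
  have part: "matching_sum (\<Union>f\<in>B. E f) w V =
    (\<Sum>c\<in>partitions_over B C V. \<Prod>f\<in>B. matching_sum (E f) w (c f))" for w V
    by (rule matching_sum_partition[OF assms(1-4) inc])
  have "(\<Prod>f\<in>B. matching_sum (E f) w' (c f)) * (\<Prod>f\<in>B. D f) =
      (\<Prod>x\<in>V'. g x) * (\<Prod>f\<in>B. matching_sum (E f) w (C f - c f))"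
    if c: "c \<in> partitions_over B C V'" for c
  proof -
    have cC: "c f \<subseteq> C f" if "f \<in> B" for f
      using c that by (auto simp: partitions_over_def)
    have ex: "\<exists>!f. f \<in> B \<and> p \<in> c f" if "p \<in> V'" for p
      using c that by (auto simp: partitions_over_def)
    have cV: "c f \<subseteq> V'" if "f \<in> B" for f
      using c that by (auto simp: partitions_over_def)
    have U: "(\<Union>f\<in>B. c f) = V'"
    proof (intro equalityI subsetI)
      show "p \<in> V'" if "p \<in> (\<Union>f\<in>B. c f)" for p using that cV by blast
      show "p \<in> (\<Union>f\<in>B. c f)" if "p \<in> V'" for p using ex[OF that] by blast
    qed
    have "(\<Prod>f\<in>B. matching_sum (E f) w' (c f)) * (\<Prod>f\<in>B. D f) =
      (\<Prod>f\<in>B. \<Prod>x\<in>c f. g x) * (\<Prod>f\<in>B. matching_sum (E f) w (C f - c f))"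
      unfolding prod.distrib[symmetric] by (rule prod.cong[OF refl]) (use loc cC in blast)
    also have "(\<Prod>f\<in>B. \<Prod>x\<in>c f. g x) = (\<Prod>x\<in>(\<Union>f\<in>B. c f). g x)"
    proof (rule prod.UNION_disjoint[symmetric])
      show "finite B" by fact
      show "\<forall>i\<in>B. finite (c i)" using cC assms(3) finite_subset by metis
      show "\<forall>i\<in>B. \<forall>j\<in>B. i \<noteq> j \<longrightarrow> c i \<inter> c j = {}"
        using ex cV by blast
    qed
    finally show ?thesis unfolding U .
  qed
  then have "matching_sum (\<Union>f\<in>B. E f) w' V' * (\<Prod>f\<in>B. D f) =
    (\<Prod>x\<in>V'. g x) * (\<Sum>c\<in>partitions_over B C V'. \<Prod>f\<in>B. matching_sum (E f) w (C f - c f))"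
    unfolding part[of w'] by (simp add: sum_distrib_right sum_distrib_left)
  also have "(\<Sum>c\<in>partitions_over B C V'. \<Prod>f\<in>B. matching_sum (E f) w (C f - c f)) =
    (\<Sum>c\<in>partitions_over B C V. \<Prod>f\<in>B. matching_sum (E f) w (c f))"
  proof (rule sum.reindex_bij_witness[where i = "\<lambda>c. \<lambda>f\<in>B. C f - c f" and j = "\<lambda>c. \<lambda>f\<in>B. C f - c f"])
    have invol: "(\<lambda>f\<in>B. C f - (\<lambda>f\<in>B. C f - c f) f) = c" if "c \<in> partitions_over B C U" for c U
    proof (rule extensionalityI[of _ B])
      show "(\<lambda>f\<in>B. C f - (\<lambda>f\<in>B. C f - c f) f) \<in> extensional B" by simp
      show "c \<in> extensional B" using that by (simp add: partitions_over_def PiE_def)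
      show "(\<lambda>f\<in>B. C f - (\<lambda>f\<in>B. C f - c f) f) f = c f" if "f \<in> B" for f
        using \<open>c \<in> partitions_over B C U\<close> that by (auto simp: partitions_over_def)
    qed
    show "(\<lambda>f\<in>B. C f - (\<lambda>f\<in>B. C f - c f) f) = c" if "c \<in> partitions_over B C V'" for c
      by (rule invol[OF that])
    show "(\<lambda>f\<in>B. C f - (\<lambda>f\<in>B. C f - c f) f) = c" if "c \<in> partitions_over B C V" for c
      by (rule invol[OF that])
    show "(\<Prod>f\<in>B. matching_sum (E f) w ((\<lambda>f\<in>B. C f - c f) f)) =
       (\<Prod>f\<in>B. matching_sum (E f) w (C f - c f))" for c
      by (rule prod.cong) auto
    show "(\<lambda>f\<in>B. C f - c f) \<in> partitions_over B C V" if c: "c \<in> partitions_over B C V'" for c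
    proof -
      have ex: "\<exists>!f. f \<in> B \<and> p \<in> c f" if "p \<in> V'" for p
        using c that by (auto simp: partitions_over_def)
      have cV: "c f \<subseteq> V'" "c f \<subseteq> C f" if "f \<in> B" for f
        using c that by (auto simp: partitions_over_def)
      have "\<exists>!f. f \<in> B \<and> p \<in> C f - c f" if p: "p \<in> V" for p
      proof (cases "p \<in> V'")
        case True
        obtain f f' where f: "f \<noteq> f'" "{h \<in> B. p \<in> C h} = {f, f'}" using two[OF True] by blast
        show ?thesis
          by (rule ex1_complement[of B p C f f' c, OF f(2,1) ex[OF True]]) (use cV(2) in blast)
      next
        case False
        obtain f where f: "{h \<in> B. p \<in> C h} = {f}" using one False p by blast
        show ?thesis by (rule ex1I[of _ f]) (use f False cV(1) in blast)+
      qed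
      then have "\<exists>!f. f \<in> B \<and> p \<in> (\<lambda>f\<in>B. C f - c f) f" if "p \<in> V" for p
        using that by (simp cong: conj_cong)
      moreover have "(\<lambda>f\<in>B. C f - c f) f \<subseteq> V" if "f \<in> B" for f
        using CV[OF that] that by auto
      moreover have "(\<lambda>f\<in>B. C f - c f) \<in> PiE B (\<lambda>f. Pow (C f))" by auto
      ultimately show ?thesis unfolding partitions_over_def by blast
    qed
    show "(\<lambda>f\<in>B. C f - c f) \<in> partitions_over B C V'" if c: "c \<in> partitions_over B C V" for c
    proof -
      have ex: "\<exists>!f. f \<in> B \<and> p \<in> c f" if "p \<in> V" for p
        using c that by (auto simp: partitions_over_def)
      have cC: "c f \<subseteq> C f" if "f \<in> B" for f
        using c that by (auto simp: partitions_over_def)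
      have sub: "C f - c f \<subseteq> V'" if fB: "f \<in> B" for f
      proof
        fix p assume p: "p \<in> C f - c f"
        then have pV: "p \<in> V" using CV[OF fB] by blast
        obtain h where h: "h \<in> B" "p \<in> c h" using ex[OF pV] by blast
        show "p \<in> V'"
        proof (rule ccontr)
          assume "p \<notin> V'"
          then obtain f1 where "{h \<in> B. p \<in> C h} = {f1}" using one[of p] pV by blast
          moreover have "h \<in> {h \<in> B. p \<in> C h}" "f \<in> {h \<in> B. p \<in> C h}"
            using h cC[OF h(1)] p fB by blast+
          ultimately have "h = f" by simp
          then show False using h p by blast
        qed
      qed
      have "\<exists>!f. f \<in> B \<and> p \<in> C f - c f" if p: "p \<in> V'" for p
      proof -
        obtain f f' where f: "f \<noteq> f'" "{h \<in> B. p \<in> C h} = {f, f'}" using two[OF p] by blast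
        have pV: "p \<in> V" using p V' by blast
        show ?thesis
          by (rule ex1_complement[of B p C f f' c, OF f(2,1) ex[OF pV]]) (use cC in blast)
      qed
      then have "\<exists>!f. f \<in> B \<and> p \<in> (\<lambda>f\<in>B. C f - c f) f" if "p \<in> V'" for p
        using that by (simp cong: conj_cong)
      moreover have "(\<lambda>f\<in>B. C f - c f) f \<subseteq> V'" if "f \<in> B" for f
        using sub[OF that] that by auto
      moreover have "(\<lambda>f\<in>B. C f - c f) \<in> PiE B (\<lambda>f. Pow (C f))" by auto
      ultimately show ?thesis unfolding partitions_over_def by blast
    qed
  qed
  finally show ?thesis unfolding part[of w] .
qed

section \<open>Matching sums on a single four-cycle\<close>

lemma four_cycle_matching_sums:
  fixes w :: "'a \<times> 'a \<Rightarrow> real"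
  assumes d: "distinct [p, q, r, s]"
    and E: "E = {(p, q), (q, p), (q, r), (r, q), (r, s), (s, r), (s, p), (p, s)}"
  shows
    "matching_sum E w {p} = 0" "matching_sum E w {q} = 0"
    "matching_sum E w {r} = 0" "matching_sum E w {s} = 0"
    "matching_sum E w {p, r} = 0" "matching_sum E w {q, s} = 0"
    "matching_sum E w {p, q} = w (p, q) + w (q, p)"
    "matching_sum E w {q, r} = w (q, r) + w (r, q)"
    "matching_sum E w {r, s} = w (r, s) + w (s, r)"
    "matching_sum E w {p, s} = w (s, p) + w (p, s)"
    "matching_sum E w {p, q, r} = 0" "matching_sum E w {q, r, s} = 0"
    "matching_sum E w {p, r, s} = 0" "matching_sum E w {p, q, s} = 0"
    "matching_sum E w {p, q, r, s} =
       (w (p, q) + w (q, p)) * (w (r, s) + w (s, r)) + (w (q, r) + w (r, q)) * (w (s, p) + w (p, s))"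
proof -
  have fin: "finite E" by (simp add: E)
  have dd: "p \<noteq> q" "q \<noteq> p" "p \<noteq> r" "r \<noteq> p" "p \<noteq> s" "s \<noteq> p" "q \<noteq> r" "r \<noteq> q" "q \<noteq> s" "s \<noteq> q" "r \<noteq> s" "s \<noteq> r"
    using d by auto
  have sel: "{e \<in> E. P e} =
    (if P (p, q) then {(p, q)} else {}) \<union> (if P (q, p) then {(q, p)} else {}) \<union>
    (if P (q, r) then {(q, r)} else {}) \<union> (if P (r, q) then {(r, q)} else {}) \<union>
    (if P (r, s) then {(r, s)} else {}) \<union> (if P (s, r) then {(s, r)} else {}) \<union>
    (if P (s, p) then {(s, p)} else {}) \<union> (if P (p, s) then {(p, s)} else {})" for P
    unfolding E by auto
  note S = sel matching_sum_empty insert_Diff_if dd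
  note R = matching_sum_rec[OF fin, of _ _ w]
  show 1: "matching_sum E w {p} = 0" "matching_sum E w {q} = 0"
    "matching_sum E w {r} = 0" "matching_sum E w {s} = 0"
    by (simp_all add: R[of p "{p}"] R[of q "{q}"] R[of r "{r}"] R[of s "{s}"] S)
  show "matching_sum E w {p, r} = 0" by (simp add: R[of p "{p, r}"] S)
  show "matching_sum E w {q, s} = 0" by (simp add: R[of q "{q, s}"] S)
  show "matching_sum E w {p, q} = w (p, q) + w (q, p)" by (simp add: R[of p "{p, q}"] S)
  show 2: "matching_sum E w {q, r} = w (q, r) + w (r, q)" by (simp add: R[of q "{q, r}"] S)
  show 3: "matching_sum E w {r, s} = w (r, s) + w (s, r)" by (simp add: R[of r "{r, s}"] S)
  show "matching_sum E w {p, s} = w (s, p) + w (p, s)" by (simp add: R[of p "{p, s}"] S)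
  show "matching_sum E w {p, q, r} = 0" by (simp add: R[of p "{p, q, r}"] S 1)
  show "matching_sum E w {q, r, s} = 0" by (simp add: R[of q "{q, r, s}"] S 1)
  show "matching_sum E w {p, r, s} = 0" by (simp add: R[of p "{p, r, s}"] S 1)
  show "matching_sum E w {p, q, s} = 0" by (simp add: R[of p "{p, q, s}"] S 1)
  show "matching_sum E w {p, q, r, s} =
       (w (p, q) + w (q, p)) * (w (r, s) + w (s, r)) + (w (q, r) + w (r, q)) * (w (s, p) + w (p, s))"
    by (simp add: R[of p "{p, q, r, s}"] S 2 3 algebra_simps)
qed

text \<open>Only the empty set, the four sides and the whole cycle can be matched, and the
  complement of an unmatchable set is unmatchable, so all other subsets give zero on both sides. The
  sides are the hypotheses; the whole cycle follows from products of opposite sides.\<close>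

lemma four_cycle_complement:
  fixes w w' :: "'a \<times> 'a \<Rightarrow> real"
  assumes d: "distinct [p, q, r, s]"
    and E: "E = {(p, q), (q, p), (q, r), (r, q), (r, s), (s, r), (s, p), (p, s)}"
    and D: "D = (w (p, q) + w (q, p)) * (w (r, s) + w (s, r)) +
                (w (q, r) + w (r, q)) * (w (s, p) + w (p, s))" and "D \<noteq> 0"
    and pq: "(w' (p, q) + w' (q, p)) * D = g p * g q * (w (r, s) + w (s, r))"
    and qr: "(w' (q, r) + w' (r, q)) * D = g q * g r * (w (s, p) + w (p, s))"
    and rs: "(w' (r, s) + w' (s, r)) * D = g r * g s * (w (p, q) + w (q, p))"
    and sp: "(w' (s, p) + w' (p, s)) * D = g s * g p * (w (q, r) + w (r, q))"
    and c: "c \<subseteq> {p, q, r, s}"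
  shows "matching_sum E w' c * D = (\<Prod>x\<in>c. g x) * matching_sum E w ({p, q, r, s} - c)"
proof -
  have dd: "p \<noteq> q" "q \<noteq> p" "p \<noteq> r" "r \<noteq> p" "p \<noteq> s" "s \<noteq> p" "q \<noteq> r" "r \<noteq> q" "q \<noteq> s" "s \<noteq> q" "r \<noteq> s" "s \<noteq> r"
    using d by auto
  note M = four_cycle_matching_sums[OF d E] matching_sum_empty insert_Diff_if dd
  \<comment> \<open>Multiplying by \<open>D\<close> once more makes all four hypotheses on the sides
    applicable; the extra factor is cancelled at the end.\<close>
  have all: "matching_sum E w' {p, q, r, s} * D = g p * g q * g r * g s"
  proof -
    have "matching_sum E w' {p, q, r, s} * D * D = ((w' (p, q) + w' (q, p)) * D) * ((w' (r, s) + w' (s, r)) * D)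
      + ((w' (q, r) + w' (r, q)) * D) * ((w' (s, p) + w' (p, s)) * D)"
      by (simp add: M algebra_simps)
    also have "\<dots> = g p * g q * g r * g s * D"
      unfolding pq qr rs sp unfolding D by (simp add: algebra_simps)
    finally show ?thesis using \<open>D \<noteq> 0\<close> by simp
  qed
  \<comment> \<open>Writing \<open>c\<close> through the membership of each of the four points turns
    the list of sixteen subsets into a split on four booleans.\<close>
  have dec: "c = {} \<or> c = {p} \<or> c = {q} \<or> c = {r} \<or> c = {s} \<or> c = {p, q} \<or> c = {q, r} \<or> c = {r, s} \<or>
    c = {p, s} \<or> c = {p, r} \<or> c = {q, s} \<or> c = {p, q, r} \<or> c = {q, r, s} \<or> c = {p, r, s} \<or>
    c = {p, q, s} \<or> c = {p, q, r, s}"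
    if "c = (if a1 then {p} else {}) \<union> ((if a2 then {q} else {}) \<union>
            ((if a3 then {r} else {}) \<union> (if a4 then {s} else {})))" for a1 a2 a3 a4
    unfolding that
    by (cases a1; cases a2; cases a3; cases a4;
        simp only: if_True if_False Un_insert_left Un_empty_left Un_empty_right simp_thms)
  moreover have "c = (if p \<in> c then {p} else {}) \<union> ((if q \<in> c then {q} else {}) \<union>
            ((if r \<in> c then {r} else {}) \<union> (if s \<in> c then {s} else {})))"
    using c by auto
  ultimately have cases: "c = {} \<or> c = {p} \<or> c = {q} \<or> c = {r} \<or> c = {s} \<or> c = {p, q} \<or> c = {q, r} \<or> c = {r, s} \<or>
    c = {p, s} \<or> c = {p, r} \<or> c = {q, s} \<or> c = {p, q, r} \<or> c = {q, r, s} \<or> c = {p, r, s} \<or>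
    c = {p, q, s} \<or> c = {p, q, r, s}" by (intro dec)
  have pairs: "matching_sum E w' {p, q} * D = g p * g q * matching_sum E w {r, s}"
    "matching_sum E w' {q, r} * D = g q * g r * matching_sum E w {p, s}"
    "matching_sum E w' {r, s} * D = g r * g s * matching_sum E w {p, q}"
    "matching_sum E w' {p, s} * D = g p * g s * matching_sum E w {q, r}"
    using pq qr rs sp by (simp_all add: four_cycle_matching_sums[OF d E] mult.commute)
  have D': "matching_sum E w {p, q, r, s} = D"
    by (simp add: four_cycle_matching_sums[OF d E] D)
  show ?thesis
    using cases
    by (elim disjE; hypsubst)
       (simp_all add: four_cycle_matching_sums(1-6,11-14)[OF d E] matching_sum_empty insert_Diff_if dd
          pairs all D' mult.assoc)
qed

section \<open>Aztec diamonds\<close>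

text \<open>The faces updated at time \<open>t\<close>; all faces of the other parity keep their weights.\<close>

definition bottom_faces :: "int \<Rightarrow> nat \<Rightarrow> face \<Rightarrow> face set" where
  "bottom_faces t n z = {f. grid_dist z f \<le> int n \<and> even (fst f + snd f + t)}"

lemma aztec_vertices_iff:
  "(x, y) \<in> aztec_vertices n z \<longleftrightarrow>
     grid_dist z (x, y) < int n \<or> grid_dist z (x + 1, y) < int n \<or>
     grid_dist z (x, y + 1) < int n \<or> grid_dist z (x + 1, y + 1) < int n"
proof -
  have "(x, y) \<in> corners (i, j) \<longleftrightarrow> (i, j) \<in> {(x, y), (x + 1, y), (x, y + 1), (x + 1, y + 1)}" for i j
    by auto
  then have "(x, y) \<in> corners f \<longleftrightarrow> f \<in> {(x, y), (x + 1, y), (x, y + 1), (x + 1, y + 1)}" for f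
    by (metis surj_pair)
  then show ?thesis
    unfolding aztec_vertices_def internal_faces_def by auto
qed

text \<open>The parities of the faces alternate around a vertex, so the updated ones are opposite
  each other; the parity of the vertex decides on which diagonal.\<close>

lemma corner_bottom_faces:
  "{h \<in> bottom_faces t n z. (x, y) \<in> corners h} =
     bottom_faces t n z \<inter> (if even (x + y + t) then {(x, y), (x + 1, y + 1)} else {(x + 1, y), (x, y + 1)})"
  by (auto simp: bottom_faces_def split: if_splits)

text \<open>Here \<open>u\<close>, \<open>v\<close> is the position of a vertex relative to the
  centre, and the updated faces at it are those with offsets 0 and 1 in both coordinates, at
  distances of the parity of \<open>k\<close>. A face of the other parity at distance below
  \<open>k\<close> is adjacent to both of them; a face of their own parity below \<open>k\<close> is
  at distance at most \<open>k - 2\<close>.\<close>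

lemma near_vertex_inner: 
  fixes u v k :: int assumes "even (u + v + k)"
  shows "(\<bar>u\<bar> + \<bar>v\<bar> < k \<or> \<bar>u + 1\<bar> + \<bar>v\<bar> < k \<or> \<bar>u\<bar> + \<bar>v + 1\<bar> < k \<or> \<bar>u + 1\<bar> + \<bar>v + 1\<bar> < k)
    \<longleftrightarrow> \<bar>u\<bar> + \<bar>v\<bar> \<le> k \<and> \<bar>u + 1\<bar> + \<bar>v + 1\<bar> \<le> k"
proof -
  obtain w where w: "u + v + k = 2 * w" using assms by blast
  then have k: "k = 2 * w - u - v" by simp
  show ?thesis unfolding k by (cases "u \<ge> 0"; cases "v \<ge> 0") (simp_all add: abs_if, presburger+)
qed
lemma near_vertex_outer: 
  fixes u v k :: int assumes "even (u + v + k)" "k \<ge> 0"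
  shows "(\<bar>u\<bar> + \<bar>v\<bar> < k + 1 \<or> \<bar>u + 1\<bar> + \<bar>v\<bar> < k + 1 \<or> \<bar>u\<bar> + \<bar>v + 1\<bar> < k + 1 \<or> \<bar>u + 1\<bar> + \<bar>v + 1\<bar> < k + 1)
    \<longleftrightarrow> \<bar>u\<bar> + \<bar>v\<bar> \<le> k \<or> \<bar>u + 1\<bar> + \<bar>v + 1\<bar> \<le> k"
proof -
  obtain w where w: "u + v + k = 2 * w" using assms by blast
  then have k: "k = 2 * w - u - v" by simp
  show ?thesis using assms(2) unfolding k by (cases "u \<ge> 0"; cases "v \<ge> 0") (simp_all add: abs_if, presburger+)
qed

text \<open>Replacing \<open>v\<close> by \<open>- 1 - v\<close> is a reflection that exchanges the
  two diagonals of faces at a vertex, so vertices of both parities share the same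
  arithmetic.\<close>

lemma near_vertex_swap:
  fixes u v k :: int
  assumes "odd (u + v + k)"
  shows "even (u + (- 1 - v) + k)" "\<bar>- 1 - v\<bar> = \<bar>v + 1\<bar>" "\<bar>- 1 - v + 1\<bar> = \<bar>v\<bar>"
  using assms by (presburger, auto)

context
  fixes z :: face and t :: int and m :: nat
  assumes par: "even (fst z + snd z + t + int m)"
begin

text \<open>By parity the updated faces lie at distances \<open>m\<close>, \<open>m - 2\<close>, ...
  from the centre. So sizes \<open>m + 1\<close> and \<open>m\<close> differ in whether one or both
  of the diagonal faces at a vertex are within distance \<open>m\<close>; with
  \<open>aztec_vertices_bottom\<close> this supplies the one-or-two-pieces condition of
  \<open>matching_sum_complement\<close>.\<close>

lemma aztec_vertices_Suc_bottom:
  "(x, y) \<in> aztec_vertices (Suc m) z \<longleftrightarrow>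
    (if even (x + y + t) then (x, y) \<in> bottom_faces t m z \<or> (x + 1, y + 1) \<in> bottom_faces t m z
     else (x + 1, y) \<in> bottom_faces t m z \<or> (x, y + 1) \<in> bottom_faces t m z)"
proof -
  obtain zi zj where z: "z = (zi, zj)" by (cases z)
  define u v where "u = x - zi" and "v = y - zj"
  have xy: "x = u + zi" "y = v + zj" by (auto simp: u_def v_def)
  have e: "even (x + y + t) \<longleftrightarrow> even (u + v + int m)" using par unfolding xy z by auto
  have d: "x + 1 - zi = u + 1" "y + 1 - zj = v + 1" by (auto simp: u_def v_def)
  have m: "int (Suc m) = int m + 1" by simp
  show ?thesis
  proof (cases "even (u + v + int m)")
    case True
    then show ?thesis
      using near_vertex_outer[OF True] e
      unfolding aztec_vertices_iff bottom_faces_def z m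
      by (simp add: u_def[symmetric] v_def[symmetric] d)
  next
    case False
    note sw = near_vertex_swap[OF False]
    show ?thesis
      using near_vertex_outer[OF sw(1)] e False
      unfolding aztec_vertices_iff bottom_faces_def z m sw
      by (simp add: u_def[symmetric] v_def[symmetric] d) blast
  qed
qed

lemma aztec_vertices_bottom:
  "(x, y) \<in> aztec_vertices m z \<longleftrightarrow>
    (if even (x + y + t) then (x, y) \<in> bottom_faces t m z \<and> (x + 1, y + 1) \<in> bottom_faces t m z
     else (x + 1, y) \<in> bottom_faces t m z \<and> (x, y + 1) \<in> bottom_faces t m z)"
proof -
  obtain zi zj where z: "z = (zi, zj)" by (cases z)
  define u v where "u = x - zi" and "v = y - zj"
  have xy: "x = u + zi" "y = v + zj" by (auto simp: u_def v_def)
  have e: "even (x + y + t) \<longleftrightarrow> even (u + v + int m)" using par unfolding xy z by auto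
  have d: "x + 1 - zi = u + 1" "y + 1 - zj = v + 1" by (auto simp: u_def v_def)
  show ?thesis
  proof (cases "even (u + v + int m)")
    case True
    then show ?thesis
      using near_vertex_inner[OF True] e
      unfolding aztec_vertices_iff bottom_faces_def z
      by (simp add: u_def[symmetric] v_def[symmetric] d)
  next
    case False
    note sw = near_vertex_swap[OF False]
    show ?thesis
      using near_vertex_inner[OF sw(1)] e False
      unfolding aztec_vertices_iff bottom_faces_def z sw
      by (simp add: u_def[symmetric] v_def[symmetric] d) blast
  qed
qed

lemma kept_grid_dist:
  assumes "odd (i + j + t)"
  shows "grid_dist z (i, j) \<le> int m \<longleftrightarrow> grid_dist z (i, j) < int m"
proof -
  obtain zi zj where z: "z = (zi, zj)" by (cases z)
  have "odd (grid_dist z (i, j) + int m)"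
    using par assms unfolding z by auto
  then have "grid_dist z (i, j) \<noteq> int m" by auto
  then show ?thesis by auto
qed

lemma kept_neighbours:
  assumes "odd (i + j + t)" "grid_dist z (i, j) \<le> int m"
  shows "(i + 1, j) \<in> bottom_faces t m z" "(i - 1, j) \<in> bottom_faces t m z"
    "(i, j + 1) \<in> bottom_faces t m z" "(i, j - 1) \<in> bottom_faces t m z"
proof -
  obtain zi zj where z: "z = (zi, zj)" by (cases z)
  have "\<bar>i - zi\<bar> + \<bar>j - zj\<bar> < int m"
    using assms kept_grid_dist[OF assms(1)] by (simp add: z)
  then show "(i + 1, j) \<in> bottom_faces t m z" "(i - 1, j) \<in> bottom_faces t m z"
    "(i, j + 1) \<in> bottom_faces t m z" "(i, j - 1) \<in> bottom_faces t m z"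
    using assms(1) by (auto simp: bottom_faces_def z)
qed

end

section \<open>Edges and matchings of Aztec diamonds\<close>

lemma face_edges_eq:
  "face_edges (i, j) =
    {((i, j), (i - 1, j)), ((i - 1, j), (i, j)),
     ((i - 1, j), (i - 1, j - 1)), ((i - 1, j - 1), (i - 1, j)),
     ((i - 1, j - 1), (i, j - 1)), ((i, j - 1), (i - 1, j - 1)),
     ((i, j - 1), (i, j)), ((i, j), (i, j - 1))}" (is "_ = ?R")
proof (intro equalityI subsetI)
  fix e assume e: "e \<in> face_edges (i, j)"
  obtain x y x' y' where xy: "e = ((x, y), (x', y'))" by (metis surj_pair)
  have "x = i \<or> x = i - 1" "y = j \<or> y = j - 1" "x' = i \<or> x' = i - 1" "y' = j \<or> y' = j - 1"
    and "adjacent (x, y) (x', y')"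
    using e by (simp_all add: face_edges_def xy) blast+
  then show "e \<in> ?R" unfolding xy
    by (elim disjE; simp)
next
  fix e assume "e \<in> ?R"
  then show "e \<in> face_edges (i, j)" unfolding insert_iff empty_iff
    by (elim disjE; simp add: face_edges_def)
qed

lemma corners_eq: "corners (i, j) = {(i, j), (i - 1, j), (i - 1, j - 1), (i, j - 1)}"
  by auto

lemma adjacent_cases:
  assumes "adjacent p q"
  obtains x y where "p = (x, y) \<and> q = (x + 1, y) \<or> q = (x, y) \<and> p = (x + 1, y)"
  | x y where "p = (x, y) \<and> q = (x, y + 1) \<or> q = (x, y) \<and> p = (x, y + 1)"
proof -
  obtain x y x' y' where pq: "p = (x, y)" "q = (x', y')" by (metis surj_pair)
  have "(x' = x + 1 \<and> y' = y) \<or> (x = x' + 1 \<and> y' = y) \<or>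
        (x' = x \<and> y' = y + 1) \<or> (x' = x \<and> y = y' + 1)"
    using assms unfolding pq adjacent.simps by linarith
  then show ?thesis using that pq by auto
qed

lemma aztec_vertices_mono: "aztec_vertices m z \<subseteq> aztec_vertices (Suc m) z"
  unfolding aztec_vertices_def internal_faces_def by (rule UN_mono) auto

text \<open>Being an induced subgraph allows the edge set to stay fixed while the vertex set shrinks
  from one size to the next.\<close>

lemma aztec_edges_induced:
  "aztec_edges n z = {(p, q). adjacent p q \<and> p \<in> aztec_vertices n z \<and> q \<in> aztec_vertices n z}"
proof (intro equalityI subsetI)
  fix e assume "e \<in> aztec_edges n z"
  then show "e \<in> {(p, q). adjacent p q \<and> p \<in> aztec_vertices n z \<and> q \<in> aztec_vertices n z}"
    by (auto simp: aztec_edges_def aztec_vertices_def face_edges_def)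
next
  fix e assume "e \<in> {(p, q). adjacent p q \<and> p \<in> aztec_vertices n z \<and> q \<in> aztec_vertices n z}"
  then obtain p q where e: "e = (p, q)" and adj: "adjacent p q"
    and V: "p \<in> aztec_vertices n z" "q \<in> aztec_vertices n z" by auto
  obtain zi zj where z: "z = (zi, zj)" by (cases z)
  have int: "e \<in> aztec_edges n z" if "e \<in> face_edges f" "grid_dist z f < int n" for f
    using that unfolding aztec_edges_def internal_faces_def by blast
  \<comment> \<open>If \<open>u\<close> is nonnegative, the faces over \<open>u + 1\<close> are no
    farther than those over \<open>u + 2\<close>, otherwise no farther than those over
    \<open>u\<close>; so one end of the edge already forces an internal face that contains the whole
    edge.\<close>
  have arith: "\<bar>u + 1\<bar> + \<bar>v\<bar> < k \<or> \<bar>u + 1\<bar> + \<bar>v + 1\<bar> < k"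
    if "\<bar>u\<bar> + \<bar>v\<bar> < k \<or> \<bar>u + 1\<bar> + \<bar>v\<bar> < k \<or> \<bar>u\<bar> + \<bar>v + 1\<bar> < k \<or> \<bar>u + 1\<bar> + \<bar>v + 1\<bar> < k"
      "\<bar>u + 1\<bar> + \<bar>v\<bar> < k \<or> \<bar>u + 2\<bar> + \<bar>v\<bar> < k \<or> \<bar>u + 1\<bar> + \<bar>v + 1\<bar> < k \<or> \<bar>u + 2\<bar> + \<bar>v + 1\<bar> < k"
    for u v k :: int
    using that by (cases "u \<ge> 0") auto
  from adj show "e \<in> aztec_edges n z"
  proof (cases rule: adjacent_cases)
    case (1 x y)
    then have "e \<in> face_edges (x + 1, y)" "e \<in> face_edges (x + 1, y + 1)"
      by (auto simp: e face_edges_eq)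
    moreover have "(x, y) \<in> aztec_vertices n z" "(x + 1, y) \<in> aztec_vertices n z"
      using 1 V by auto
    then have "grid_dist z (x + 1, y) < int n \<or> grid_dist z (x + 1, y + 1) < int n"
      using arith[of "x - zi" "y - zj" "int n"] unfolding aztec_vertices_iff z
      by (simp add: algebra_simps)
    ultimately show ?thesis using int by blast
  next
    case (2 x y)
    then have "e \<in> face_edges (x, y + 1)" "e \<in> face_edges (x + 1, y + 1)"
      by (auto simp: e face_edges_eq)
    moreover have "(x, y) \<in> aztec_vertices n z" "(x, y + 1) \<in> aztec_vertices n z"
      using 2 V by auto
    then have "grid_dist z (x, y + 1) < int n \<or> grid_dist z (x + 1, y + 1) < int n"
      using arith[of "y - zj" "x - zi" "int n"] unfolding aztec_vertices_iff z
      by (simp add: algebra_simps) blast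
    ultimately show ?thesis using int by blast
  qed
qed

lemma oriented_dimers_matchings:
  assumes "aztec_edges n z \<subseteq> E" "\<And>p q. (p, q) \<in> E \<Longrightarrow> adjacent p q"
  shows "oriented_dimers n z = matchings E (aztec_vertices n z)"
proof -
  have mem: "e \<in> aztec_edges n z \<longleftrightarrow> e \<in> E \<and> fst e \<in> aztec_vertices n z \<and> snd e \<in> aztec_vertices n z"
    for e
  proof
    assume e: "e \<in> aztec_edges n z"
    have "fst e \<in> aztec_vertices n z \<and> snd e \<in> aztec_vertices n z"
      using e unfolding aztec_edges_induced by (cases e) simp
    then show "e \<in> E \<and> fst e \<in> aztec_vertices n z \<and> snd e \<in> aztec_vertices n z"
      using e assms(1) by blast
  next
    assume "e \<in> E \<and> fst e \<in> aztec_vertices n z \<and> snd e \<in> aztec_vertices n z"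
    then show "e \<in> aztec_edges n z"
      unfolding aztec_edges_induced using assms(2) by (cases e) simp
  qed
  have "M \<subseteq> aztec_edges n z \<longleftrightarrow>
      M \<subseteq> E \<and> (\<forall>e\<in>M. fst e \<in> aztec_vertices n z \<and> snd e \<in> aztec_vertices n z)" for M
    using mem by (meson subset_eq)
  then show ?thesis unfolding oriented_dimers_def matchings_def by simp
qed

context
  fixes z :: face and t :: int and m :: nat
  assumes par: "even (fst z + snd z + t + int m)"
begin

text \<open>The two faces at an edge have opposite parity, and the updated neighbours of a kept
  internal face are still within distance \<open>m\<close>.\<close>

lemma aztec_edges_bottom: "aztec_edges (Suc m) z \<subseteq> (\<Union>f\<in>bottom_faces t m z. face_edges f)"
proof
  fix e assume "e \<in> aztec_edges (Suc m) z"
  then obtain f where "f \<in> internal_faces (Suc m) z" "e \<in> face_edges f"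
    unfolding aztec_edges_def by blast
  moreover obtain i j where "f = (i, j)" by (cases f)
  ultimately have ij: "grid_dist z (i, j) \<le> int m" and e: "e \<in> face_edges (i, j)"
    by (simp_all add: internal_faces_def)
  show "e \<in> (\<Union>f\<in>bottom_faces t m z. face_edges f)"
  proof (cases "even (i + j + t)")
    case True
    then show ?thesis using ij e by (auto simp: bottom_faces_def)
  next
    case False
    note nb = kept_neighbours[OF par False ij]
    have "e \<in> face_edges (i + 1, j) \<or> e \<in> face_edges (i - 1, j) \<or>
      e \<in> face_edges (i, j + 1) \<or> e \<in> face_edges (i, j - 1)"
      using e unfolding face_edges_eq by auto
    then show ?thesis using nb by blast
  qed
qed

text \<open>Both sizes are expressed with the same edge set, so that afterwards only the weights and
  the vertex set differ.\<close>

lemma aztec_Z_matching_sum: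
  assumes "n = m \<or> n = Suc m"
  shows "aztec_Z n z a \<phi> = matching_sum (\<Union>f\<in>bottom_faces t m z. face_edges f)
           (\<lambda>e. \<phi> e * a (right_face e)) (aztec_vertices n z)"
proof -
  have "aztec_edges n z \<subseteq> aztec_edges (Suc m) z"
    using assms aztec_vertices_mono[of m z] by (auto simp: aztec_edges_induced)
  then have "oriented_dimers n z =
      matchings (\<Union>f\<in>bottom_faces t m z. face_edges f) (aztec_vertices n z)"
    using aztec_edges_bottom by (intro oriented_dimers_matchings) (auto simp: face_edges_def)
  then show ?thesis by (simp add: aztec_Z_def matching_sum_def)
qed

lemma disjoint_bottom_edges: "disjoint_family_on face_edges (bottom_faces t m z)"
  unfolding disjoint_family_on_def
proof (intro ballI impI)
  fix f f' assume f: "f \<in> bottom_faces t m z" "f' \<in> bottom_faces t m z" "f \<noteq> f'"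
  obtain i j i' j' where ij: "f = (i, j)" "f' = (i', j')" by (metis surj_pair)
  have "even (i + j + t)" "even (i' + j' + t)" "i \<noteq> i' \<or> j \<noteq> j'"
    using f by (auto simp: bottom_faces_def ij)
  then have "\<not> (i' = i \<and> j' = j + 1)" "\<not> (i' = i \<and> j' = j - 1)"
     "\<not> (i' = i + 1 \<and> j' = j)" "\<not> (i' = i - 1 \<and> j' = j)" "\<not> (i' = i \<and> j' = j)"
    by auto
  then show "face_edges f \<inter> face_edges f' = {}"
    unfolding ij face_edges_eq by auto
qed

end

text \<open>The boundary is traversed counterclockwise here, whereas the definition directs every
  edge from white to black. Exactly two of the four edges are reversed, so the product keeps its
  value.\<close>

lemma kasteleyn_face:
  assumes "kasteleyn_orientation n z \<phi>" "(i, j) \<in> internal_faces n z"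
  shows "e \<in> face_edges (i, j) \<Longrightarrow> \<phi> e \<in> {-1, 1}"
    and "(p, q) \<in> face_edges (i, j) \<Longrightarrow> \<phi> (q, p) = - \<phi> (p, q)"
    and "\<phi> ((i, j), (i - 1, j)) * \<phi> ((i - 1, j), (i - 1, j - 1)) *
         \<phi> ((i - 1, j - 1), (i, j - 1)) * \<phi> ((i, j - 1), (i, j)) = - 1"
proof -
  have sub: "face_edges (i, j) \<subseteq> aztec_edges n z"
    using assms(2) by (auto simp: aztec_edges_def)
  show 1: "\<phi> e \<in> {-1, 1}" if "e \<in> face_edges (i, j)" for e
    using assms(1) sub that unfolding kasteleyn_orientation_def by (cases e) blast
  show 2: "\<phi> (q, p) = - \<phi> (p, q)" if "(p, q) \<in> face_edges (i, j)" for p q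
    using assms(1) sub that unfolding kasteleyn_orientation_def by blast
  have pr: "(\<Prod>e\<in>{(w, b)\<in>face_edges (i, j). white w}. \<phi> e) = -1"
    using assms unfolding kasteleyn_orientation_def by blast
  have "\<phi> ((i - 1, j), (i, j)) = - \<phi> ((i, j), (i - 1, j))"
    "\<phi> ((i - 1, j - 1), (i - 1, j)) = - \<phi> ((i - 1, j), (i - 1, j - 1))"
    "\<phi> ((i, j - 1), (i - 1, j - 1)) = - \<phi> ((i - 1, j - 1), (i, j - 1))"
    "\<phi> ((i, j), (i, j - 1)) = - \<phi> ((i, j - 1), (i, j))"
    by (rule 2; simp add: face_edges_eq)+
  note flip = this
  show "\<phi> ((i, j), (i - 1, j)) * \<phi> ((i - 1, j), (i - 1, j - 1)) *
         \<phi> ((i - 1, j - 1), (i, j - 1)) * \<phi> ((i, j - 1), (i, j)) = - 1"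
  proof (cases "even (i + j)")
    case True
    have "\<phi> ((i, j), (i - 1, j)) * (\<phi> ((i, j), (i, j - 1)) *
        (\<phi> ((i - 1, j - 1), (i, j - 1)) * \<phi> ((i - 1, j - 1), (i - 1, j)))) = - 1"
      using pr True by (simp add: face_edges_white)
    then show ?thesis unfolding flip by (simp only: minus_mult_left[symmetric] minus_mult_right[symmetric] minus_minus mult_ac)
  next
    case False
    have "\<phi> ((i - 1, j), (i, j)) * (\<phi> ((i - 1, j), (i - 1, j - 1)) *
        (\<phi> ((i, j - 1), (i - 1, j - 1)) * \<phi> ((i, j - 1), (i, j)))) = - 1"
      using pr False by (simp add: face_edges_white)
    then show ?thesis unfolding flip by (simp only: minus_mult_left[symmetric] minus_mult_right[symmetric] minus_minus mult_ac)
  qed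
qed

section \<open>The dSKP recurrence and the ratio function\<close>

text \<open>
  Here \<open>x\<close> is the old weight of a face, \<open>y\<close> the new one, and \<open>n, e, s, w\<close> are the weights of the
  neighbours.  The numbers \<open>x\<close> and \<open>y\<close> are the two roots of the quadratic equation
  \<open>(n - q) (s - q) / ((e - q) (w - q)) = (n - x) (s - x) / ((e - x) (w - x))\<close> in \<open>q\<close>.
\<close>

definition dskp_det :: "real \<Rightarrow> real \<Rightarrow> real \<Rightarrow> real \<Rightarrow> real \<Rightarrow> real" where
  "dskp_det x n e s w = (n - x) * (s - x) - (e - x) * (w - x)"

definition dskp :: "real \<Rightarrow> real \<Rightarrow> real \<Rightarrow> real \<Rightarrow> real \<Rightarrow> real \<Rightarrow> bool" where
  "dskp x n e s w y \<longleftrightarrow> dskp_det x n e s w \<noteq> 0 \<and>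
     (n - y) * dskp_det x n e s w = (n - e) * (n - w) * (s - x)"

text \<open>The defining equation gives \<open>y\<close> through its difference to \<open>n\<close>;
  substituting it makes the other three polynomial identities. The four of them become the side
  conditions of \<open>four_cycle_complement\<close>.\<close>

lemma dskp_sides:
  assumes "dskp x n e s w y"
  shows "(n - y) * dskp_det x n e s w = (n - e) * (n - w) * (s - x)"
    "(e - y) * dskp_det x n e s w = - (n - e) * (s - e) * (w - x)"
    "(s - y) * dskp_det x n e s w = (s - e) * (s - w) * (n - x)"
    "(w - y) * dskp_det x n e s w = - (n - w) * (s - w) * (e - x)"
  using assms unfolding dskp_def dskp_det_def by algebra+

lemma dskp_det_inverse:
  assumes "dskp x n e s w y" "x \<noteq> 0" "n \<noteq> 0" "e \<noteq> 0" "s \<noteq> 0" "w \<noteq> 0"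
  shows "dskp_det (inverse x) (inverse n) (inverse e) (inverse s) (inverse w) =
    dskp_det x n e s w * y / (x * (n * e * s * w))"
proof -
  \<comment> \<open>Vieta: \<open>x * y\<close> is the product of the roots of the quadratic
    equation that relates old and new weight.\<close>
  have y: "y * dskp_det x n e s w * x = (n - x) * (s - x) * e * w - n * s * (e - x) * (w - x)"
    using assms(1) unfolding dskp_def dskp_det_def by algebra
  have "dskp_det (inverse x) (inverse n) (inverse e) (inverse s) (inverse w) =
     ((n - x) * (s - x) * e * w - n * s * (e - x) * (w - x)) / (x * x * (n * e * s * w))"
    unfolding dskp_det_def using assms(2-) by (simp add: field_simps)
  then show ?thesis unfolding y[symmetric] using assms(2-) by (simp add: field_simps)
qed

text \<open>The recurrence is invariant under Moebius transformations; inversion is the one that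
  occurs in the numerator of the ratio function.\<close>

lemma dskp_inverse:
  assumes d: "dskp x n e s w y" and nz: "x \<noteq> 0" "n \<noteq> 0" "e \<noteq> 0" "s \<noteq> 0" "w \<noteq> 0" "y \<noteq> 0"
  shows "dskp (inverse x) (inverse n) (inverse e) (inverse s) (inverse w) (inverse y)"
proof -
  have "dskp_det x n e s w \<noteq> 0" using d by (simp add: dskp_def)
  moreover have "(inverse n - inverse y) * (dskp_det x n e s w * y / (x * (n * e * s * w))) =
     - ((n - y) * dskp_det x n e s w) / (n * x * (n * e * s * w))"
    using nz by (simp add: field_simps)
  moreover have "\<dots> = (inverse n - inverse e) * (inverse n - inverse w) * (inverse s - inverse x)"
    unfolding dskp_sides(1)[OF d] using nz by (simp add: field_simps)
  ultimately show ?thesis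
    using nz unfolding dskp_def dskp_det_inverse[OF d nz(1-5)] by simp
qed

section \<open>Urban renewal at one face and on a whole diamond\<close>

fun face_det :: "(face \<Rightarrow> real) \<Rightarrow> face \<Rightarrow> real" where
  "face_det a (i, j) = dskp_det (a (i, j)) (a (i, j + 1)) (a (i + 1, j)) (a (i, j - 1)) (a (i - 1, j))"

fun face_dskp :: "(face \<Rightarrow> real) \<Rightarrow> (face \<Rightarrow> real) \<Rightarrow> face \<Rightarrow> bool" where
  "face_dskp a a' (i, j) \<longleftrightarrow>
     dskp (a (i, j)) (a (i, j + 1)) (a (i + 1, j)) (a (i, j - 1)) (a (i - 1, j)) (a' (i, j))"

text \<open>
  The difference of the two kept weights at a vertex, which is the factor by which the weights after
  urban renewal differ from those of the updated face weights.  The first sign makes the two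
  updated faces at the vertex agree on it up to a sign that depends on the face only.
\<close>

fun vertex_gap :: "int \<Rightarrow> (face \<Rightarrow> real) \<Rightarrow> vertex \<Rightarrow> real" where
  "vertex_gap t a (x, y) = (if even x then 1 else - 1) *
     (if even (x + y + t) then a (x, y + 1) - a (x + 1, y) else a (x, y) - a (x + 1, y + 1))"

text \<open>Two opposite edges of the counterclockwise boundary. By the Kasteleyn condition the
  other two have the opposite product; this turns the sum over the two matchings of a face into the
  difference \<open>dskp_det\<close>, up to this sign.\<close>

fun face_sign :: "(dedge \<Rightarrow> real) \<Rightarrow> face \<Rightarrow> real" where
  "face_sign \<phi> (i, j) = \<phi> ((i, j), (i - 1, j)) * \<phi> ((i - 1, j - 1), (i, j - 1))"

lemma face_complement:
  fixes \<phi> :: "dedge \<Rightarrow> real" and a a' :: "face \<Rightarrow> real"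
  defines "w \<equiv> \<lambda>e. \<phi> e * a (right_face e)" and "w' \<equiv> \<lambda>e. \<phi> e * a' (right_face e)"
  assumes K: "kasteleyn_orientation n z \<phi>" "(i, j) \<in> internal_faces n z"
    and ev: "even (i + j + t)"
    and d: "face_dskp a a' (i, j)"
    and kept: "\<And>i j. odd (i + j + t) \<Longrightarrow> a' (i, j) = a (i, j)"
    and c: "c \<subseteq> corners (i, j)"
  shows "matching_sum (face_edges (i, j)) w' c * (face_sign \<phi> (i, j) * face_det a (i, j)) =
    (\<Prod>p\<in>c. vertex_gap t a p) * matching_sum (face_edges (i, j)) w (corners (i, j) - c)"
proof -
  let ?p = "(i, j)" and ?q = "(i - 1, j)" and ?r = "(i - 1, j - 1)" and ?s = "(i, j - 1)"
  define P Q R S where "P = \<phi> (?p, ?q)" and "Q = \<phi> (?q, ?r)" and "R = \<phi> (?r, ?s)" and "S = \<phi> (?s, ?p)"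
  define x nn ee ss ww y where "x = a (i, j)" and "nn = a (i, j + 1)" and "ee = a (i + 1, j)"
    and "ss = a (i, j - 1)" and "ww = a (i - 1, j)" and "y = a' (i, j)"
  have xs': "a (i, 1 + j) = nn" "a (1 + i, j) = ee" by (simp_all add: nn_def ee_def add.commute)
  define D where "D = dskp_det x nn ee ss ww"
  note xs = x_def[symmetric] nn_def[symmetric] ee_def[symmetric] ss_def[symmetric]
    ww_def[symmetric] y_def[symmetric]
  note kf = kasteleyn_face[OF K]
  have flip: "\<phi> (?q, ?p) = - P" "\<phi> (?r, ?q) = - Q" "\<phi> (?s, ?r) = - R" "\<phi> (?p, ?s) = - S"
    unfolding P_def Q_def R_def S_def by (rule kf(2); simp add: face_edges_eq)+
  have "P \<in> {-1, 1}" "Q \<in> {-1, 1}" "R \<in> {-1, 1}" "S \<in> {-1, 1}"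
    unfolding P_def Q_def R_def S_def by (rule kf(1); simp add: face_edges_eq)+
  then have sq: "P * P = 1" "Q * Q = 1" "R * R = 1" "S * S = 1" by auto
  have PQRS: "P * Q * R * S = - 1" using kf(3) by (simp add: P_def Q_def R_def S_def)
  have QS: "Q * S = - (P * R)"
    using PQRS sq by algebra
  have k: "a' (i, j + 1) = nn" "a' (i + 1, j) = ee" "a' (i, j - 1) = ss" "a' (i - 1, j) = ww"
    unfolding nn_def ee_def ss_def ww_def by (rule kept; use ev in presburger)+
  then have k': "a' (i, 1 + j) = nn" "a' (1 + i, j) = ee" by (simp_all add: add.commute)
  \<comment> \<open>A counterclockwise edge has the neighbouring face on its right; its reversal has
    the face \<open>(i, j)\<close> itself there and the opposite sign.\<close>
  have wsum: "w (?p, ?q) + w (?q, ?p) = P * (nn - x)" "w (?q, ?r) + w (?r, ?q) = Q * (ww - x)"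
    "w (?r, ?s) + w (?s, ?r) = R * (ss - x)" "w (?s, ?p) + w (?p, ?s) = S * (ee - x)"
    unfolding w_def flip P_def[symmetric] Q_def[symmetric] R_def[symmetric] S_def[symmetric]
    by (simp_all add: xs xs' right_diff_distrib)
  have wsum': "w' (?p, ?q) + w' (?q, ?p) = P * (nn - y)" "w' (?q, ?r) + w' (?r, ?q) = Q * (ww - y)"
    "w' (?r, ?s) + w' (?s, ?r) = R * (ss - y)" "w' (?s, ?p) + w' (?p, ?s) = S * (ee - y)"
    unfolding w'_def flip P_def[symmetric] Q_def[symmetric] R_def[symmetric] S_def[symmetric]
    by (simp_all add: xs k k' right_diff_distrib)
  define \<sigma> :: real where "\<sigma> = (if even i then 1 else - 1)"
  have \<sigma>: "\<sigma> * \<sigma> = 1" by (simp add: \<sigma>_def)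
  \<comment> \<open>The sign alternating with the column gives all four corners the same
    \<open>\<sigma>\<close>, which cancels because every side involves two corners.\<close>
  have gap: "vertex_gap t a ?p = \<sigma> * (nn - ee)" "vertex_gap t a ?q = \<sigma> * (nn - ww)"
    "vertex_gap t a ?r = \<sigma> * (ss - ww)" "vertex_gap t a ?s = \<sigma> * (ss - ee)"
    using ev by (auto simp: \<sigma>_def nn_def ee_def ss_def ww_def)
  have dd: "dskp x nn ee ss ww y" using d by (simp add: xs)
  note sides = dskp_sides[OF dd, folded D_def]
  have D0: "D \<noteq> 0" using dd by (simp add: dskp_def D_def)
  have dist: "distinct [?p, ?q, ?r, ?s]" by simp
  have PR: "P * R \<noteq> 0" using sq by auto
  have fd: "face_sign \<phi> (i, j) * face_det a (i, j) = P * R * D"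
    by (simp add: P_def R_def D_def xs)
  show ?thesis
    unfolding corners_eq fd
  proof (rule four_cycle_complement[OF dist])
    show "face_edges (i, j) = {(?p, ?q), (?q, ?p), (?q, ?r), (?r, ?q), (?r, ?s), (?s, ?r), (?s, ?p), (?p, ?s)}"
      by (rule face_edges_eq)
    show "P * R * D = (w (?p, ?q) + w (?q, ?p)) * (w (?r, ?s) + w (?s, ?r)) +
      (w (?q, ?r) + w (?r, ?q)) * (w (?s, ?p) + w (?p, ?s))"
      unfolding wsum using QS unfolding D_def dskp_det_def by algebra
    show "P * R * D \<noteq> 0" using PR D0 by simp
    show "(w' (?p, ?q) + w' (?q, ?p)) * (P * R * D) =
      vertex_gap t a ?p * vertex_gap t a ?q * (w (?r, ?s) + w (?s, ?r))"
      unfolding wsum wsum' gap using sides(1) sq(1) \<sigma> by algebra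
    show "(w' (?q, ?r) + w' (?r, ?q)) * (P * R * D) =
      vertex_gap t a ?q * vertex_gap t a ?r * (w (?s, ?p) + w (?p, ?s))"
      unfolding wsum wsum' gap using sides(4) sq(2) QS \<sigma> by algebra
    show "(w' (?r, ?s) + w' (?s, ?r)) * (P * R * D) =
      vertex_gap t a ?r * vertex_gap t a ?s * (w (?p, ?q) + w (?q, ?p))"
      unfolding wsum wsum' gap using sides(3) sq(3) \<sigma> by algebra
    show "(w' (?s, ?p) + w' (?p, ?s)) * (P * R * D) =
      vertex_gap t a ?s * vertex_gap t a ?p * (w (?q, ?r) + w (?r, ?q))"
      unfolding wsum wsum' gap using sides(2) sq(4) QS \<sigma> by algebra
    show "c \<subseteq> {?p, ?q, ?r, ?s}" using c unfolding corners_eq .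
  qed
qed

lemma bottom_faces_internal: "bottom_faces t m z \<subseteq> internal_faces (Suc m) z"
  by (auto simp: bottom_faces_def internal_faces_def)

lemma finite_bottom_faces: "finite (bottom_faces t m z)"
  by (rule finite_subset[OF bottom_faces_internal])
     (use finite_aztec_faces[of "Suc m" z] in \<open>simp add: aztec_faces_def\<close>)

lemma aztec_Z_step:
  assumes par: "even (fst z + snd z + t + int m)"
    and K: "kasteleyn_orientation (Suc m) z \<phi>"
    and d: "\<And>f. f \<in> bottom_faces t m z \<Longrightarrow> face_dskp a a' f"
    and kept: "\<And>i j. odd (i + j + t) \<Longrightarrow> a' (i, j) = a (i, j)"
  shows "aztec_Z m z a' \<phi> * (\<Prod>f\<in>bottom_faces t m z. face_sign \<phi> f * face_det a f) =
    (\<Prod>p\<in>aztec_vertices m z. vertex_gap t a p) * aztec_Z (Suc m) z a \<phi>"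
proof -
  let ?B = "bottom_faces t m z"
  have V: "aztec_Z n z a \<phi> = matching_sum (\<Union>f\<in>?B. face_edges f)
           (\<lambda>e. \<phi> e * a (right_face e)) (aztec_vertices n z)" if "n = m \<or> n = Suc m" for n a
    by (rule aztec_Z_matching_sum[OF par that])
  show ?thesis
    unfolding V[of m, OF disjI1[OF refl]] V[of "Suc m", OF disjI2[OF refl]]
  proof (rule matching_sum_complement[where C = corners])
    show "finite ?B" by (rule finite_bottom_faces)
    show "finite (face_edges f)" for f by (cases f) (simp add: face_edges_eq)
    show "finite (corners f)" for f by (cases f) simp
    show "disjoint_family_on face_edges ?B" by (rule disjoint_bottom_edges[OF par])
    show "fst e \<in> corners f \<and> snd e \<in> corners f" if "e \<in> face_edges f" for e f
      using that by (auto simp: face_edges_def)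
    show "corners f \<subseteq> aztec_vertices (Suc m) z" if "f \<in> ?B" for f
      using that bottom_faces_internal unfolding aztec_vertices_def by blast
    show "aztec_vertices m z \<subseteq> aztec_vertices (Suc m) z"
      by (rule aztec_vertices_mono)
    show "\<exists>f f'. f \<noteq> f' \<and> {h \<in> ?B. p \<in> corners h} = {f, f'}" if "p \<in> aztec_vertices m z" for p
    proof -
      obtain x y where p: "p = (x, y)" by (cases p)
      show ?thesis
      proof (cases "even (x + y + t)")
        case True
        then have "{h \<in> ?B. p \<in> corners h} = {(x, y), (x + 1, y + 1)}"
          using that unfolding p corner_bottom_faces aztec_vertices_bottom[OF par] by auto
        then show ?thesis by (intro exI[of _ "(x, y)"] exI[of _ "(x + 1, y + 1)"]) simp
      next
        case False
        then have "{h \<in> ?B. p \<in> corners h} = {(x + 1, y), (x, y + 1)}"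
          using that unfolding p corner_bottom_faces aztec_vertices_bottom[OF par] by auto
        then show ?thesis by (intro exI[of _ "(x + 1, y)"] exI[of _ "(x, y + 1)"]) simp
      qed
    qed
    show "\<exists>f. {h \<in> ?B. p \<in> corners h} = {f}"
      if "p \<in> aztec_vertices (Suc m) z - aztec_vertices m z" for p
    proof -
      obtain x y where p: "p = (x, y)" by (cases p)
      have 1: "p \<in> aztec_vertices (Suc m) z" "p \<notin> aztec_vertices m z" using that by auto
      show ?thesis
        using 1 unfolding p corner_bottom_faces aztec_vertices_bottom[OF par] aztec_vertices_Suc_bottom[OF par]
        by (auto split: if_splits)
    qed
    show "matching_sum (face_edges f) (\<lambda>e. \<phi> e * a' (right_face e)) c * (face_sign \<phi> f * face_det a f) =
        (\<Prod>p\<in>c. vertex_gap t a p) *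
        matching_sum (face_edges f) (\<lambda>e. \<phi> e * a (right_face e)) (corners f - c)"
      if f: "f \<in> ?B" and c: "c \<subseteq> corners f" for f c
    proof -
      obtain i j where ij: "f = (i, j)" by (cases f)
      have "even (i + j + t)" using f by (simp add: ij bottom_faces_def)
      then show ?thesis
        unfolding ij using face_complement[OF K, of i j t a a' c] bottom_faces_internal f d[OF f] kept c
        unfolding ij by blast
    qed
  qed
qed


text \<open>Reflection in the vertical axis through the centre pairs the vertices, none of which
  lies on that axis. The parity matters because inverting the weights changes the sign of every
  \<open>vertex_gap\<close>.\<close>

lemma even_card_aztec_vertices: "even (card (aztec_vertices n z))"
proof -
  obtain zi zj where z: "z = (zi, zj)" by (cases z)
  let ?V = "aztec_vertices n z"
  define L where "L = {p \<in> ?V. fst p < zi}"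
  define h :: "vertex \<Rightarrow> vertex" where "h = (\<lambda>(x, y). (2 * zi - 1 - x, y))"
  have fin: "finite ?V"
    unfolding aztec_vertices_def using finite_aztec_faces[of n z]
    by (auto simp: aztec_faces_def)
  have abs: "\<bar>2 * zi - 1 - x - zi\<bar> = \<bar>x + 1 - zi\<bar>" "\<bar>2 * zi - 1 - x + 1 - zi\<bar> = \<bar>x - zi\<bar>" for x
    by auto
  have hV: "h p \<in> ?V" if "p \<in> ?V" for p
  proof -
    obtain x y where p: "p = (x, y)" by (cases p)
    show ?thesis
      using that unfolding p h_def prod.case aztec_vertices_iff z grid_dist.simps abs by blast
  qed
  have hh: "h (h p) = p" for p by (cases p) (simp add: h_def)
  have neg: "fst (h p) < zi \<longleftrightarrow> \<not> fst p < zi" for p by (cases p) (auto simp: h_def)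
  have "?V = L \<union> h ` L"
  proof (intro equalityI subsetI)
    fix p assume p: "p \<in> ?V"
    show "p \<in> L \<union> h ` L"
    proof (cases "fst p < zi")
      case False
      then have "h p \<in> L" using hV[OF p] neg by (simp add: L_def)
      then show ?thesis using hh[of p] by (metis UnI2 imageI)
    qed (use p in \<open>simp add: L_def\<close>)
  next
    fix p assume "p \<in> L \<union> h ` L"
    then show "p \<in> ?V" using hV by (auto simp: L_def)
  qed
  moreover have "card (L \<union> h ` L) = card L + card (h ` L)"
  proof (rule card_Un_disjoint)
    show "finite L" "finite (h ` L)" using fin by (simp_all add: L_def)
    show "L \<inter> h ` L = {}" using neg by (auto simp: L_def)
  qed
  moreover have "card (h ` L) = card L"
    by (rule card_image) (metis hh inj_onI)
  ultimately show ?thesis by simp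
qed

section \<open>Powers of the kept face weights\<close>

fun face_neighbours :: "face \<Rightarrow> face set" where
  "face_neighbours (i, j) = {(i, j + 1), (i + 1, j), (i, j - 1), (i - 1, j)}"

text \<open>The denominator that arises from a difference of inverses when \<open>vertex_gap\<close>
  is formed from inverted weights.\<close>

fun vertex_product :: "int \<Rightarrow> (face \<Rightarrow> real) \<Rightarrow> vertex \<Rightarrow> real" where
  "vertex_product t a (x, y) =
     (if even (x + y + t) then a (x, y + 1) * a (x + 1, y) else a (x, y) * a (x + 1, y + 1))"

lemma card_Int_insert:
  "finite X \<Longrightarrow> p \<notin> X \<Longrightarrow> card (A \<inter> insert p X) = of_bool (p \<in> A) + card (A \<inter> X)"
  by (simp add: Int_insert_right)

context
  fixes z :: face and t :: int and m :: nat
  assumes par: "even (fst z + snd z + t + int m)"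
begin

text \<open>These are the exponents of \<open>a h\<close> in \<open>kept_face_products\<close>. A
  corner of \<open>h\<close> belongs to the smaller diamond when both updated neighbours of
  \<open>h\<close> next to it are within distance \<open>m\<close>. Inside, there are four corners
  and four neighbours; at distance \<open>m + 1\<close> there are one neighbour and no corner on the
  axes through the centre, two neighbours and one corner elsewhere.\<close>

lemma kept_face_count:
  assumes h: "h \<in> bottom_faces (t + 1) (Suc m) z"
  shows "1 + card {p \<in> aztec_vertices m z. p \<in> corners h} =
    of_bool (h \<in> bottom_faces (t + 1) m z) + card {f \<in> bottom_faces t m z. h \<in> face_neighbours f}"
proof -
  let ?B = "bottom_faces t m z"
  obtain i j where ij: "h = (i, j)" by (cases h)
  obtain zi zj where z: "z = (zi, zj)" by (cases z)
  have odd: "odd (i + j + t)" and dist: "grid_dist z (i, j) \<le> int m + 1"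
    using h by (auto simp: bottom_faces_def ij)
  define N E S W where "N \<longleftrightarrow> (i, j + 1) \<in> ?B" and "E \<longleftrightarrow> (i + 1, j) \<in> ?B"
    and "S \<longleftrightarrow> (i, j - 1) \<in> ?B" and "W \<longleftrightarrow> (i - 1, j) \<in> ?B"
  note B = N_def[symmetric] E_def[symmetric] S_def[symmetric] W_def[symmetric]
  have "{f \<in> ?B. h \<in> face_neighbours f} = ?B \<inter> {(i, j + 1), (i + 1, j), (i, j - 1), (i - 1, j)}"
    by (auto simp: ij)
  then have c1: "card {f \<in> ?B. h \<in> face_neighbours f} = of_bool N + of_bool E + of_bool S + of_bool W"
    by (simp add: card_Int_insert B)
  have "{p \<in> aztec_vertices m z. p \<in> corners h} =
      aztec_vertices m z \<inter> {(i, j), (i - 1, j), (i - 1, j - 1), (i, j - 1)}"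
    unfolding ij corners_eq by blast
  moreover have "(i, j) \<in> aztec_vertices m z \<longleftrightarrow> N \<and> E" "(i - 1, j) \<in> aztec_vertices m z \<longleftrightarrow> N \<and> W"
    "(i - 1, j - 1) \<in> aztec_vertices m z \<longleftrightarrow> S \<and> W" "(i, j - 1) \<in> aztec_vertices m z \<longleftrightarrow> S \<and> E"
    using odd unfolding aztec_vertices_bottom[OF par] by (auto simp: B)
  ultimately have c2: "card {p \<in> aztec_vertices m z. p \<in> corners h} =
      of_bool (N \<and> E) + of_bool (N \<and> W) + of_bool (S \<and> W) + of_bool (S \<and> E)"
    by (simp add: card_Int_insert)
  show ?thesis
  proof (cases "grid_dist z (i, j) \<le> int m")
    case True
    have "N" "E" "S" "W"
      using kept_neighbours[OF par odd True] by (simp_all add: B)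
    moreover have "h \<in> bottom_faces (t + 1) m z" using h True by (simp add: bottom_faces_def ij)
    ultimately show ?thesis unfolding c1 c2 by simp
  next
    case False
    then have d: "\<bar>i - zi\<bar> + \<bar>j - zj\<bar> = int m + 1" using dist by (simp add: z)
    have "E \<longleftrightarrow> i < zi" "W \<longleftrightarrow> i > zi" "N \<longleftrightarrow> j < zj" "S \<longleftrightarrow> j > zj"
      using odd d unfolding E_def W_def N_def S_def bottom_faces_def z by auto
    moreover have "i \<noteq> zi \<or> j \<noteq> zj" using d by auto
    moreover have "h \<notin> bottom_faces (t + 1) m z" using False by (simp add: bottom_faces_def ij)
    ultimately show ?thesis unfolding c1 c2 by (auto simp: not_less_iff_gr_or_eq)
  qed
qed

text \<open>Double counting: the products over vertices and over updated faces are both regrouped by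
  the kept face \<open>h\<close>, after which only exponents are compared.\<close>

lemma kept_face_products:
  fixes a :: "face \<Rightarrow> real"
  shows "(\<Prod>h\<in>bottom_faces (t + 1) (Suc m) z. a h) * (\<Prod>p\<in>aztec_vertices m z. vertex_product t a p) =
    (\<Prod>h\<in>bottom_faces (t + 1) m z. a h) *
    (\<Prod>f\<in>bottom_faces t m z. \<Prod>h\<in>face_neighbours f. a h)"
proof -
  let ?B = "bottom_faces t m z" and ?K = "bottom_faces (t + 1) (Suc m) z"
    and ?K' = "bottom_faces (t + 1) m z" and ?V = "aztec_vertices m z"
  obtain zi zj where z: "z = (zi, zj)" by (cases z)
  have finV: "finite ?V"
    unfolding aztec_vertices_def using finite_aztec_faces[of m z] by (auto simp: aztec_faces_def)
  have nb: "face_neighbours f \<subseteq> ?K" if "f \<in> ?B" for f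
    using that by (cases f) (auto simp: bottom_faces_def z)
  have vp: "vertex_product t a p = (\<Prod>h\<in>{h \<in> ?K. p \<in> corners h}. a h)" if "p \<in> ?V" for p
  proof -
    obtain x y where p: "p = (x, y)" by (cases p)
    show ?thesis
    proof (cases "even (x + y + t)")
      case True
      then have "(x, y) \<in> ?B" "(x + 1, y + 1) \<in> ?B"
        using that unfolding p aztec_vertices_bottom[OF par] by auto
      then have "(x + 1, y) \<in> ?K" "(x, y + 1) \<in> ?K"
        using nb[of "(x, y)"] by auto
      then have "{h \<in> ?K. p \<in> corners h} = {(x + 1, y), (x, y + 1)}"
        unfolding p corner_bottom_faces using True by auto
      then show ?thesis using True by (simp add: p)
    next
      case False
      then have "(x + 1, y) \<in> ?B" "(x, y + 1) \<in> ?B"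
        using that unfolding p aztec_vertices_bottom[OF par] by auto
      then have "(x, y) \<in> ?K" "(x + 1, y + 1) \<in> ?K"
        using nb[of "(x + 1, y)"] by auto
      then have "{h \<in> ?K. p \<in> corners h} = {(x, y), (x + 1, y + 1)}"
        unfolding p corner_bottom_faces using False by auto
      then show ?thesis using False by (simp add: p)
    qed
  qed
  have "(\<Prod>p\<in>?V. vertex_product t a p) = (\<Prod>p\<in>?V. \<Prod>h\<in>{h \<in> ?K. p \<in> corners h}. a h)"
    by (rule prod.cong) (simp_all add: vp)
  also have "\<dots> = (\<Prod>h\<in>?K. \<Prod>p\<in>{p \<in> ?V. p \<in> corners h}. a h)"
    by (rule prod.swap_restrict[OF finV finite_bottom_faces])
  finally have 1: "(\<Prod>p\<in>?V. vertex_product t a p) = (\<Prod>h\<in>?K. a h ^ card {p \<in> ?V. p \<in> corners h})"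
    by simp
  have "(\<Prod>f\<in>?B. \<Prod>h\<in>face_neighbours f. a h) = (\<Prod>f\<in>?B. \<Prod>h\<in>{h \<in> ?K. h \<in> face_neighbours f}. a h)"
    by (intro prod.cong refl) (use nb in auto)
  also have "\<dots> = (\<Prod>h\<in>?K. \<Prod>f\<in>{f \<in> ?B. h \<in> face_neighbours f}. a h)"
    by (rule prod.swap_restrict[OF finite_bottom_faces finite_bottom_faces])
  finally have 2: "(\<Prod>f\<in>?B. \<Prod>h\<in>face_neighbours f. a h) =
      (\<Prod>h\<in>?K. a h ^ card {f \<in> ?B. h \<in> face_neighbours f})"
    by simp
  have "?K' \<subseteq> ?K" by (auto simp: bottom_faces_def)
  then have "(\<Prod>h\<in>?K'. a h) = (\<Prod>h\<in>?K. if h \<in> ?K' then a h else 1)"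
    by (simp add: prod.inter_restrict[OF finite_bottom_faces, symmetric] Int_absorb1)
  also have "\<dots> = (\<Prod>h\<in>?K. a h ^ of_bool (h \<in> ?K'))"
    by (rule prod.cong) auto
  finally have 3: "(\<Prod>h\<in>?K'. a h) = (\<Prod>h\<in>?K. a h ^ of_bool (h \<in> ?K'))" .
  have "(\<Prod>h\<in>?K. a h) * (\<Prod>h\<in>?K. a h ^ card {p \<in> ?V. p \<in> corners h}) =
      (\<Prod>h\<in>?K. a h ^ (1 + card {p \<in> ?V. p \<in> corners h}))"
    by (simp add: prod.distrib)
  also have "\<dots> = (\<Prod>h\<in>?K. a h ^ (of_bool (h \<in> ?K') + card {f \<in> ?B. h \<in> face_neighbours f}))"
    by (rule prod.cong[OF refl]) (simp only: kept_face_count)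
  also have "\<dots> = (\<Prod>h\<in>?K. a h ^ of_bool (h \<in> ?K')) *
      (\<Prod>h\<in>?K. a h ^ card {f \<in> ?B. h \<in> face_neighbours f})"
    by (simp only: power_add prod.distrib)
  finally show ?thesis unfolding 1 2 3 .
qed

text \<open>For parity reasons no updated face is at distance \<open>m + 1\<close>, so radius
  \<open>m\<close> captures all of them in the larger diamond too.\<close>

lemma aztec_faces_split:
  "aztec_faces (Suc m) z = bottom_faces t m z \<union> bottom_faces (t + 1) (Suc m) z"
  "aztec_faces m z = bottom_faces t m z \<union> bottom_faces (t + 1) m z"
proof -
  obtain zi zj where z: "z = (zi, zj)" by (cases z)
  have F: "aztec_faces n z = {f. grid_dist z f \<le> int n}" for n
    by (auto simp: aztec_faces_def internal_faces_def open_faces_def)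
  have ne: "grid_dist z (i, j) \<noteq> int m + 1" if "even (i + j + t)" for i j
  proof -
    have "even (grid_dist z (i, j) + int m)" using par that unfolding z by auto
    then show ?thesis by auto
  qed
  have le: "grid_dist z f \<le> int (Suc m) \<longleftrightarrow> grid_dist z f \<le> int m" if "even (fst f + snd f + t)" for f
    using ne[OF that] by auto
  show "aztec_faces (Suc m) z = bottom_faces t m z \<union> bottom_faces (t + 1) (Suc m) z"
  proof (intro set_eqI)
    show "f \<in> aztec_faces (Suc m) z \<longleftrightarrow> f \<in> bottom_faces t m z \<union> bottom_faces (t + 1) (Suc m) z" for f
      using le[of f] unfolding F bottom_faces_def
      by (cases "even (fst f + snd f + t)") (auto simp del: of_nat_Suc)
  qed
  show "aztec_faces m z = bottom_faces t m z \<union> bottom_faces (t + 1) m z"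
    unfolding F bottom_faces_def by auto
qed

end

section \<open>Invariance of the ratio function\<close>

lemma bottom_faces_disjoint: "bottom_faces t m z \<inter> bottom_faces (t + 1) n z = {}"
  by (auto simp: bottom_faces_def)

text \<open>The value of the ratio function, stated without a quotient. At size 0 it yields
  \<open>a z\<close>, in agreement with the convention made there, so the induction has a uniform
  statement.\<close>

definition aztec_ratio :: "nat \<Rightarrow> face \<Rightarrow> (face \<Rightarrow> real) \<Rightarrow> (dedge \<Rightarrow> real) \<Rightarrow> real \<Rightarrow> bool" where
  "aztec_ratio n z a \<phi> y \<longleftrightarrow> aztec_Z n z a \<phi> \<noteq> 0 \<and>
     y * aztec_Z n z a \<phi> = (\<Prod>f\<in>aztec_faces n z. a f) * aztec_Z n z (\<lambda>f. inverse (a f)) \<phi>"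

text \<open>\<open>aztec_Z_step\<close> is applied to the weights and to their inverses. The two
  transformation factors differ by a monomial: the determinants exchange old updated weights for new
  ones and produce powers of the neighbours, the gaps produce \<open>vertex_product\<close>.\<close>

lemma aztec_ratio_step:
  assumes par: "even (fst z + snd z + t + int m)"
    and K: "kasteleyn_orientation (Suc m) z \<phi>"
    and d: "\<And>f. f \<in> bottom_faces t m z \<Longrightarrow> face_dskp a a' f"
    and kept: "\<And>i j. odd (i + j + t) \<Longrightarrow> a' (i, j) = a (i, j)"
    and nz: "\<And>f. a f \<noteq> 0" "\<And>f. a' f \<noteq> 0"
    and gap: "\<And>p. vertex_gap t a p \<noteq> 0"
    and ratio: "aztec_ratio m z a' \<phi> y"
  shows "aztec_ratio (Suc m) z a \<phi> y"
proof -
  let ?B = "bottom_faces t m z" and ?V = "aztec_vertices m z"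
  let ?i = "\<lambda>a f. inverse (a f) :: real"
  have signnz: "face_sign \<phi> f \<noteq> 0" if f: "f \<in> ?B" for f
  proof -
    obtain i j where ij: "f = (i, j)" by (cases f)
    have int: "(i, j) \<in> internal_faces (Suc m) z" using f bottom_faces_internal unfolding ij by blast
    have "\<phi> ((i, j), (i - 1, j)) \<in> {-1, 1}" "\<phi> ((i - 1, j - 1), (i, j - 1)) \<in> {-1, 1}"
      by (rule kasteleyn_face(1)[OF K int]; simp add: face_edges_eq)+
    then show ?thesis by (auto simp: ij)
  qed
  have detnz: "face_det a f \<noteq> 0" if "f \<in> ?B" for f
    using d[OF that] by (cases f) (simp add: dskp_def)
  have di: "face_dskp (?i a) (?i a') f" if "f \<in> ?B" for f
    using d[OF that] by (cases f) (simp add: dskp_inverse nz)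
  have deti: "face_det (?i a) f = face_det a f * a' f / (a f * (\<Prod>h\<in>face_neighbours f. a h))"
    if "f \<in> ?B" for f
    using d[OF that] by (cases f) (simp add: dskp_det_inverse nz mult.assoc)
  have gapi: "vertex_gap t (?i a) p = - vertex_gap t a p / vertex_product t a p" for p
    by (cases p) (auto simp: nz field_simps)
  have vpnz: "vertex_product t a p \<noteq> 0" for p
    by (cases p) (simp add: nz)
  define D where "D = (\<Prod>f\<in>?B. face_sign \<phi> f * face_det a f)"
  define G where "G = (\<Prod>p\<in>?V. vertex_gap t a p)"
  define VP where "VP = (\<Prod>p\<in>?V. vertex_product t a p)"
  define NP where "NP = (\<Prod>f\<in>?B. \<Prod>h\<in>face_neighbours f. a h)"
  define PB where "PB = (\<Prod>f\<in>?B. a f)"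
  define PB' where "PB' = (\<Prod>f\<in>?B. a' f)"
  define PK where "PK = (\<Prod>f\<in>bottom_faces (t + 1) (Suc m) z. a f)"
  define PK' where "PK' = (\<Prod>f\<in>bottom_faces (t + 1) m z. a f)"
  have D0: "D \<noteq> 0" using signnz detnz by (simp add: D_def finite_bottom_faces)
  have finV: "finite ?V"
    unfolding aztec_vertices_def using finite_aztec_faces[of m z] by (auto simp: aztec_faces_def)
  have G0: "G \<noteq> 0" using gap finV by (simp add: G_def)
  have VP0: "VP \<noteq> 0" using vpnz finV by (simp add: VP_def)
  have nb0: "(\<Prod>h\<in>face_neighbours f. a h) \<noteq> 0" for f
    by (cases f) (simp add: nz)
  have P0: "PB \<noteq> 0" "NP \<noteq> 0"
    using nb0 nz by (simp_all add: PB_def NP_def finite_bottom_faces)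
  have "(\<Prod>f\<in>?B. face_sign \<phi> f * face_det (?i a) f) =
      (\<Prod>f\<in>?B. face_sign \<phi> f * face_det a f * a' f / (a f * (\<Prod>h\<in>face_neighbours f. a h)))"
    by (rule prod.cong) (simp_all add: deti)
  then have Di: "(\<Prod>f\<in>?B. face_sign \<phi> f * face_det (?i a) f) = D * PB' / (PB * NP)"
    by (simp only: prod_dividef prod.distrib D_def PB'_def PB_def NP_def)
  have "(\<Prod>p\<in>?V. - vertex_gap t a p / vertex_product t a p) =
      (\<Prod>p\<in>?V. (- 1) * (vertex_gap t a p / vertex_product t a p))"
    by simp
  also have "\<dots> = (- 1) ^ card ?V * (\<Prod>p\<in>?V. vertex_gap t a p / vertex_product t a p)"
    unfolding prod.distrib by simp
  \<comment> \<open>The number of vertices is even, so the signs of the inverted gaps multiply to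
    1.\<close>
  finally have Gi: "(\<Prod>p\<in>?V. vertex_gap t (?i a) p) = G / VP"
    by (simp add: gapi even_card_aztec_vertices prod_dividef G_def VP_def)
  have s1: "aztec_Z m z a' \<phi> * D = G * aztec_Z (Suc m) z a \<phi>"
    unfolding D_def G_def by (rule aztec_Z_step[OF par K d kept])
  have s2: "aztec_Z m z (?i a') \<phi> * (D * PB' / (PB * NP)) = G / VP * aztec_Z (Suc m) z (?i a) \<phi>"
    unfolding Di[symmetric] Gi[symmetric] by (rule aztec_Z_step[OF par K di]) (simp_all add: kept)
  have PKVP: "PK * VP = PK' * NP"
    unfolding PK_def VP_def PK'_def NP_def by (rule kept_face_products[OF par])
  have F1: "(\<Prod>f\<in>aztec_faces (Suc m) z. a f) = PB * PK"
    unfolding aztec_faces_split(1)[OF par] PB_def PK_def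
    by (intro prod.union_disjoint finite_bottom_faces bottom_faces_disjoint)
  have "(\<Prod>f\<in>bottom_faces (t + 1) m z. a' f) = PK'"
    unfolding PK'_def
  proof (rule prod.cong[OF refl])
    fix f assume f: "f \<in> bottom_faces (t + 1) m z"
    obtain i j where ij: "f = (i, j)" by (cases f)
    have "odd (i + j + t)" using f unfolding bottom_faces_def ij by simp
    then show "a' f = a f" unfolding ij by (rule kept)
  qed
  then have F2: "(\<Prod>f\<in>aztec_faces m z. a' f) = PB' * PK'"
    unfolding aztec_faces_split(2)[OF par] PB'_def
    by (simp add: prod.union_disjoint finite_bottom_faces bottom_faces_disjoint)
  have Z': "aztec_Z m z a' \<phi> \<noteq> 0" "y * aztec_Z m z a' \<phi> = PB' * PK' * aztec_Z m z (?i a') \<phi>"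
    using ratio unfolding aztec_ratio_def F2 by auto
  have Z0: "aztec_Z (Suc m) z a \<phi> \<noteq> 0" using s1 Z'(1) D0 by auto
  have e1: "aztec_Z (Suc m) z a \<phi> = aztec_Z m z a' \<phi> * D / G"
    using s1 G0 by (simp add: field_simps)
  have e2: "aztec_Z (Suc m) z (?i a) \<phi> = aztec_Z m z (?i a') \<phi> * D * PB' * VP / (PB * NP * G)"
    using s2 G0 VP0 P0 by (simp add: field_simps)
  \<comment> \<open>The old updated weights \<open>PB\<close> cancel against the inverted
    determinants, leaving the new ones \<open>PB'\<close>; \<open>PKVP\<close> then reduces the kept
    weights to those of the smaller diamond.\<close>
  have "PB * PK * aztec_Z (Suc m) z (?i a) \<phi> =
      (PK * VP) * (aztec_Z m z (?i a') \<phi> * D * PB') / (NP * G)"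
    unfolding e2 using P0 G0 by (simp add: field_simps)
  also have "\<dots> = (PB' * PK' * aztec_Z m z (?i a') \<phi>) * D / G"
    unfolding PKVP using P0 G0 by (simp add: field_simps)
  also have "\<dots> = y * aztec_Z (Suc m) z a \<phi>"
    unfolding Z'(2)[symmetric] e1 by simp
  finally show ?thesis
    using Z0 unfolding aztec_ratio_def F1 by simp
qed

lemma kasteleyn_orientation_Suc:
  assumes "kasteleyn_orientation (Suc m) z \<phi>"
  shows "kasteleyn_orientation m z \<phi>"
proof -
  have i: "internal_faces m z \<subseteq> internal_faces (Suc m) z" by (auto simp: internal_faces_def)
  then have "aztec_edges m z \<subseteq> aztec_edges (Suc m) z" unfolding aztec_edges_def by blast
  then show ?thesis using assms i unfolding kasteleyn_orientation_def by blast
qed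

lemma aztec_ratio_0: "aztec_ratio 0 z a \<phi> (a z)"
proof -
  obtain zi zj where z: "z = (zi, zj)" by (cases z)
  have "internal_faces 0 z = {}" by (auto simp: internal_faces_def z)
  then have "oriented_dimers 0 z = {{}}"
    by (auto simp: oriented_dimers_def aztec_edges_def aztec_vertices_def)
  then have Z: "aztec_Z 0 z b \<phi> = 1" for b by (simp add: aztec_Z_def)
  have "aztec_faces 0 z = {z}"
    by (auto simp: aztec_faces_def internal_faces_def open_faces_def z)
  then show ?thesis by (simp add: aztec_ratio_def Z)
qed

text \<open>Time runs forward while the size shrinks, and size 0 is reached at time
  \<open>t + n\<close>; the parity condition makes \<open>z\<close> a kept face at that time. One
  \<open>\<phi>\<close> serves all sizes because it restricts to smaller diamonds.\<close>

lemma aztec_ratio_solution: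
  fixes A :: "nat \<Rightarrow> face \<Rightarrow> real"
  assumes upd: "\<And>t i j. even (i + j + int t) \<Longrightarrow> face_dskp (A t) (A (Suc t)) (i, j)"
    and keep: "\<And>t i j. odd (i + j + int t) \<Longrightarrow> A (Suc t) (i, j) = A t (i, j)"
    and nz: "\<And>t f. A t f \<noteq> 0"
    and gap: "\<And>t p. vertex_gap (int t) (A t) p \<noteq> 0"
    and "odd (fst z + snd z + int t + int n)"
    and "kasteleyn_orientation n z \<phi>"
  shows "aztec_ratio n z (A t) \<phi> (A (t + n) z)"
  using assms(5,6)
proof (induction n arbitrary: t)
  case 0
  then show ?case using aztec_ratio_0[of z "A t"] by simp
next
  case (Suc m)
  have par: "even (fst z + snd z + int t + int m)" using Suc.prems(1) by simp
  have par': "odd (fst z + snd z + int (Suc t) + int m)"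
    using Suc.prems(1) by (simp only: of_nat_Suc ac_simps simp_thms)
  have IH: "aztec_ratio m z (A (Suc t)) \<phi> (A (t + Suc m) z)"
    using Suc.IH[of "Suc t", OF par' kasteleyn_orientation_Suc[OF Suc.prems(2)]] by simp
  show ?case
  proof (rule aztec_ratio_step[OF par Suc.prems(2) _ keep nz nz gap IH])
    show "face_dskp (A t) (A (Suc t)) f" if "f \<in> bottom_faces (int t) m z" for f
      using that upd by (cases f) (simp add: bottom_faces_def)
  qed
qed

section \<open>Polygons and their companions\<close>

lemma RP3_subspace: "p \<in> RP3 \<Longrightarrow> subspace p"
  by (simp add: RP3_def)

lemma RP3_nonzero: "p \<in> RP3 \<Longrightarrow> \<exists>x\<in>p. x \<noteq> 0"
  using dim_eq_0[of p] by (auto simp: RP3_def)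

lemma RP3_span:
  assumes "p \<in> RP3" "x \<in> p" "x \<noteq> 0"
  shows "p = span {x}"
proof -
  have "span {x} \<subseteq> p" using assms by (simp add: span_minimal RP3_subspace)
  moreover have "dim (span {x}) = 1" using assms by (simp add: dim_singleton)
  moreover have "dim p = 1" using assms by (simp add: RP3_def)
  ultimately show ?thesis
    using subspace_dim_equal[of "span {x}" p] RP3_subspace[OF assms(1)] by simp
qed

lemma RP3_subset_eq:
  assumes "p \<in> RP3" "subspace q" "dim q = 1" "p \<subseteq> q"
  shows "p = q"
  using subspace_dim_equal[of p q] assms by (simp add: RP3_def)

lemma subspace_line_through: "subspace (line_through p q)"
  by (simp add: line_through_def)

lemma subspace_plane_through: "subspace (plane_through p q r)"
  by (simp add: plane_through_def)

lemma line_through_sup: "p \<subseteq> line_through p q" "q \<subseteq> line_through p q"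
  by (auto simp: line_through_def span_base)

lemma plane_through_sup:
  "p \<subseteq> plane_through p q r" "q \<subseteq> plane_through p q r" "r \<subseteq> plane_through p q r"
  by (auto simp: plane_through_def span_base)

lemma line_through_minimal: "subspace X \<Longrightarrow> p \<subseteq> X \<Longrightarrow> q \<subseteq> X \<Longrightarrow> line_through p q \<subseteq> X"
  by (simp add: line_through_def span_minimal)

lemma line_through_commute: "line_through p q = line_through q p"
  by (simp add: line_through_def Un_commute)

lemma dim_span_Un_RP3: "p \<in> RP3 \<Longrightarrow> dim (span (A \<union> p)) \<le> dim A + 1"
proof -
  assume p: "p \<in> RP3"
  then obtain x where x: "x \<in> p" "x \<noteq> 0" using RP3_nonzero by blast
  have "span (A \<union> p) \<subseteq> span (insert x A)"
  proof (rule span_minimal)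
    have "p \<subseteq> span {x}" using RP3_span[OF p x] by simp
    also have "span {x} \<subseteq> span (insert x A)" by (rule span_mono) auto
    finally show "A \<union> p \<subseteq> span (insert x A)" using span_superset[of "insert x A"] by blast
  qed simp
  then have "dim (span (A \<union> p)) \<le> dim (insert x A)"
    by (metis dim_span dim_subset)
  also have "\<dots> \<le> dim A + 1" by (simp add: dim_insert)
  finally show ?thesis .
qed

lemma dim_plane_through_le:
  assumes "p \<in> RP3" "q \<in> RP3" "r \<in> RP3"
  shows "dim (plane_through p q r) \<le> 3"
proof -
  have "dim p = 1" using assms(1) by (simp add: RP3_def)
  moreover have "dim (p \<union> q) \<le> dim p + 1" using dim_span_Un_RP3[OF assms(2), of p] by simp
  moreover have "dim (p \<union> q \<union> r) \<le> dim (p \<union> q) + 1"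
    using dim_span_Un_RP3[OF assms(3), of "p \<union> q"] by simp
  ultimately show ?thesis by (simp add: plane_through_def)
qed

lemma dim_line_through:
  assumes "p \<in> RP3" "q \<in> RP3"
  shows "dim (line_through p q) = 2 \<longleftrightarrow> p \<noteq> q"
proof
  assume "dim (line_through p q) = 2"
  then show "p \<noteq> q" using assms by (auto simp: line_through_def RP3_def)
next
  assume ne: "p \<noteq> q"
  have le: "dim (line_through p q) \<le> 2"
    using dim_span_Un_RP3[OF assms(2), of p] assms(1) by (simp add: line_through_def RP3_def)
  show "dim (line_through p q) = 2"
  proof (rule ccontr)
    assume "dim (line_through p q) \<noteq> 2"
    then have le1: "dim (line_through p q) \<le> 1" using le by simp
    have "dim p \<le> dim (line_through p q)" by (rule dim_subset) (rule line_through_sup)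
    then have "dim (line_through p q) = 1" using le1 assms(1) by (simp add: RP3_def)
    then have "p = line_through p q" "q = line_through p q"
      using RP3_subset_eq[OF _ subspace_line_through _ ] line_through_sup assms by blast+
    then show False using ne by simp
  qed
qed

lemma line_through_eq:
  assumes "p \<in> RP3" "q \<in> RP3" "x \<in> RP3" "y \<in> RP3"
    and "x \<subseteq> line_through p q" "y \<subseteq> line_through p q" "x \<noteq> y"
  shows "line_through x y = line_through p q"
proof -
  have sub: "line_through x y \<subseteq> line_through p q"
    by (rule line_through_minimal[OF subspace_line_through assms(5,6)])
  have "dim (line_through p q) \<le> 2"
    using dim_span_Un_RP3[OF assms(2), of p] assms(1) by (simp add: line_through_def RP3_def)
  then show ?thesis
    using subspace_dim_equal[OF subspace_line_through subspace_line_through sub]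
      dim_line_through[OF assms(3,4)] assms(7) by simp
qed

text \<open>The invariant of the dynamics. The plane condition on a companion is replaced by a
  symmetric coplanarity of four points, which follows from it for the initial pair and is reproduced
  by \<open>shd_coplanar\<close> at each step.\<close>

definition shd_stage :: "polygon \<Rightarrow> polygon \<Rightarrow> bool" where
  "shd_stage v c \<longleftrightarrow> shd_map_defined (v, c) \<and>
     (\<forall>i. v i \<in> RP3 \<and> c i \<in> RP3 \<and> c i \<subseteq> line_through (v (i - 1)) (v (i + 1)) \<and>
       dim (v i \<union> v (i + 2) \<union> c i \<union> c (i + 2)) \<le> 3)"

context
  fixes v c :: polygon
  assumes stage: "shd_stage v c"
begin

lemma stage_RP3: "v i \<in> RP3" "c i \<in> RP3" "shd_polygon v i \<in> RP3" "shd_companion v c i \<in> RP3"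
proof -
  show "v i \<in> RP3" "c i \<in> RP3" using stage by (auto simp: shd_stage_def)
  have "dim (shd_polygon v i) = 1" "dim (shd_companion v c i) = 1"
    using stage by (simp_all add: shd_stage_def shd_map_defined_def)
  then show "shd_polygon v i \<in> RP3" "shd_companion v c i \<in> RP3"
    by (simp_all add: RP3_def shd_polygon_def shd_companion_def subspace_inter
        subspace_line_through subspace_plane_through)
qed

lemma stage_companion: "c i \<subseteq> line_through (v (i - 1)) (v (i + 1))"
  using stage by (auto simp: shd_stage_def)

lemma stage_dist:
  "v (i - 1) \<noteq> v (i + 1)" "c (i - 1) \<noteq> c (i + 1)" "shd_polygon v (i - 1) \<noteq> shd_polygon v (i + 1)"
proof -
  have "dim (line_through (v (i - 1)) (v (i + 1))) = 2" "dim (line_through (c (i - 1)) (c (i + 1))) = 2"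
    "dim (line_through (shd_polygon v (i - 1)) (shd_polygon v (i + 1))) = 2"
    using stage by (simp_all add: shd_stage_def shd_map_defined_def)
  then show "v (i - 1) \<noteq> v (i + 1)" "c (i - 1) \<noteq> c (i + 1)"
    "shd_polygon v (i - 1) \<noteq> shd_polygon v (i + 1)"
    by (simp_all only: dim_line_through stage_RP3 simp_thms)
qed

lemma polygon_subset:
  "shd_polygon v i \<subseteq> line_through (v (i - 1)) (v (i + 1))"
  "shd_polygon v i \<subseteq> plane_through (v (i - 2)) (v i) (v (i + 2))"
  by (auto simp: shd_polygon_def)

lemma companion_subset:
  "shd_companion v c i \<subseteq> line_through (c (i - 1)) (c (i + 1))"
  "shd_companion v c i \<subseteq> line_through (shd_polygon v (i - 1)) (shd_polygon v (i + 1))"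
  by (auto simp: shd_companion_def)

text \<open>Where the map is defined the intersection is a single point, so any point found in it is
  the new vertex. Unwanted coincidences among iterates are derived in this way.\<close>

lemma polygon_eqI:
  assumes "x \<in> RP3" "x \<subseteq> line_through (v (i - 1)) (v (i + 1))"
    "x \<subseteq> plane_through (v (i - 2)) (v i) (v (i + 2))"
  shows "shd_polygon v i = x"
  using RP3_subset_eq[OF assms(1), of "shd_polygon v i"] assms(2,3) stage_RP3(3)[of i]
  by (auto simp: shd_polygon_def RP3_def)

lemma companion_eqI:
  assumes "x \<in> RP3" "x \<subseteq> line_through (c (i - 1)) (c (i + 1))"
    "x \<subseteq> line_through (shd_polygon v (i - 1)) (shd_polygon v (i + 1))"
  shows "shd_companion v c i = x"
  using RP3_subset_eq[OF assms(1), of "shd_companion v c i"] assms(2,3) stage_RP3(4)[of i]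
  by (auto simp: shd_companion_def RP3_def)

lemma line_subset_plane:
  "line_through (v (i - 2)) (v i) \<subseteq> plane_through (v (i - 2)) (v i) (v (i + 2))"
  "line_through (v i) (v (i + 2)) \<subseteq> plane_through (v (i - 2)) (v i) (v (i + 2))"
  by (rule line_through_minimal[OF subspace_plane_through]; rule plane_through_sup)+

lemma companion_in_plane:
  "c (i - 1) \<subseteq> plane_through (v (i - 2)) (v i) (v (i + 2))"
  "c (i + 1) \<subseteq> plane_through (v (i - 2)) (v i) (v (i + 2))"
  using stage_companion[of "i - 1"] stage_companion[of "i + 1"] line_subset_plane[of i]
  by (simp_all add: algebra_simps)

lemma companion_line_in_plane:
  "line_through (c (i - 1)) (c (i + 1)) \<subseteq> plane_through (v (i - 2)) (v i) (v (i + 2))"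
  by (rule line_through_minimal[OF subspace_plane_through companion_in_plane])

text \<open>The two lines lie in a common plane, hence meet, and the first one lies in the plane
  that cuts out the new vertex.\<close>

lemma polygon_on_companion_line: "shd_polygon v i \<subseteq> line_through (c (i - 1)) (c (i + 1))"
proof -
  let ?L = "line_through (c (i - 1)) (c (i + 1))" and ?M = "line_through (v (i - 1)) (v (i + 1))"
  let ?W = "span (v (i - 1) \<union> v (i + 1) \<union> c (i - 1) \<union> c (i + 1))"
  have "\<forall>k. dim (v k \<union> v (k + 2) \<union> c k \<union> c (k + 2)) \<le> 3"
    using stage by (simp add: shd_stage_def)
  from this[rule_format, of "i - 1"] have W: "dim ?W \<le> 3" by (simp add: algebra_simps)
  have "?L \<subseteq> ?W" "?M \<subseteq> ?W"
    by (rule line_through_minimal; auto intro!: span_base)+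
  then have "{x + y |x y. x \<in> ?L \<and> y \<in> ?M} \<subseteq> ?W"
    by (auto intro: span_add)
  then have "dim {x + y |x y. x \<in> ?L \<and> y \<in> ?M} \<le> 3"
    using dim_subset W le_trans by blast
  moreover have "dim {x + y |x y. x \<in> ?L \<and> y \<in> ?M} + dim (?L \<inter> ?M) = dim ?L + dim ?M"
    by (rule dim_sums_Int[OF subspace_line_through subspace_line_through])
  moreover have "dim ?L = 2" "dim ?M = 2"
    by (simp_all only: dim_line_through[OF stage_RP3(2) stage_RP3(2)]
       dim_line_through[OF stage_RP3(1) stage_RP3(1)] stage_dist simp_thms)
  ultimately have "dim (?L \<inter> ?M) \<ge> 1" by linarith
  moreover have "?L \<inter> ?M \<subseteq> shd_polygon v i"
    using companion_line_in_plane[of i] by (auto simp: shd_polygon_def)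
  moreover have "subspace (?L \<inter> ?M)" by (simp add: subspace_inter subspace_line_through)
  ultimately have "?L \<inter> ?M = shd_polygon v i"
    using subspace_dim_equal[of "?L \<inter> ?M" "shd_polygon v i"] stage_RP3(3)[of i]
    by (simp add: RP3_def)
  then show ?thesis by blast
qed

text \<open>The new points with index \<open>i\<close> lie on the line of \<open>c (i - 1)\<close>
  and \<open>c (i + 1)\<close>, those with index \<open>i + 2\<close> on the line of
  \<open>c (i + 1)\<close> and \<open>c (i + 3)\<close>; two lines with a common point lie in a
  plane.\<close>

lemma shd_coplanar:
  "dim (shd_polygon v i \<union> shd_polygon v (i + 2) \<union> shd_companion v c i \<union> shd_companion v c (i + 2)) \<le> 3"
proof -
  let ?P = "plane_through (c (i - 1)) (c (i + 1)) (c (i + 3))"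
  have L: "line_through (c (i - 1)) (c (i + 1)) \<subseteq> ?P" "line_through (c (i + 1)) (c (i + 3)) \<subseteq> ?P"
    by (rule line_through_minimal[OF subspace_plane_through]; rule plane_through_sup)+
  have "shd_polygon v i \<union> shd_polygon v (i + 2) \<union> shd_companion v c i \<union> shd_companion v c (i + 2) \<subseteq> ?P"
    using polygon_on_companion_line[of i] polygon_on_companion_line[of "i + 2"]
      companion_subset(1)[of i] companion_subset(1)[of "i + 2"] L by (simp add: algebra_simps) blast
  then have "dim (shd_polygon v i \<union> shd_polygon v (i + 2) \<union> shd_companion v c i \<union> shd_companion v c (i + 2))
     \<le> dim ?P" by (rule dim_subset)
  also have "\<dots> \<le> 3" by (rule dim_plane_through_le; rule stage_RP3)
  finally show ?thesis .
qed

lemma shd_stage_next: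
  assumes "shd_map_defined (shd_polygon v, shd_companion v c)"
  shows "shd_stage (shd_polygon v) (shd_companion v c)"
  unfolding shd_stage_def using assms stage_RP3(3,4) companion_subset(2) shd_coplanar by auto

text \<open>Otherwise \<open>v i\<close> would be the new vertex both at \<open>i - 1\<close> and at
  \<open>i + 1\<close>, and these two have to span a line.\<close>

lemma not_collinear: "\<not> v i \<subseteq> line_through (v (i - 1)) (v (i + 1))"
proof
  assume col: "v i \<subseteq> line_through (v (i - 1)) (v (i + 1))"
  have "shd_polygon v (i + 1) = v i"
  proof (rule polygon_eqI)
    show "v i \<subseteq> line_through (v (i + 1 - 1)) (v (i + 1 + 1))"
      using line_through_sup(1)[of "v i"] by simp
    show "v i \<subseteq> plane_through (v (i + 1 - 2)) (v (i + 1)) (v (i + 1 + 2))"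
      using line_subset_plane(1)[of "i + 1"] col by (simp add: algebra_simps)
  qed (rule stage_RP3)
  moreover have "shd_polygon v (i - 1) = v i"
  proof (rule polygon_eqI)
    show "v i \<subseteq> line_through (v (i - 1 - 1)) (v (i - 1 + 1))"
      using line_through_sup(2)[of "v i"] by simp
    show "v i \<subseteq> plane_through (v (i - 1 - 2)) (v (i - 1)) (v (i - 1 + 2))"
      using line_subset_plane(2)[of "i - 1"] col by (simp add: algebra_simps)
  qed (rule stage_RP3)
  ultimately show False using stage_dist(3)[of i] by simp
qed

end

section \<open>The quadrilaterals of the dynamics\<close>

definition repr :: "(real ^ 4) set \<Rightarrow> real ^ 4" where
  "repr p = (SOME x. x \<in> p \<and> x \<noteq> 0)"

text \<open>Two linear functionals take the place of the coordinates \<open>l\<close> and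
  \<open>3\<close>, so that they can be moved into general position.\<close>

definition proj :: "real ^ 4 \<Rightarrow> real ^ 4 \<Rightarrow> (real ^ 4) set \<Rightarrow> real" where
  "proj \<alpha> \<beta> p = (\<alpha> \<bullet> repr p) / (\<beta> \<bullet> repr p)"

lemma repr:
  assumes "p \<in> RP3"
  shows "repr p \<in> p" "repr p \<noteq> 0" "span {repr p} = p"
proof -
  show *: "repr p \<in> p" "repr p \<noteq> 0"
    using someI_ex[of "\<lambda>x. x \<in> p \<and> x \<noteq> 0"] RP3_nonzero[OF assms] by (auto simp: repr_def)
  show "span {repr p} = p" using RP3_span[OF assms *] by simp
qed

lemma proj_normalized:
  assumes "p \<in> RP3" "\<beta> \<bullet> repr p \<noteq> 0"
  obtains x where "span {x} = p" "\<beta> \<bullet> x = 1" "\<alpha> \<bullet> x = proj \<alpha> \<beta> p"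
proof
  let ?x = "(1 / (\<beta> \<bullet> repr p)) *\<^sub>R repr p"
  have "?x \<in> p" using repr(1)[OF assms(1)] RP3_subspace[OF assms(1)] by (simp add: subspace_scale)
  moreover have "?x \<noteq> 0" using repr(2)[OF assms(1)] assms(2) by simp
  ultimately show "span {?x} = p" using RP3_span[OF assms(1)] by simp
  show "\<beta> \<bullet> ?x = 1" using assms(2) by simp
  show "\<alpha> \<bullet> ?x = proj \<alpha> \<beta> p" by (simp add: proj_def)
qed

lemma line_through_span: "line_through (span {x}) (span {y}) = span {x, y}"
proof
  show "line_through (span {x}) (span {y}) \<subseteq> span {x, y}"
    by (rule line_through_minimal) (simp_all add: span_mono)
  have "x \<in> line_through (span {x}) (span {y})" "y \<in> line_through (span {x}) (span {y})"
    by (rule subsetD[OF line_through_sup(1)] subsetD[OF line_through_sup(2)]; simp add: span_base)+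
  then show "span {x, y} \<subseteq> line_through (span {x}) (span {y})"
    by (simp add: span_minimal subspace_line_through)
qed

lemma in_span_pair:
  fixes x y z :: "'a :: real_vector"
  assumes "x \<in> span {y, z}"
  shows "\<exists>a b. x = a *\<^sub>R y + b *\<^sub>R z"
proof -
  obtain a b where "x - a *\<^sub>R y = b *\<^sub>R z"
    using assms by (auto simp: span_breakdown_eq)
  then have "x = a *\<^sub>R y + b *\<^sub>R z" by (simp add: algebra_simps)
  then show ?thesis by blast
qed

lemma affine_point_on_line:
  assumes "span {f} \<subseteq> line_through (span {x}) (span {y})" "\<beta> \<bullet> f = 1" "\<beta> \<bullet> x = 1" "\<beta> \<bullet> y = 1"
  obtains l where "f = (1 - l) *\<^sub>R x + l *\<^sub>R y"
proof -
  have "f \<in> span {x, y}"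
    using assms(1) unfolding line_through_span by (meson in_mono singletonI span_base)
  then obtain a b where ab: "f = a *\<^sub>R x + b *\<^sub>R y" using in_span_pair by blast
  then have "a + b = 1" using assms(2-4) by (simp add: inner_right_distrib)
  then have "a = 1 - b" by simp
  then show ?thesis using ab that by blast
qed

lemma affine_pair_coeffs:
  assumes "span {x} \<noteq> span {y}" "\<beta> \<bullet> x = 1" "\<beta> \<bullet> y = 1"
    and "a *\<^sub>R x + b *\<^sub>R y = a' *\<^sub>R x + b' *\<^sub>R y"
  shows "a = a'" "b = b'"
proof -
  have ab: "a + b = a' + b'"
    using arg_cong[OF assms(4), of "\<lambda>v. \<beta> \<bullet> v"] assms(2,3) by (simp add: inner_right_distrib)
  then have b: "b = a' + b' - a" by simp
  have "(a - a') *\<^sub>R x = (b' - b) *\<^sub>R y" using assms(4) by (simp add: algebra_simps)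
  also have "b' - b = a - a'" using ab by simp
  finally have "(a - a') *\<^sub>R x = (a - a') *\<^sub>R y" .
  moreover have "x \<noteq> y" using assms(1) by auto
  ultimately show "a = a'" by simp
  then show "b = b'" using ab by simp
qed

text \<open>Menelaus: the sides of the complete quadrilateral are \<open>ENf\<close>, \<open>SWf\<close>, \<open>ESg\<close> and \<open>NWg\<close>.\<close>

lemma dskp_quadrilateral:
  assumes RP: "f \<in> RP3" "N \<in> RP3" "E \<in> RP3" "S \<in> RP3" "W \<in> RP3" "g \<in> RP3"
    and nz: "\<beta> \<bullet> repr f \<noteq> 0" "\<beta> \<bullet> repr N \<noteq> 0" "\<beta> \<bullet> repr E \<noteq> 0" "\<beta> \<bullet> repr S \<noteq> 0"
      "\<beta> \<bullet> repr W \<noteq> 0" "\<beta> \<bullet> repr g \<noteq> 0"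
    and ne: "E \<noteq> S" "N \<noteq> W" "proj \<alpha> \<beta> N \<noteq> proj \<alpha> \<beta> E" "proj \<alpha> \<beta> S \<noteq> proj \<alpha> \<beta> W"
    and l1: "f \<subseteq> line_through E N" and l2: "f \<subseteq> line_through S W"
    and int: "line_through E S \<inter> line_through N W = g"
  shows "dskp (proj \<alpha> \<beta> f) (proj \<alpha> \<beta> N) (proj \<alpha> \<beta> E) (proj \<alpha> \<beta> S) (proj \<alpha> \<beta> W) (proj \<alpha> \<beta> g)"
proof -
  obtain f' where f: "span {f'} = f" "\<beta> \<bullet> f' = 1" "\<alpha> \<bullet> f' = proj \<alpha> \<beta> f"
    using proj_normalized[OF RP(1) nz(1)] .
  obtain n where n: "span {n} = N" "\<beta> \<bullet> n = 1" "\<alpha> \<bullet> n = proj \<alpha> \<beta> N"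
    using proj_normalized[OF RP(2) nz(2)] .
  obtain e where e: "span {e} = E" "\<beta> \<bullet> e = 1" "\<alpha> \<bullet> e = proj \<alpha> \<beta> E"
    using proj_normalized[OF RP(3) nz(3)] .
  obtain s where s: "span {s} = S" "\<beta> \<bullet> s = 1" "\<alpha> \<bullet> s = proj \<alpha> \<beta> S"
    using proj_normalized[OF RP(4) nz(4)] .
  obtain w where w: "span {w} = W" "\<beta> \<bullet> w = 1" "\<alpha> \<bullet> w = proj \<alpha> \<beta> W"
    using proj_normalized[OF RP(5) nz(5)] .
  obtain g' where g: "span {g'} = g" "\<beta> \<bullet> g' = 1" "\<alpha> \<bullet> g' = proj \<alpha> \<beta> g"
    using proj_normalized[OF RP(6) nz(6)] .
  have gE: "g \<subseteq> line_through E S" "g \<subseteq> line_through N W" using int by auto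
  obtain l where l: "f' = (1 - l) *\<^sub>R e + l *\<^sub>R n"
    by (rule affine_point_on_line[of f' e n \<beta>]) (use l1 f n e in simp_all)
  obtain u where u: "f' = (1 - u) *\<^sub>R s + u *\<^sub>R w"
    by (rule affine_point_on_line[of f' s w \<beta>]) (use l2 f s w in simp_all)
  obtain r where r: "g' = (1 - r) *\<^sub>R e + r *\<^sub>R s"
    by (rule affine_point_on_line[of g' e s \<beta>]) (use gE g e s in simp_all)
  obtain t where t: "g' = (1 - t) *\<^sub>R n + t *\<^sub>R w"
    by (rule affine_point_on_line[of g' n w \<beta>]) (use gE g n w in simp_all)
  \<comment> \<open>The two expressions of \<open>f'\<close> are equated and rearranged,
    \<open>e\<close> and \<open>s\<close> on one side, \<open>n\<close> and \<open>w\<close> on the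
    other. The resulting vector lies on both remaining sides of the quadrilateral, hence is a
    multiple of \<open>g'\<close>; comparing coefficients gives all ratios in terms of
    \<open>k\<close>.\<close>
  define h where "h = (1 - l) *\<^sub>R e + (- (1 - u)) *\<^sub>R s"
  have h': "h = (- l) *\<^sub>R n + u *\<^sub>R w"
  proof -
    have "(1 - l) *\<^sub>R e + l *\<^sub>R n = (1 - u) *\<^sub>R s + u *\<^sub>R w" using l u by simp
    then show ?thesis unfolding h_def by (simp add: algebra_simps)
  qed
  have "h \<in> line_through E S"
    unfolding h_def e(1)[symmetric] s(1)[symmetric] line_through_span
    by (intro span_add span_scale span_base) auto
  moreover have "h \<in> line_through N W"
    unfolding h' n(1)[symmetric] w(1)[symmetric] line_through_span
    by (intro span_add span_scale span_base) auto
  ultimately have "h \<in> span {g'}" using int g(1) by blast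
  then obtain k where k: "h = k *\<^sub>R g'" by (auto simp: span_breakdown_eq)
  have "(1 - l) *\<^sub>R e + (- (1 - u)) *\<^sub>R s = (k * (1 - r)) *\<^sub>R e + (k * r) *\<^sub>R s"
    using k unfolding h_def r by (simp add: algebra_simps)
  from affine_pair_coeffs[OF _ e(2) s(2) this]
  have c1: "1 - l = k * (1 - r)" "- (1 - u) = k * r" using ne(1) e(1) s(1) by auto
  have "(- l) *\<^sub>R n + u *\<^sub>R w = (k * (1 - t)) *\<^sub>R n + (k * t) *\<^sub>R w"
    using k unfolding h' t by (simp add: algebra_simps)
  from affine_pair_coeffs[OF _ n(2) w(2) this]
  have c2: "- l = k * (1 - t)" "u = k * t" using ne(2) n(1) w(1) by auto
  define x nn ee ss ww y where "x = proj \<alpha> \<beta> f" and "nn = proj \<alpha> \<beta> N" and "ee = proj \<alpha> \<beta> E"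
    and "ss = proj \<alpha> \<beta> S" and "ww = proj \<alpha> \<beta> W" and "y = proj \<alpha> \<beta> g"
  have x1: "x = (1 - l) * ee + l * nn" and x2: "x = (1 - u) * ss + u * ww"
    and y2: "y = (1 - t) * nn + t * ww"
    using arg_cong[OF l, of "\<lambda>v. \<alpha> \<bullet> v"] arg_cong[OF u, of "\<lambda>v. \<alpha> \<bullet> v"]
      arg_cong[OF t, of "\<lambda>v. \<alpha> \<bullet> v"] f n e s w g
    by (simp_all add: inner_right_distrib x_def nn_def ee_def ss_def ww_def y_def)
  have ul: "u - l = k" using c2 by (simp add: algebra_simps)
  have k0: "k \<noteq> 0"
  proof
    assume "k = 0"
    then have "1 - l = 0" "l = 0" using c1(1) c2(1) by auto
    then show False by simp
  qed
  have det: "dskp_det x nn ee ss ww = (nn - ee) * (ss - ww) * k"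
  proof -
    have d: "nn - x = (1 - l) * (nn - ee)" "ee - x = - l * (nn - ee)"
      "ss - x = u * (ss - ww)" "ww - x = - (1 - u) * (ss - ww)"
      using x1 x2 by algebra+
    show ?thesis unfolding dskp_det_def d ul[symmetric] by (simp add: algebra_simps)
  qed
  have "dskp x nn ee ss ww y"
    unfolding dskp_def det
  proof
    show "(nn - ee) * (ss - ww) * k \<noteq> 0" using ne(3,4) k0 by (simp add: nn_def ee_def ss_def ww_def)
    have "nn - y = t * (nn - ww)" "ss - x = u * (ss - ww)" using y2 x2 by algebra+
    then show "(nn - y) * ((nn - ee) * (ss - ww) * k) = (nn - ee) * (nn - ww) * (ss - x)"
      using c2(2) by simp
  qed
  then show ?thesis by (simp add: x_def nn_def ee_def ss_def ww_def y_def)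
qed

lemma dskp_degenerate:
  assumes "n \<noteq> x" "s \<noteq> x"
  shows "dskp x n e s x e"
  using assms by (simp add: dskp_def dskp_det_def)

section \<open>Orbits of the dynamics and distinctness of neighbouring points\<close>

locale shd_orbit =
  fixes V C :: "nat \<Rightarrow> polygon"
  assumes stage: "shd_stage (V k) (C k)"
    and V_Suc: "V (Suc k) = shd_polygon (V k)"
    and C_Suc: "C (Suc k) = shd_companion (V k) (C k)"
begin

lemma V_RP3: "V k i \<in> RP3" and C_RP3: "C k i \<in> RP3"
  using stage_RP3[OF stage[of k]] by blast+

lemma C_line: "C k i \<subseteq> line_through (V k (i - 1)) (V k (i + 1))"
  by (rule stage_companion[OF stage])

lemma V_dist: "V k (i - 1) \<noteq> V k (i + 1)" and C_dist: "C k (i - 1) \<noteq> C k (i + 1)"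
  using stage_dist[OF stage[of k]] by blast+

lemma V_line: "V (Suc k) i \<subseteq> line_through (V k (i - 1)) (V k (i + 1))"
  unfolding V_Suc by (rule polygon_subset(1)[OF stage])

lemma V_C_line: "V (Suc k) i \<subseteq> line_through (C k (i - 1)) (C k (i + 1))"
  unfolding V_Suc by (rule polygon_on_companion_line[OF stage])

lemma C_C_line: "C (Suc k) i \<subseteq> line_through (C k (i - 1)) (C k (i + 1))"
  unfolding C_Suc by (rule companion_subset(1)[OF stage])

lemma V_eqI:
  assumes "x \<in> RP3" "x \<subseteq> line_through (V k (i - 1)) (V k (i + 1))"
    "x \<subseteq> line_through (V k (i - 2)) (V k i) \<or> x \<subseteq> line_through (V k i) (V k (i + 2))"
  shows "V (Suc k) i = x"
  unfolding V_Suc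
  by (rule polygon_eqI[OF stage assms(1,2)]) (use assms(3) line_subset_plane[OF stage] in blast)

lemma V_not_collinear: "\<not> V k i \<subseteq> line_through (V k (i - 1)) (V k (i + 1))"
  by (rule not_collinear[OF stage])

lemma C_neq_V: "C k i \<noteq> V k i"
  using C_line V_not_collinear by metis

text \<open>A coincidence would make the line of \<open>C k i\<close> and \<open>C k (i + 2)\<close>
  a short diagonal of \<open>V k\<close>. Then the new vertex at \<open>i + 1\<close> lies on two
  consecutive short diagonals and equals the new vertex at \<open>i + 2\<close>, which contradicts
  non-collinearity one step later.\<close>

lemma C_neq_V_next: "C k i \<noteq> V k (i + 1)"
proof
  assume eq: "C k i = V k (i + 1)"
  have l1: "V k (i + 1) \<subseteq> line_through (V k (i + 1)) (V k (i + 3))" by (rule line_through_sup)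
  have l2: "C k (i + 2) \<subseteq> line_through (V k (i + 1)) (V k (i + 3))"
    using C_line[of k "i + 2"] by (simp add: algebra_simps)
  have "C k i \<noteq> C k (i + 2)" using C_dist[of k "i + 1"] by (simp add: algebra_simps)
  then have "line_through (C k i) (C k (i + 2)) = line_through (V k (i + 1)) (V k (i + 3))"
    using l1 l2 eq by (intro line_through_eq V_RP3 C_RP3) simp_all
  then have "V (Suc k) (i + 1) \<subseteq> line_through (V k (i + 1)) (V k (i + 3))"
    using V_C_line[of k "i + 1"] by (simp add: algebra_simps)
  moreover have "V (Suc k) (i + 1) \<subseteq> line_through (V k i) (V k (i + 2))"
    using V_line[of k "i + 1"] by (simp add: algebra_simps)
  ultimately have "V (Suc k) (i + 2) = V (Suc k) (i + 1)"
    by (intro V_eqI V_RP3) (simp_all add: algebra_simps)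
  then show False
    using V_not_collinear[of "Suc k" "i + 1"] line_through_sup(2)[of "V (Suc k) (i + 2)" "V (Suc k) i"]
    by (simp add: algebra_simps)
qed

text \<open>The mirror image of \<open>C_neq_V_next\<close> under reversal of the indices.\<close>

lemma C_neq_V_prev: "C k i \<noteq> V k (i - 1)"
proof
  assume eq: "C k i = V k (i - 1)"
  have l1: "V k (i - 1) \<subseteq> line_through (V k (i - 3)) (V k (i - 1))" by (rule line_through_sup)
  have l2: "C k (i - 2) \<subseteq> line_through (V k (i - 3)) (V k (i - 1))"
    using C_line[of k "i - 2"] by (simp add: algebra_simps)
  have "C k (i - 2) \<noteq> C k i" using C_dist[of k "i - 1"] by (simp add: algebra_simps)
  then have "line_through (C k (i - 2)) (C k i) = line_through (V k (i - 3)) (V k (i - 1))"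
    using l1 l2 eq by (intro line_through_eq V_RP3 C_RP3) simp_all
  then have "V (Suc k) (i - 1) \<subseteq> line_through (V k (i - 3)) (V k (i - 1))"
    using V_C_line[of k "i - 1"] by (simp add: algebra_simps)
  moreover have "V (Suc k) (i - 1) \<subseteq> line_through (V k (i - 2)) (V k i)"
    using V_line[of k "i - 1"] by (simp add: algebra_simps)
  ultimately have "V (Suc k) (i - 2) = V (Suc k) (i - 1)"
    by (intro V_eqI V_RP3) (simp_all add: algebra_simps)
  then show False
    using V_not_collinear[of "Suc k" "i - 1"] line_through_sup(1)[of "V (Suc k) (i - 2)" "V (Suc k) i"]
    by (simp add: algebra_simps)
qed

text \<open>A common point would lie on both lines that define the next companion at
  \<open>i + 1\<close>, so this companion would coincide with the vertex before it.\<close>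

lemma V_Suc_neq_C: "V (Suc k) i \<noteq> C k i"
proof
  assume eq: "V (Suc k) i = C k i"
  have "C k i \<subseteq> line_through (C k i) (C k (i + 2))"
    "V (Suc k) i \<subseteq> line_through (V (Suc k) i) (V (Suc k) (i + 2))"
    by (rule line_through_sup)+
  then have "C (Suc k) (i + 1) = V (Suc k) i"
    unfolding C_Suc
    by (intro companion_eqI[OF stage] V_RP3) (simp_all add: eq V_Suc[symmetric] algebra_simps)
  then show False using C_neq_V_prev[of "Suc k" "i + 1"] by simp
qed

text \<open>A common point would lie on two consecutive short diagonals and hence also be the new
  vertex at \<open>i\<close>, which is excluded already.\<close>

lemma V_Suc_prev_neq_C: "V (Suc k) (i - 1) \<noteq> C k i"
proof
  assume eq: "V (Suc k) (i - 1) = C k i"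
  then have "C k i \<subseteq> line_through (V k (i - 2)) (V k i)"
    using V_line[of k "i - 1"] by (simp add: algebra_simps)
  then have "V (Suc k) i = C k i" by (intro V_eqI C_RP3 C_line disjI1)
  then show False using V_Suc_neq_C by blast
qed

end

text \<open>Injectivity is required on the set of points, not on indices: distinct points get
  distinct coordinates, while one point may still occur at several places.\<close>

locale shd_orbit_proj = shd_orbit +
  fixes \<alpha> \<beta> :: "real ^ 4"
  assumes \<beta>: "p \<in> range (case_prod V) \<union> range (case_prod C) \<Longrightarrow> \<beta> \<bullet> repr p \<noteq> 0"
    and \<alpha>: "p \<in> range (case_prod V) \<union> range (case_prod C) \<Longrightarrow> \<alpha> \<bullet> repr p \<noteq> 0"
    and inj: "inj_on (proj \<alpha> \<beta>) (range (case_prod V) \<union> range (case_prod C))"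
begin

abbreviation "X \<equiv> proj \<alpha> \<beta>"

lemma \<beta>V: "\<beta> \<bullet> repr (V k i) \<noteq> 0" and \<beta>C: "\<beta> \<bullet> repr (C k i) \<noteq> 0"
  by (rule \<beta>; force)+

lemma X_eq_iff:
  "X (V k i) = X (V k' i') \<longleftrightarrow> V k i = V k' i'" "X (V k i) = X (C k' i') \<longleftrightarrow> V k i = C k' i'"
  "X (C k i) = X (V k' i') \<longleftrightarrow> C k i = V k' i'" "X (C k i) = X (C k' i') \<longleftrightarrow> C k i = C k' i'"
  by (rule inj_on_eq_iff[OF inj]; force)+

lemma X_nonzero: "X (V k i) \<noteq> 0" "X (C k i) \<noteq> 0"
proof -
  have "\<alpha> \<bullet> repr (V k i) \<noteq> 0" "\<alpha> \<bullet> repr (C k i) \<noteq> 0" by (rule \<alpha>; force)+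
  then show "X (V k i) \<noteq> 0" "X (C k i) \<noteq> 0" using \<beta>V \<beta>C by (simp_all add: proj_def)
qed

text \<open>The sides are the two short diagonals through \<open>V k i\<close>, the line of the
  companions at \<open>i - 1\<close> and \<open>i + 1\<close>, and the line of the new vertices
  there; the last two meet in the new companion by definition.\<close>

lemma dskp_V_to_C:
  "dskp (X (V k i)) (X (V (Suc k) (i + 1))) (X (C k (i + 1))) (X (C k (i - 1)))
     (X (V (Suc k) (i - 1))) (X (C (Suc k) i))"
proof (rule dskp_quadrilateral)
  have nE: "V (Suc k) (i + 1) \<noteq> C k (i + 1)" "V (Suc k) (i - 1) \<noteq> C k (i - 1)"
    by (rule V_Suc_neq_C)+
  show "C k (i + 1) \<noteq> C k (i - 1)" using C_dist by metis
  show "V (Suc k) (i + 1) \<noteq> V (Suc k) (i - 1)" using V_dist by metis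
  show "X (V (Suc k) (i + 1)) \<noteq> X (C k (i + 1))" using nE by (simp add: X_eq_iff)
  show "X (C k (i - 1)) \<noteq> X (V (Suc k) (i - 1))" using nE by (simp add: X_eq_iff)
  have "line_through (C k (i + 1)) (V (Suc k) (i + 1)) = line_through (V k i) (V k (i + 2))"
    by (intro line_through_eq V_RP3 C_RP3 nE(1)[symmetric])
       (use C_line[of k "i + 1"] V_line[of k "i + 1"] in \<open>simp_all add: algebra_simps\<close>)
  then show "V k i \<subseteq> line_through (C k (i + 1)) (V (Suc k) (i + 1))"
    using line_through_sup by simp
  have "line_through (C k (i - 1)) (V (Suc k) (i - 1)) = line_through (V k (i - 2)) (V k i)"
    by (intro line_through_eq V_RP3 C_RP3 nE(2)[symmetric])
       (use C_line[of k "i - 1"] V_line[of k "i - 1"] in \<open>simp_all add: algebra_simps\<close>)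
  then show "V k i \<subseteq> line_through (C k (i - 1)) (V (Suc k) (i - 1))"
    using line_through_sup by simp
  show "line_through (C k (i + 1)) (C k (i - 1)) \<inter>
      line_through (V (Suc k) (i + 1)) (V (Suc k) (i - 1)) = C (Suc k) i"
    unfolding C_Suc V_Suc shd_companion_def
    by (simp add: line_through_commute)
qed (rule V_RP3 C_RP3 \<beta>V \<beta>C)+

lemma dskp_C_to_V:
  "dskp (X (C k i)) (X (C (Suc k) (i + 1))) (X (V (Suc k) (i + 1))) (X (V (Suc k) (i - 1)))
     (X (C (Suc k) (i - 1))) (X (V (Suc (Suc k)) i))"
proof (rule dskp_quadrilateral)
  have nE: "C (Suc k) (i + 1) \<noteq> V (Suc k) (i + 1)" "C (Suc k) (i - 1) \<noteq> V (Suc k) (i - 1)"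
    by (rule C_neq_V)+
  show "V (Suc k) (i + 1) \<noteq> V (Suc k) (i - 1)" using V_dist by metis
  show "C (Suc k) (i + 1) \<noteq> C (Suc k) (i - 1)" using C_dist by metis
  show "X (C (Suc k) (i + 1)) \<noteq> X (V (Suc k) (i + 1))" using nE by (simp add: X_eq_iff)
  show "X (V (Suc k) (i - 1)) \<noteq> X (C (Suc k) (i - 1))" using nE by (simp add: X_eq_iff)
  have "line_through (V (Suc k) (i + 1)) (C (Suc k) (i + 1)) = line_through (C k i) (C k (i + 2))"
    by (intro line_through_eq V_RP3 C_RP3 nE(1)[symmetric])
       (use C_C_line[of k "i + 1"] V_C_line[of k "i + 1"] in \<open>simp_all add: algebra_simps\<close>)
  then show "C k i \<subseteq> line_through (V (Suc k) (i + 1)) (C (Suc k) (i + 1))"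
    using line_through_sup by simp
  have "line_through (V (Suc k) (i - 1)) (C (Suc k) (i - 1)) = line_through (C k (i - 2)) (C k i)"
    by (intro line_through_eq V_RP3 C_RP3 nE(2)[symmetric])
       (use C_C_line[of k "i - 1"] V_C_line[of k "i - 1"] in \<open>simp_all add: algebra_simps\<close>)
  then show "C k i \<subseteq> line_through (V (Suc k) (i - 1)) (C (Suc k) (i - 1))"
    using line_through_sup by simp
  \<comment> \<open>The plane that cuts out the next vertex is replaced by the companion line inside
    it, which passes through that vertex as well.\<close>
  have "line_through (V (Suc k) (i - 1)) (V (Suc k) (i + 1)) \<inter>
      line_through (C (Suc k) (i - 1)) (C (Suc k) (i + 1)) = V (Suc (Suc k)) i"
  proof
    show "V (Suc (Suc k)) i \<subseteq> line_through (V (Suc k) (i - 1)) (V (Suc k) (i + 1)) \<inter>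
      line_through (C (Suc k) (i - 1)) (C (Suc k) (i + 1))"
      using V_line V_C_line by blast
    show "line_through (V (Suc k) (i - 1)) (V (Suc k) (i + 1)) \<inter>
      line_through (C (Suc k) (i - 1)) (C (Suc k) (i + 1)) \<subseteq> V (Suc (Suc k)) i"
      using companion_line_in_plane[OF stage[of "Suc k"], of i]
      unfolding V_Suc[of "Suc k"] shd_polygon_def[of "V (Suc k)"] by blast
  qed
  then show "line_through (V (Suc k) (i + 1)) (V (Suc k) (i - 1)) \<inter>
      line_through (C (Suc k) (i + 1)) (C (Suc k) (i - 1)) = V (Suc (Suc k)) i"
    by (simp add: line_through_commute)
qed (rule V_RP3 C_RP3 \<beta>V \<beta>C)+

end

section \<open>The dynamics as a dSKP solution\<close>

lemma div_mod_4:
  "d = 4 * q \<Longrightarrow> d div 4 = q \<and> d mod 4 = 0" "d = 4 * q + 1 \<Longrightarrow> d div 4 = q \<and> d mod 4 = 1"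
  "d = 4 * q + 2 \<Longrightarrow> d div 4 = q \<and> d mod 4 = 2" "d = 4 * q + 3 \<Longrightarrow> d div 4 = q \<and> d mod 4 = 3"
  for d q :: int
  by auto

lemma mod_4_cases:
  fixes d :: int
  obtains q where "d = 4 * q" | q where "d = 4 * q + 1" | q where "d = 4 * q + 2" | q where "d = 4 * q + 3"
proof -
  have "d = 4 * (d div 4) + d mod 4" by simp
  moreover have "d mod 4 = 0 \<or> d mod 4 = 1 \<or> d mod 4 = 2 \<or> d mod 4 = 3" by presburger
  ultimately show ?thesis using that by (metis add_0_right)
qed

context shd_orbit
begin

text \<open>
  The points at time \<open>t\<close>.  Two steps of the recurrence are one step of the dynamics together with a
  shift of \<open>i - j\<close> by 2.
\<close>

fun level_point :: "nat \<Rightarrow> face \<Rightarrow> (real ^ 4) set" where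
  "level_point t (i, j) =
     (let k = t div 2; d = i - j - 2 * int k; n = i + j - d div 4; r = d mod 4 in
      if even t then
        if r = 0 then C k n else if r = 1 then V (Suc k) n else if r = 2 then V k n else C k n
      else
        if r = 0 then V (Suc k) (n + 1) else if r = 1 then V (Suc k) n
        else if r = 2 then C (Suc k) n else C k n)"

lemma level_point_even:
  "i - j - 2 * int k = 4 * q \<Longrightarrow> level_point (2 * k) (i, j) = C k (i + j - q)"
  "i - j - 2 * int k = 4 * q + 1 \<Longrightarrow> level_point (2 * k) (i, j) = V (Suc k) (i + j - q)"
  "i - j - 2 * int k = 4 * q + 2 \<Longrightarrow> level_point (2 * k) (i, j) = V k (i + j - q)"
  "i - j - 2 * int k = 4 * q + 3 \<Longrightarrow> level_point (2 * k) (i, j) = C k (i + j - q)"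
  using div_mod_4[of "i - j - 2 * int k" q] by (simp_all add: Let_def)

lemma level_point_odd:
  "i - j - 2 * int k = 4 * q \<Longrightarrow> level_point (Suc (2 * k)) (i, j) = V (Suc k) (i + j - q + 1)"
  "i - j - 2 * int k = 4 * q + 1 \<Longrightarrow> level_point (Suc (2 * k)) (i, j) = V (Suc k) (i + j - q)"
  "i - j - 2 * int k = 4 * q + 2 \<Longrightarrow> level_point (Suc (2 * k)) (i, j) = C (Suc k) (i + j - q)"
  "i - j - 2 * int k = 4 * q + 3 \<Longrightarrow> level_point (Suc (2 * k)) (i, j) = C k (i + j - q)"
  using div_mod_4[of "i - j - 2 * int k" q] by (simp_all add: Let_def)

declare level_point.simps [simp del]

lemma level_point_range: "level_point t f \<in> range (case_prod V) \<union> range (case_prod C)"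
proof -
  obtain i j where f: "f = (i, j)" by (cases f)
  have "V k n \<in> range (case_prod V)" "C k n \<in> range (case_prod C)" for k n by force+
  then show ?thesis unfolding f by (simp add: level_point.simps Let_def)
qed

lemma level_point_keep:
  assumes "odd (i + j + int t)"
  shows "level_point (Suc t) (i, j) = level_point t (i, j)"
proof (cases "even t")
  case True
  then obtain k where k: "t = 2 * k" by blast
  have odd: "odd (i - j - 2 * int k)" using assms unfolding k by simp
  obtain q where "i - j - 2 * int k = 4 * q + 1 \<or> i - j - 2 * int k = 4 * q + 3"
    using odd by (cases "i - j - 2 * int k" rule: mod_4_cases) auto
  then show ?thesis unfolding k using level_point_even level_point_odd by metis
next
  case False
  then obtain k where k: "t = Suc (2 * k)" by (metis oddE Suc_eq_plus1)
  have even: "even (i - j - 2 * int k)" using assms unfolding k by simp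
  have S: "Suc t = 2 * Suc k" by (simp add: k)
  obtain q where "i - j - 2 * int k = 4 * q \<or> i - j - 2 * int k = 4 * q + 2"
    using even by (cases "i - j - 2 * int k" rule: mod_4_cases) auto
  then show ?thesis
  proof
    assume d: "i - j - 2 * int k = 4 * q"
    \<comment> \<open>Raising \<open>k\<close> by one lowers the difference by 2, which moves
      residue 0 to residue 2 and decreases the quotient.\<close>
    then have "i - j - 2 * int (Suc k) = 4 * (q - 1) + 2" by simp
    from level_point_even(3)[OF this] level_point_odd(1)[OF d] show ?thesis
      unfolding S unfolding k by (simp add: algebra_simps)
  next
    assume d: "i - j - 2 * int k = 4 * q + 2"
    then have "i - j - 2 * int (Suc k) = 4 * q" by simp
    from level_point_even(1)[OF this] level_point_odd(3)[OF d] show ?thesis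
      unfolding S unfolding k by (simp add: algebra_simps)
  qed
qed

lemma V_dist2: "V k n \<noteq> V k (n + 2)" and C_dist2: "C k n \<noteq> C k (n + 2)"
  using V_dist[of k "n + 1"] C_dist[of k "n + 1"] by (simp_all add: algebra_simps)

text \<open>Along this diagonal the residue is constant, so the two faces carry points of the same
  kind with indices two apart.\<close>

lemma level_point_gap_up:
  assumes "odd (i + j + int t)"
  shows "level_point t (i, j) \<noteq> level_point t (i + 1, j + 1)"
proof (cases "even t")
  case True
  then obtain k where k: "t = 2 * k" by blast
  have odd: "odd (i - j - 2 * int k)" using assms unfolding k by simp
  then obtain q where "i - j - 2 * int k = 4 * q + 1 \<or> i - j - 2 * int k = 4 * q + 3"
    by (cases "i - j - 2 * int k" rule: mod_4_cases) auto
  then show ?thesis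
  proof
    assume d: "i - j - 2 * int k = 4 * q + 1"
    then have "(i + 1) - (j + 1) - 2 * int k = 4 * q + 1" by simp
    from level_point_even(2)[OF this] level_point_even(2)[OF d] show ?thesis
      using V_dist2[of "Suc k" "i + j - q"] unfolding k by (simp add: algebra_simps)
  next
    assume d: "i - j - 2 * int k = 4 * q + 3"
    then have "(i + 1) - (j + 1) - 2 * int k = 4 * q + 3" by simp
    from level_point_even(4)[OF this] level_point_even(4)[OF d] show ?thesis
      using C_dist2[of k "i + j - q"] unfolding k by (simp add: algebra_simps)
  qed
next
  case False
  then obtain k where k: "t = Suc (2 * k)" by (metis oddE Suc_eq_plus1)
  have even: "even (i - j - 2 * int k)" using assms unfolding k by simp
  then obtain q where "i - j - 2 * int k = 4 * q \<or> i - j - 2 * int k = 4 * q + 2"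
    by (cases "i - j - 2 * int k" rule: mod_4_cases) auto
  then show ?thesis
  proof
    assume d: "i - j - 2 * int k = 4 * q"
    then have "(i + 1) - (j + 1) - 2 * int k = 4 * q" by simp
    from level_point_odd(1)[OF this] level_point_odd(1)[OF d] show ?thesis
      using V_dist2[of "Suc k" "i + j - q + 1"] unfolding k by (simp add: algebra_simps)
  next
    assume d: "i - j - 2 * int k = 4 * q + 2"
    then have "(i + 1) - (j + 1) - 2 * int k = 4 * q + 2" by simp
    from level_point_odd(3)[OF this] level_point_odd(3)[OF d] show ?thesis
      using C_dist2[of "Suc k" "i + j - q"] unfolding k by (simp add: algebra_simps)
  qed
qed

text \<open>Along this diagonal the residue changes by 2, so a vertex meets a companion; the four
  cases are four of the inequalities between vertices and companions of an orbit.\<close>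

lemma level_point_gap_down:
  assumes "odd (i + 1 + j + int t)"
  shows "level_point t (i, j + 1) \<noteq> level_point t (i + 1, j)"
proof (cases "even t")
  case True
  then obtain k where k: "t = 2 * k" by blast
  have odd: "odd (i - (j + 1) - 2 * int k)" using assms unfolding k by simp
  then obtain q where "i - (j + 1) - 2 * int k = 4 * q + 1 \<or> i - (j + 1) - 2 * int k = 4 * q + 3"
    by (cases "i - (j + 1) - 2 * int k" rule: mod_4_cases) auto
  then show ?thesis
  proof
    assume d: "i - (j + 1) - 2 * int k = 4 * q + 1"
    then have "(i + 1) - j - 2 * int k = 4 * q + 3" by simp
    from level_point_even(4)[OF this] level_point_even(2)[OF d] show ?thesis
      using V_Suc_neq_C[of k "i + j + 1 - q"] unfolding k by (simp add: algebra_simps)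
  next
    assume d: "i - (j + 1) - 2 * int k = 4 * q + 3"
    then have "(i + 1) - j - 2 * int k = 4 * (q + 1) + 1" by simp
    from level_point_even(2)[OF this] level_point_even(4)[OF d] show ?thesis
      using V_Suc_prev_neq_C[of k "i + j + 1 - q"] unfolding k by (simp add: algebra_simps)
  qed
next
  case False
  then obtain k where k: "t = Suc (2 * k)" by (metis oddE Suc_eq_plus1)
  have even: "even (i - (j + 1) - 2 * int k)" using assms unfolding k by simp
  then obtain q where "i - (j + 1) - 2 * int k = 4 * q \<or> i - (j + 1) - 2 * int k = 4 * q + 2"
    by (cases "i - (j + 1) - 2 * int k" rule: mod_4_cases) auto
  then show ?thesis
  proof
    assume d: "i - (j + 1) - 2 * int k = 4 * q"
    then have "(i + 1) - j - 2 * int k = 4 * q + 2" by simp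
    from level_point_odd(3)[OF this] level_point_odd(1)[OF d] show ?thesis
      using C_neq_V_next[of "Suc k" "i + j + 1 - q"] unfolding k by (simp add: algebra_simps)
  next
    assume d: "i - (j + 1) - 2 * int k = 4 * q + 2"
    then have "(i + 1) - j - 2 * int k = 4 * (q + 1)" by simp
    from level_point_odd(1)[OF this] level_point_odd(3)[OF d] show ?thesis
      using C_neq_V[of "Suc k" "i + j + 1 - q"] unfolding k by (simp add: algebra_simps)
  qed
qed

end

context shd_orbit_proj
begin

definition level :: "nat \<Rightarrow> face \<Rightarrow> real" where
  "level t f = X (level_point t f)"

text \<open>Residue 0 at even and 1 at odd times give the copying steps; residue 2 at even and 3 at
  odd times give the quadrilaterals \<open>dskp_V_to_C\<close> and
  \<open>dskp_C_to_V\<close>.\<close>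

lemma level_dskp:
  assumes "even (i + j + int t)"
  shows "face_dskp (level t) (level (Suc t)) (i, j)"
proof (cases "even t")
  case True
  then obtain k where k: "t = 2 * k" by blast
  have even: "even (i - j - 2 * int k)" using assms unfolding k by simp
  then obtain q where "i - j - 2 * int k = 4 * q \<or> i - j - 2 * int k = 4 * q + 2"
    by (cases "i - j - 2 * int k" rule: mod_4_cases) auto
  then show ?thesis
  proof
    assume d: "i - j - 2 * int k = 4 * q"
    then have nb: "i - (j + 1) - 2 * int k = 4 * (q - 1) + 3" "(i + 1) - j - 2 * int k = 4 * q + 1"
      "i - (j - 1) - 2 * int k = 4 * q + 1" "(i - 1) - j - 2 * int k = 4 * (q - 1) + 3" by simp_all
    define n where "n = i + j - q"
    have e: "i + (j + 1) - (q - 1) = n + 2" "(i + 1) + j - q = n + 1" "i + (j - 1) - q = n - 1"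
      "(i - 1) + j - (q - 1) = n" by (simp_all add: n_def)
    \<comment> \<open>The centre and its west neighbour are the same point, so the new value is that
      of the east neighbour.\<close>
    have "dskp (X (C k n)) (X (C k (n + 2))) (X (V (Suc k) (n + 1))) (X (V (Suc k) (n - 1)))
        (X (C k n)) (X (V (Suc k) (n + 1)))"
      by (rule dskp_degenerate)
         (simp_all add: X_eq_iff C_dist2[THEN not_sym] V_Suc_prev_neq_C)
    then show ?thesis
      unfolding face_dskp.simps level_def k level_point_even(1)[OF d] level_point_even(4)[OF nb(1)]
        level_point_even(2)[OF nb(2)] level_point_even(2)[OF nb(3)] level_point_even(4)[OF nb(4)]
        level_point_odd(1)[OF d] e n_def[symmetric] .
  next
    assume d: "i - j - 2 * int k = 4 * q + 2"
    then have nb: "i - (j + 1) - 2 * int k = 4 * q + 1" "(i + 1) - j - 2 * int k = 4 * q + 3"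
      "i - (j - 1) - 2 * int k = 4 * q + 3" "(i - 1) - j - 2 * int k = 4 * q + 1" by simp_all
    define n where "n = i + j - q"
    have e: "i + (j + 1) - q = n + 1" "(i + 1) + j - q = n + 1" "i + (j - 1) - q = n - 1"
      "(i - 1) + j - q = n - 1" by (simp_all add: n_def)
    show ?thesis
      unfolding face_dskp.simps level_def k level_point_even(3)[OF d] level_point_even(2)[OF nb(1)]
        level_point_even(4)[OF nb(2)] level_point_even(4)[OF nb(3)] level_point_even(2)[OF nb(4)]
        level_point_odd(3)[OF d] e n_def[symmetric] by (rule dskp_V_to_C)
  qed
next
  case False
  then obtain k where k: "t = Suc (2 * k)" by (metis oddE Suc_eq_plus1)
  have S: "Suc (Suc (2 * k)) = 2 * Suc k" by simp
  have odd: "odd (i - j - 2 * int k)" using assms unfolding k by simp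
  then obtain q where "i - j - 2 * int k = 4 * q + 1 \<or> i - j - 2 * int k = 4 * q + 3"
    by (cases "i - j - 2 * int k" rule: mod_4_cases) auto
  then show ?thesis
  proof
    assume d: "i - j - 2 * int k = 4 * q + 1"
    then have nb: "i - (j + 1) - 2 * int k = 4 * q" "(i + 1) - j - 2 * int k = 4 * q + 2"
      "i - (j - 1) - 2 * int k = 4 * q + 2" "(i - 1) - j - 2 * int k = 4 * q"
      and d': "i - j - 2 * int (Suc k) = 4 * (q - 1) + 3" by simp_all
    define n where "n = i + j - q"
    have e: "i + (j + 1) - q + 1 = n + 2" "(i + 1) + j - q = n + 1" "i + (j - 1) - q = n - 1"
      "(i - 1) + j - q + 1 = n" "i + j - (q - 1) = n + 1" by (simp_all add: n_def)
    have "C (Suc k) (n - 1) \<noteq> V (Suc k) n" using C_neq_V_next[of "Suc k" "n - 1"] by simp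
    then have "dskp (X (V (Suc k) n)) (X (V (Suc k) (n + 2))) (X (C (Suc k) (n + 1))) (X (C (Suc k) (n - 1)))
        (X (V (Suc k) n)) (X (C (Suc k) (n + 1)))"
      by (intro dskp_degenerate) (simp_all add: X_eq_iff V_dist2[THEN not_sym])
    then show ?thesis
      unfolding face_dskp.simps level_def k S level_point_odd(2)[OF d] level_point_odd(1)[OF nb(1)]
        level_point_odd(3)[OF nb(2)] level_point_odd(3)[OF nb(3)] level_point_odd(1)[OF nb(4)]
        level_point_even(4)[OF d'] e n_def[symmetric] .
  next
    assume d: "i - j - 2 * int k = 4 * q + 3"
    then have nb: "i - (j + 1) - 2 * int k = 4 * q + 2" "(i + 1) - j - 2 * int k = 4 * (q + 1)"
      "i - (j - 1) - 2 * int k = 4 * (q + 1)" "(i - 1) - j - 2 * int k = 4 * q + 2"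
      and d': "i - j - 2 * int (Suc k) = 4 * q + 1" by simp_all
    define n where "n = i + j - q"
    have e: "i + (j + 1) - q = n + 1" "(i + 1) + j - (q + 1) + 1 = n + 1" "i + (j - 1) - (q + 1) + 1 = n - 1"
      "(i - 1) + j - q = n - 1" by (simp_all add: n_def)
    show ?thesis
      unfolding face_dskp.simps level_def k S level_point_odd(4)[OF d] level_point_odd(3)[OF nb(1)]
        level_point_odd(1)[OF nb(2)] level_point_odd(1)[OF nb(3)] level_point_odd(3)[OF nb(4)]
        level_point_even(2)[OF d'] e n_def[symmetric] by (rule dskp_C_to_V)
  qed
qed

lemma level_nonzero: "level t f \<noteq> 0"
  using level_point_range[of t f] X_nonzero by (auto simp: level_def)

lemma level_gap: "vertex_gap (int t) (level t) p \<noteq> 0"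
proof -
  obtain x y where p: "p = (x, y)" by (cases p)
  have inj_level: "level t f = level t g \<longleftrightarrow> level_point t f = level_point t g" for f g
    unfolding level_def by (rule inj_on_eq_iff[OF inj level_point_range level_point_range])
  show ?thesis
  proof (cases "even (x + y + int t)")
    case True
    then have "odd (x + 1 + y + int t)" by presburger
    from level_point_gap_down[OF this] True show ?thesis by (simp add: p inj_level)
  next
    case False
    from level_point_gap_up[OF this] False show ?thesis by (simp add: p inj_level)
  qed
qed

lemma level_aztec_ratio:
  assumes "odd (fst z + snd z + int n)" "kasteleyn_orientation n z \<phi>"
  shows "aztec_ratio n z (level 0) \<phi> (level n z)"
proof -
  have keep: "level (Suc t) (i, j) = level t (i, j)" if "odd (i + j + int t)" for t i j
    unfolding level_def level_point_keep[OF that] ..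
  have "aztec_ratio n z (level 0) \<phi> (level (0 + n) z)"
    by (rule aztec_ratio_solution[OF level_dskp keep level_nonzero level_gap])
       (use assms in simp_all)
  then show ?thesis by simp
qed

end

section \<open>Generic projections and passage to the limit\<close>

lemma exists_near_avoiding_hyperplanes:
  fixes x :: "'a :: euclidean_space"
  assumes "countable U" "0 \<notin> U" "e > 0"
  shows "\<exists>y. dist y x < e \<and> (\<forall>u\<in>U. y \<bullet> u \<noteq> 0)"
proof (rule ccontr)
  assume "\<not> ?thesis"
  \<comment> \<open>Countably many hyperplanes form a negligible set, a nonempty ball does
    not.\<close>
  then have "ball x e \<subseteq> (\<Union>u\<in>U. {y. u \<bullet> y = 0})"
    by (force simp: dist_commute inner_commute)
  moreover have "negligible (\<Union>u\<in>U. {y. u \<bullet> y = 0})"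
    by (rule negligible_countable_Union) (use assms(1,2) in \<open>auto intro!: negligible_hyperplane\<close>)
  ultimately have "negligible (ball x e)" using negligible_subset by blast
  then show False using open_not_negligible[of "ball x e"] assms(3) by auto
qed

text \<open>With \<open>\<beta>\<close> chosen first, equality of the coordinates of two points is a
  linear condition on \<open>\<alpha>\<close> whose normal vector \<open>w (p, q)\<close> is nonzero
  for distinct points. So both choices avoid countably many hyperplanes.\<close>

lemma exists_generic_projection:
  assumes "countable P" "P \<subseteq> RP3" "e > 0"
  shows "\<exists>\<alpha> \<beta>. dist \<alpha> \<alpha>0 < e \<and> dist \<beta> \<beta>0 < e \<and>
    (\<forall>p\<in>P. \<alpha> \<bullet> repr p \<noteq> 0 \<and> \<beta> \<bullet> repr p \<noteq> 0) \<and> inj_on (proj \<alpha> \<beta>) P"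
proof -
  have "0 \<notin> repr ` P" using assms(2) repr(2) by (metis imageE subsetD)
  then obtain \<beta> where \<beta>: "dist \<beta> \<beta>0 < e" "\<And>p. p \<in> P \<Longrightarrow> \<beta> \<bullet> repr p \<noteq> 0"
    using exists_near_avoiding_hyperplanes[of "repr ` P" e \<beta>0] assms by auto
  define w where "w = (\<lambda>(p, q). (\<beta> \<bullet> repr q) *\<^sub>R repr p - (\<beta> \<bullet> repr p) *\<^sub>R repr q)"
  let ?Q = "{(p, q) \<in> P \<times> P. p \<noteq> q}"
  have w0: "w (p, q) \<noteq> 0" if pq: "p \<in> P" "q \<in> P" "p \<noteq> q" for p q
  proof
    assume "w (p, q) = 0"
    then have eq: "(\<beta> \<bullet> repr q) *\<^sub>R repr p = (\<beta> \<bullet> repr p) *\<^sub>R repr q" by (simp add: w_def)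
    have R: "p \<in> RP3" "q \<in> RP3" using pq assms(2) by auto
    have "(\<beta> \<bullet> repr q) *\<^sub>R repr p \<in> p" "(\<beta> \<bullet> repr p) *\<^sub>R repr q \<in> q"
      using R by (simp_all add: RP3_subspace repr subspace_scale)
    moreover have "(\<beta> \<bullet> repr q) *\<^sub>R repr p \<noteq> 0" using \<beta>(2)[OF pq(2)] repr(2)[OF R(1)] by simp
    ultimately have "p = q" using RP3_span R eq by metis
    then show False using pq(3) by simp
  qed
  have "countable ?Q"
    by (rule countable_subset[of _ "P \<times> P"]) (use assms(1) in auto)
  then have "countable (repr ` P \<union> w ` ?Q)"
    using assms(1) by (intro countable_Un countable_image)
  moreover have "0 \<notin> repr ` P \<union> w ` ?Q" using w0 \<open>0 \<notin> repr ` P\<close> by fastforce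
  ultimately obtain \<alpha> where \<alpha>: "dist \<alpha> \<alpha>0 < e" "\<And>u. u \<in> repr ` P \<union> w ` ?Q \<Longrightarrow> \<alpha> \<bullet> u \<noteq> 0"
    using exists_near_avoiding_hyperplanes assms(3) by meson
  have "inj_on (proj \<alpha> \<beta>) P"
  proof (rule inj_onI, rule ccontr)
    fix p q assume pq: "p \<in> P" "q \<in> P" "proj \<alpha> \<beta> p = proj \<alpha> \<beta> q" "p \<noteq> q"
    have "\<alpha> \<bullet> w (p, q) = 0"
      using pq(3) \<beta>(2)[OF pq(1)] \<beta>(2)[OF pq(2)]
      by (simp add: w_def proj_def inner_diff_right field_simps)
    moreover have "w (p, q) \<in> w ` ?Q" using pq by blast
    ultimately show False using \<alpha>(2) by blast
  qed
  moreover have "\<forall>p\<in>P. \<alpha> \<bullet> repr p \<noteq> 0" using \<alpha>(2) by blast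
  ultimately show ?thesis using \<alpha>(1) \<beta> by blast
qed

lemma affine_coord_repr:
  assumes p: "p \<in> RP3" and fin: "\<not> at_infinity p"
  shows "repr p $ 3 \<noteq> 0" "affine_coord l p = repr p $ l / repr p $ 3"
proof -
  obtain r where r: "r \<in> p" "r $ 3 \<noteq> 0" using fin by (auto simp: at_infinity_def)
  have sc: "\<exists>k. x = k *\<^sub>R repr p" if "x \<in> p" for x
    using that repr(3)[OF p] by (metis span_singleton rangeE)
  show r3: "repr p $ 3 \<noteq> 0" using sc[OF r(1)] r(2) by auto
  show "affine_coord l p = repr p $ l / repr p $ 3"
    unfolding affine_coord_def
  proof (rule the_equality)
    show "\<forall>r\<in>p. r \<noteq> 0 \<longrightarrow> repr p $ l / repr p $ 3 = r $ l / r $ 3"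
    proof (intro ballI impI)
      fix x assume "x \<in> p" "x \<noteq> 0"
      then obtain k where "x = k *\<^sub>R repr p" "k \<noteq> 0" using sc by force
      then show "repr p $ l / repr p $ 3 = x $ l / x $ 3" by simp
    qed
  qed (use repr[OF p] in blast)
qed

text \<open>\<open>aztec_Z\<close> is a polynomial in the weights, and the face to the right of an
  edge is an internal face or a neighbour of one, hence a face of the diamond.\<close>

lemma tendsto_aztec_Z:
  assumes "\<And>f. f \<in> aztec_faces n z \<Longrightarrow> ((\<lambda>s. a s f) \<longlongrightarrow> b f) F"
  shows "((\<lambda>s. aztec_Z n z (a s) \<phi>) \<longlongrightarrow> aztec_Z n z b \<phi>) F"
  unfolding aztec_Z_def
proof (intro tendsto_sum tendsto_prod tendsto_mult tendsto_const assms)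
  fix M e assume "M \<in> oriented_dimers n z" "e \<in> M"
  then have "e \<in> aztec_edges n z" by (auto simp: oriented_dimers_def)
  then obtain h where h: "h \<in> internal_faces n z" "e \<in> face_edges h"
    unfolding aztec_edges_def by blast
  obtain i j where ij: "h = (i, j)" by (cases h)
  obtain zi zj where z: "z = (zi, zj)" by (cases z)
  have "right_face e \<in> {(i, j), (i + 1, j), (i - 1, j), (i, j + 1), (i, j - 1)}"
    using h(2) unfolding ij face_edges_eq insert_iff empty_iff
    by (elim disjE; simp add: add.commute)
  then show "right_face e \<in> aztec_faces n z"
    using h(1) unfolding ij z aztec_faces_def internal_faces_def open_faces_def insert_iff empty_iff
    by (elim disjE) (auto split: if_splits)
qed


lemma shd_orbit_iterates:
  assumes v: "\<forall>i. v i \<in> RP3" and c: "companion v c" and g: "general_position v c"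
  shows "shd_orbit (\<lambda>k. fst ((shd_map ^^ k) (v, c))) (\<lambda>k. snd ((shd_map ^^ k) (v, c)))"
proof
  let ?T = "\<lambda>k. (shd_map ^^ k) (v, c)"
  have def: "shd_map_defined (?T k)" for k using g by (simp add: general_position_def)
  show V: "fst (?T (Suc k)) = shd_polygon (fst (?T k))"
    and C: "snd (?T (Suc k)) = shd_companion (fst (?T k)) (snd (?T k))" for k
    by (simp_all add: shd_map_def case_prod_beta)
  show "shd_stage (fst (?T k)) (snd (?T k))" for k
  proof (induction k)
    case 0
    have cR: "c i \<in> RP3" "c i \<subseteq> line_through (v (i - 1)) (v (i + 1))" for i
      using c by (auto simp: companion_def)
    have "dim (v i \<union> v (i + 2) \<union> c i \<union> c (i + 2)) \<le> 3" for i
    proof -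
      let ?P = "plane_through (v i) (v (i + 2)) (c i)"
      have "\<forall>j. c j \<subseteq> plane_through (v (j - 2)) (v j) (c (j - 2))"
        using c by (simp add: companion_def)
      from this[rule_format, of "i + 2"] have "c (i + 2) \<subseteq> ?P" by simp
      then have "v i \<union> v (i + 2) \<union> c i \<union> c (i + 2) \<subseteq> ?P"
        by (intro Un_least plane_through_sup)
      then have "dim (v i \<union> v (i + 2) \<union> c i \<union> c (i + 2)) \<le> dim ?P" by (rule dim_subset)
      also have "\<dots> \<le> 3" using v cR by (intro dim_plane_through_le) auto
      finally show ?thesis .
    qed
    then show ?case using def[of 0] v cR by (simp add: shd_stage_def)
  next
    case (Suc k)
    show ?case
      unfolding V C by (rule shd_stage_next[OF Suc]) (use def[of "Suc k"] V[of k] C[of k] in \<open>metis prod.collapse\<close>)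
  qed
qed

lemma tendsto_proj:
  assumes "p \<in> RP3" "\<not> at_infinity p"
    and "(\<alpha> \<longlongrightarrow> axis l 1) F" "(\<beta> \<longlongrightarrow> axis 3 1) F"
  shows "((\<lambda>s. proj (\<alpha> s) (\<beta> s) p) \<longlongrightarrow> affine_coord l p) F"
proof -
  have "((\<lambda>s. (\<alpha> s \<bullet> repr p) / (\<beta> s \<bullet> repr p)) \<longlongrightarrow> (axis l 1 \<bullet> repr p) / (axis 3 1 \<bullet> repr p)) F"
    by (intro tendsto_intros assms) (use affine_coord_repr(1)[OF assms(1,2)] in \<open>simp add: inner_axis'\<close>)
  then show ?thesis
    unfolding proj_def affine_coord_repr(2)[OF assms(1,2)] by (simp add: inner_axis')
qed

theorem theorem10p3:
  fixes v c :: polygon and l :: 4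
    and Tu :: "nat \<Rightarrow> int \<Rightarrow> real" and b :: "int \<Rightarrow> real" and a :: "face \<Rightarrow> real"
  assumes "\<forall>i. v i \<in> RP3"
    and "companion v c"
    and "general_position v c"
    and "l \<in> {0, 1, 2}"
    and "\<forall>k i. Tu k i = affine_coord l (fst ((shd_map ^^ k) (v, c)) i)"
    and "\<forall>i. b i = affine_coord l (c i)"
    and "a = shd_weight (Tu 0) (Tu 1) b"
  shows "\<forall>(i::int) (k::nat). k \<ge> 1 \<longrightarrow>
     (\<forall>\<phi>. kasteleyn_orientation (2 * k - 2) (shd_centre i k) \<phi> \<longrightarrow>
          aztec_Y_defined (2 * k - 2) (shd_centre i k) a \<phi> \<longrightarrow>
          Tu k i = aztec_Y (2 * k - 2) (shd_centre i k) a \<phi>)"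
proof (intro allI impI)
  fix i :: int and k :: nat and \<phi>
  assume k: "k \<ge> 1" and K: "kasteleyn_orientation (2 * k - 2) (shd_centre i k) \<phi>"
    and Y: "aztec_Y_defined (2 * k - 2) (shd_centre i k) a \<phi>"
  define V where "V = (\<lambda>k. fst ((shd_map ^^ k) (v, c)))"
  define C where "C = (\<lambda>k. snd ((shd_map ^^ k) (v, c)))"
  interpret shd_orbit V C
    unfolding V_def C_def by (rule shd_orbit_iterates[OF assms(1-3)])
  define n z where "n = 2 * k - 2" and "z = shd_centre i k"
  have n: "n = 2 * (k - 1)" by (simp add: n_def)
  \<comment> \<open>The centre has residue 1 at time \<open>2 * (k - 1)\<close>, where the vertices
    of generation \<open>k\<close> sit. The weights already contain generation 1, which is why the
    size is \<open>2 * k - 2\<close> and not \<open>2 * k\<close>.\<close>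
  have centre: "fst z - snd z - 2 * int (k - 1) = 4 * (if even i then 1 else 0) + 1"
    "fst z + snd z - (if even i then 1 else 0) = i"
    using k by (auto simp: z_def even_iff_mod_2_eq_zero[symmetric] of_nat_diff elim!: evenE oddE)
  have top: "level_point n z = V k i"
    using level_point_even(2)[of "fst z" "snd z" "k - 1", OF centre(1)] k
    unfolding n centre(2) by simp
  have par: "odd (fst z + snd z + int n)" using centre(2) unfolding n by (auto split: if_splits)
  let ?P = "range (case_prod V) \<union> range (case_prod C)"
  have "countable ?P" by simp
  moreover have "?P \<subseteq> RP3" using V_RP3 C_RP3 by auto
  ultimately have "\<forall>s. \<exists>\<alpha> \<beta>. dist \<alpha> (axis l 1) < inverse (real (Suc s)) \<and>
      dist \<beta> (axis 3 1) < inverse (real (Suc s)) \<and>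
      (\<forall>p\<in>?P. \<alpha> \<bullet> repr p \<noteq> 0 \<and> \<beta> \<bullet> repr p \<noteq> 0) \<and> inj_on (proj \<alpha> \<beta>) ?P"
    by (intro allI exists_generic_projection) simp_all
  then obtain \<alpha> \<beta> where \<alpha>: "\<And>s. dist (\<alpha> s) (axis l 1) < inverse (real (Suc s))"
    and \<beta>: "\<And>s. dist (\<beta> s) (axis 3 1) < inverse (real (Suc s))"
    and gen: "\<And>s. \<forall>p\<in>?P. \<alpha> s \<bullet> repr p \<noteq> 0 \<and> \<beta> s \<bullet> repr p \<noteq> 0" "\<And>s. inj_on (proj (\<alpha> s) (\<beta> s)) ?P"
    by metis
  have "(\<lambda>s. dist (\<alpha> s) (axis l 1)) \<longlonglongrightarrow> 0" "(\<lambda>s. dist (\<beta> s) (axis 3 1)) \<longlonglongrightarrow> 0"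
    by (rule tendsto_sandwich[OF _ _ tendsto_const LIMSEQ_inverse_real_of_nat];
        intro always_eventually allI zero_le_dist less_imp_le \<alpha> \<beta>)+
  then have lim\<alpha>: "\<alpha> \<longlonglongrightarrow> axis l 1" and lim\<beta>: "\<beta> \<longlonglongrightarrow> axis 3 1"
    by (simp_all only: tendsto_dist_iff[symmetric])
  have limV: "(\<lambda>s. proj (\<alpha> s) (\<beta> s) (V k i)) \<longlonglongrightarrow> Tu k i" for k i
    using tendsto_proj[OF V_RP3 _ lim\<alpha> lim\<beta>, of k i] assms(3,5)
    by (simp add: general_position_def V_def)
  have limC: "(\<lambda>s. proj (\<alpha> s) (\<beta> s) (C 0 i)) \<longlonglongrightarrow> b i" for i
    using tendsto_proj[OF C_RP3 _ lim\<alpha> lim\<beta>, of 0 i] assms(3,6)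
    by (simp add: general_position_def C_def)
  define L where "L = (\<lambda>s t f. proj (\<alpha> s) (\<beta> s) (level_point t f))"
  have lim0: "(\<lambda>s. L s 0 f) \<longlonglongrightarrow> a f" for f
  proof -
    obtain i j where f: "f = (i, j)" by (cases f)
    show ?thesis
      unfolding f assms(7) L_def level_point.simps shd_weight.simps Let_def
      using limV[of 0] limV[of 1] limC by auto
  qed
  have limtop: "(\<lambda>s. L s n z) \<longlonglongrightarrow> Tu k i"
    unfolding L_def top by (rule limV)
  have ratio: "aztec_ratio n z (L s 0) \<phi> (L s n z)" for s
  proof -
    interpret shd_orbit_proj V C "\<alpha> s" "\<beta> s"
      by unfold_locales (use gen[of s] in auto)
    have "level = L s" by (simp add: L_def level_def fun_eq_iff)
    then show ?thesis using level_aztec_ratio[OF par] K unfolding n_def z_def by simp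
  qed
  show "Tu k i = aztec_Y (2 * k - 2) (shd_centre i k) a \<phi>"
  \<comment> \<open>At size 0 \<open>aztec_Y\<close> is \<open>a z\<close> by convention and
    \<open>aztec_Y_defined\<close> provides no nonvanishing.\<close>
  proof (cases "n = 0")
    case True
    then have "Tu k i = a z" using LIMSEQ_unique[OF limtop] lim0[of z] by simp
    then show ?thesis using True by (simp add: aztec_Y_def n_def z_def)
  next
    case False
    then have nz: "\<And>f. f \<in> aztec_faces n z \<Longrightarrow> a f \<noteq> 0" and Z: "aztec_Z n z a \<phi> \<noteq> 0"
      using Y by (auto simp: aztec_Y_defined_def n_def z_def)
    have "(\<lambda>s. L s n z * aztec_Z n z (L s 0) \<phi>) \<longlonglongrightarrow> Tu k i * aztec_Z n z a \<phi>"
      by (intro tendsto_mult limtop tendsto_aztec_Z lim0)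
    moreover have "(\<lambda>s. (\<Prod>f\<in>aztec_faces n z. L s 0 f) * aztec_Z n z (\<lambda>f. inverse (L s 0 f)) \<phi>)
        \<longlonglongrightarrow> (\<Prod>f\<in>aztec_faces n z. a f) * aztec_Z n z (\<lambda>f. inverse (a f)) \<phi>"
      by (intro tendsto_mult tendsto_prod tendsto_aztec_Z tendsto_inverse lim0 nz)
    \<comment> \<open>The multiplied-out relation holds for every \<open>s\<close>, so the limits of
      its two sides agree; only then is the nonzero limit of the denominator divided out.\<close>
    ultimately have "Tu k i * aztec_Z n z a \<phi> =
        (\<Prod>f\<in>aztec_faces n z. a f) * aztec_Z n z (\<lambda>f. inverse (a f)) \<phi>"
      using ratio unfolding aztec_ratio_def by (metis (no_types, lifting) LIMSEQ_unique ext)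
    then have "Tu k i = aztec_Y n z a \<phi>"
      using Z False by (simp add: aztec_Y_def field_simps)
    then show ?thesis by (simp add: n_def z_def)
  qed
qed

end
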